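(* With notation as in the context, if $\overline{\mathbb M}=\mathbb G$, then the cut locus of $o$ is exactly $\mathbb M^c=\partial\mathbb M$, i.e. $\mathrm{Cut}_o=\mathbb G\setminus\mathbb M$.
   Context: Let $q,m\ge1$, $U^{(1)},\dots,U^{(m)}$ linearly independent real skew-symmetric $q\times q$ matrices; $\mathbb G=\mathbb R^q\times\mathbb R^m$ with law $(x,t)\cdot(x',t')=(x+x',t+t'+\frac12\langle\mathbb Ux,x'\rangle)$, $\langle\mathbb Ux,x'\rangle=(\langle U^{(j)}x,x'\rangle)_j$, identity $o$; $d(g)$ is the Carnot–Carathéodory distance from $o$ (infimum of $\int_0^1|x'|$ over absolutely continuous curves from $o$ to $g$ with $t'=\frac12\langle\mathbb Ux,x'\rangle$). $U(\tau)=i\sum_j\tau_jU^{(j)}$, $\Omega_*=\{\tau:\|U(\tau)\|<\pi\}$, $\phi((x,t);\tau)=\langle U(\tau)\cot U(\tau)x,x\rangle+4t\cdot\tau$. $\mathbb M$ is the set of $g$ such that $\phi(g;\cdot)$ has a nondegenerate critical point in $\Omega_*$ (an open set). $\mathrm{Cut}_o$ is the complement of $\{g:\ d^2$ is $C^\infty$ in a neighborhood of $g\}$. *)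

theory Defs
  imports "HOL-Analysis.Analysis"
begin

text \<open>Points of the group G = R^q x R^m are pairs (x,t) :: (real^'q) \<times> (real^'m).
  The structure is given by a family U :: 'm \<Rightarrow> real^'q^'q of real matrices.\<close>

text \<open>Horizontal curves from o: x(s) = int_0^s h, h in L^1([0,1]) (i.e. x absolutely
  continuous with x' = h a.e., x(0)=0), and t(s) = int_0^s 1/2 <U x, x'>.\<close>

definition hx :: "(real \<Rightarrow> real^'q) \<Rightarrow> real \<Rightarrow> real^'q" where
  "hx h s = integral {0..s} h"

definition ht :: "('m \<Rightarrow> real^'q^'q) \<Rightarrow> (real \<Rightarrow> real^'q) \<Rightarrow> real \<Rightarrow> real^'m" where
  "ht U h s = integral {0..s} (\<lambda>r. (1/2) *\<^sub>R (\<chi> j. (U j *v hx h r) \<bullet> h r))"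

text \<open>Carnot--Caratheodory distance from the identity o = (0,0).\<close>
definition cc_dist :: "('m::finite \<Rightarrow> real^'q^'q) \<Rightarrow> (real^'q::finite) \<times> (real^'m) \<Rightarrow> real" where
  "cc_dist U g = Inf {integral {0..1} (\<lambda>r. norm (h r)) | h.
      h absolutely_integrable_on {0..1} \<and> (hx h 1, ht U h 1) = g}"

text \<open>C-infinity on a set S: all iterated partial derivatives exist (as Frechet
  derivatives) and are continuous on S. D vs is the iterated partial derivative
  along the list vs of basis directions.\<close>
definition Cinf_on :: "'a::euclidean_space set \<Rightarrow> ('a \<Rightarrow> real) \<Rightarrow> bool" where
  "Cinf_on S f \<longleftrightarrow> (\<exists>D :: 'a list \<Rightarrow> 'a \<Rightarrow> real. D [] = f \<and>
      (\<forall>vs. continuous_on S (D vs)) \<and>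
      (\<forall>vs. \<forall>x\<in>S. (D vs has_derivative (\<lambda>v. \<Sum>b\<in>Basis. (v \<bullet> b) * D (b # vs) x)) (at x)))"

definition cut_locus :: "('m::finite \<Rightarrow> real^'q^'q) \<Rightarrow> ((real^'q::finite) \<times> (real^'m)) set" where
  "cut_locus U = - {g. \<exists>S. open S \<and> g \<in> S \<and> Cinf_on S (\<lambda>p. (cc_dist U p)\<^sup>2)}"

text \<open>U(tau) = i sum_j tau_j U^(j), a complex (Hermitian) matrix.\<close>
definition Utau :: "('m::finite \<Rightarrow> real^'q^'q) \<Rightarrow> real^'m \<Rightarrow> complex^'q::finite^'q" where
  "Utau U \<tau> = (\<chi> a b. \<i> * complex_of_real (\<Sum>j\<in>UNIV. \<tau>$j * (U j)$a$b))"

text \<open>Operator norm of a complex matrix acting on C^q.\<close>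
definition opnorm :: "complex^'q::finite^'q \<Rightarrow> real" where
  "opnorm A = onorm (\<lambda>v::complex^'q. A *v v)"

definition Omega_star :: "('m::finite \<Rightarrow> real^'q::finite^'q) \<Rightarrow> (real^'m) set" where
  "Omega_star U = {\<tau>. opnorm (Utau U \<tau>) < pi}"

text \<open>z cot z (extended by 1 at 0) and its Taylor coefficients at 0; z cot z as a
  matrix function is defined by its power series (radius pi).\<close>
definition zcot :: "complex \<Rightarrow> complex" where
  "zcot z = (if z = 0 then 1 else z * cot z)"

definition zcot_coeff :: "nat \<Rightarrow> complex" where
  "zcot_coeff n = (deriv ^^ n) zcot 0 / fact n"

definition cmatpow :: "complex^'q::finite^'q \<Rightarrow> nat \<Rightarrow> complex^'q^'q" where
  "cmatpow A n = (((**) A) ^^ n) (mat 1)"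

definition cmat_scale :: "complex \<Rightarrow> complex^'q::finite^'q \<Rightarrow> complex^'q^'q" where
  "cmat_scale c A = (\<chi> a b. c * A$a$b)"

definition mat_zcot :: "complex^'q::finite^'q \<Rightarrow> complex^'q^'q" where
  "mat_zcot A = (\<Sum>n. cmat_scale (zcot_coeff n) (cmatpow A n))"

text \<open>phi((x,t);tau) = <U(tau) cot U(tau) x, x> + 4 t.tau  (the quadratic form is real
  since U(tau)cot U(tau) is real symmetric; we take its real part).\<close>
definition phi :: "('m::finite \<Rightarrow> real^'q::finite^'q) \<Rightarrow> (real^'q) \<times> (real^'m) \<Rightarrow> real^'m \<Rightarrow> real" where
  "phi U g \<tau> = (let x = fst g; t = snd g; M = mat_zcot (Utau U \<tau>) in
     Re (\<Sum>a\<in>UNIV. \<Sum>b\<in>UNIV. M$a$b * complex_of_real (x$b) * complex_of_real (x$a))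
     + 4 * (t \<bullet> \<tau>))"

text \<open>Nondegenerate critical point: gradient vanishes and Hessian (derivative of the
  gradient) is injective, i.e. nonsingular.\<close>
definition nondeg_crit :: "(real^'m::finite \<Rightarrow> real) \<Rightarrow> real^'m \<Rightarrow> bool" where
  "nondeg_crit f \<tau> \<longleftrightarrow> (\<exists>G H. eventually (\<lambda>\<sigma>. (f has_derivative (\<lambda>h. G \<sigma> \<bullet> h)) (at \<sigma>)) (nhds \<tau>)
      \<and> G \<tau> = 0 \<and> (G has_derivative H) (at \<tau>) \<and> inj H)"

definition MM :: "('m::finite \<Rightarrow> real^'q::finite^'q) \<Rightarrow> ((real^'q) \<times> (real^'m)) set" where
  "MM U = {g. \<exists>\<tau>\<in>Omega_star U. nondeg_crit (phi U g) \<tau>}"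

end

theory Submission
  imports Defs "HOL-Complex_Analysis.Complex_Analysis"
begin

text \<open>
  Put \<open>J(\<tau>) = \<Sum>\<^sub>j \<tau>\<^sub>j U\<^sub>j\<close>, a real skew matrix, so that \<open>U(\<tau>) cot U(\<tau>) = J coth J\<close>. The operators
  \<open>K\<^sub>s = J coth (s J)\<close> satisfy the Riccati equation \<open>K\<^sub>s' = J\<^sup>2 - K\<^sub>s\<^sup>2\<close>, and integrating it along a
  horizontal curve gives \<open>\<phi>(g; \<tau>) \<le> L\<^sup>2\<close> for every \<open>\<tau> \<in> \<Omega>\<^sub>*\<close> and every curve of length \<open>L\<close> from \<open>o\<close>
  to \<open>g\<close>. The curve with velocity \<open>exp (2 r J(\<tau>)) \<zeta>\<close> attains this bound, hence \<open>\<tau>\<close> is critical for its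
  endpoint, and conversely a critical point \<open>\<theta>\<close> of \<open>\<phi>(g; \<cdot>)\<close> gives \<open>d(g)\<^sup>2 = \<phi>(g; \<theta>)\<close>. Nondegeneracy
  makes \<open>\<theta>\<close> a smooth function of \<open>g\<close>, so \<open>d\<^sup>2\<close> is smooth on \<open>MM\<close>.

  Conversely, let \<open>d\<^sup>2\<close> be smooth near \<open>g\<^sub>0\<close>. On the dense set \<open>MM\<close> the gradient of \<open>d\<^sup>2\<close> determines the
  geodesic parameters \<open>(\<zeta>, \<tau>)\<close> of a point, so by continuity the geodesic endpoint map is a left inverse of
  \<open>g \<mapsto> (\<zeta>(g), \<tau>(g))\<close> near \<open>g\<^sub>0\<close>. By invariance of domain the latter map is open; as \<open>\<tau>\<close> takes values in the
  closure of \<open>\<Omega>\<^sub>*\<close>, this forces \<open>\<tau>(g\<^sub>0) \<in> \<Omega>\<^sub>*\<close>. Differentiating the critical point equation in \<open>t\<close> shows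
  that the Hessian at \<open>\<tau>(g\<^sub>0)\<close> is invertible.
\<close>

subsection \<open>The Banach algebra of endomorphisms\<close>

text \<open>A quadratic form does not see the skew part of its operator, so \<open>J coth J\<close>
  may be replaced by \<open>Iop J\<close>, that is \<open>J coth J - J\<close>. This form is chosen
  because it inverts \<open>Eop J\<close>, the operator that sends the initial velocity of a
  geodesic to its horizontal endpoint. The two operators differ in reach: \<open>Eop\<close> is an
  entire series, continuous in every covector, while the series of \<open>Iop\<close> stops at
  \<open>pi\<close>, where \<open>Eop\<close> may cease to be invertible. Limits of covectors that
  may hit the boundary of \<open>Omega_star\<close> are therefore handled through \<open>Eop\<close>
  and \<open>Tend\<close>, and translated back only inside. No matrix is diagonalised: the identity
  behind \<open>Iop\<close> is one of real functions, carried over to operators through Taylor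
  coefficients. Nor does the argument go through minimisers at arbitrary points: the distance is
  computed only where a critical covector exists in \<open>Omega_star\<close>, and density carries
  the information to the other points.\<close>

text \<open>A copy of the bounded operators, since \<open>'a \<Rightarrow>\<^sub>L 'a\<close> cannot itself be made an instance of the
  algebra classes.\<close>
typedef (overloaded) 'a endo = "UNIV :: ('a::euclidean_space \<Rightarrow>\<^sub>L 'a) set"
  morphisms endo_blinfun Endo
  by simp

setup_lifting type_definition_endo

instantiation endo :: (euclidean_space) real_normed_vector
begin

lift_definition zero_endo :: "'a endo" is 0 .
lift_definition plus_endo :: "'a endo \<Rightarrow> 'a endo \<Rightarrow> 'a endo" is "(+)" .
lift_definition minus_endo :: "'a endo \<Rightarrow> 'a endo \<Rightarrow> 'a endo" is "(-)" .
lift_definition uminus_endo :: "'a endo \<Rightarrow> 'a endo" is uminus .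
lift_definition scaleR_endo :: "real \<Rightarrow> 'a endo \<Rightarrow> 'a endo" is scaleR .
lift_definition norm_endo :: "'a endo \<Rightarrow> real" is norm .
definition sgn_endo :: "'a endo \<Rightarrow> 'a endo" where "sgn_endo A = scaleR (inverse (norm A)) A"
definition dist_endo :: "'a endo \<Rightarrow> 'a endo \<Rightarrow> real" where "dist_endo A B = norm (A - B)"
definition uniformity_endo :: "('a endo \<times> 'a endo) filter" where
  "uniformity_endo = (INF e\<in>{0<..}. principal {(x, y). dist x y < e})"
definition open_endo :: "'a endo set \<Rightarrow> bool" where
  "open_endo S = (\<forall>x\<in>S. \<forall>\<^sub>F (x', y) in uniformity. x' = x \<longrightarrow> y \<in> S)"

instance
proof
  show "dist A B = norm (A - B)" for A B :: "'a endo" by (rule dist_endo_def)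
  show "sgn A = scaleR (inverse (norm A)) A" for A :: "'a endo" by (rule sgn_endo_def)
  show "norm (A + B) \<le> norm A + norm B" for A B :: "'a endo"
    by transfer (rule norm_triangle_ineq)
qed (rule uniformity_endo_def open_endo_def | transfer, simp add: algebra_simps)+

end

instantiation endo :: (euclidean_space) real_normed_algebra_1
begin

lift_definition one_endo :: "'a endo" is id_blinfun .
lift_definition times_endo :: "'a endo \<Rightarrow> 'a endo \<Rightarrow> 'a endo" is blinfun_compose .

instance
proof
  have nz: "\<exists>x::'a. x \<noteq> 0"
    using nonzero_Basis nonempty_Basis by blast
  show "norm (1::'a endo) = 1"
    using nz by transfer (metis norm_blinfun_id)
  show "(0::'a endo) \<noteq> 1"
    using nz by transfer (metis blinfun_apply_id_blinfun zero_blinfun.rep_eq)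
  show "norm (A * B) \<le> norm A * norm B" for A B :: "'a endo"
    by transfer (rule norm_blinfun_compose)
qed (transfer; rule blinfun_eqI; simp add: blinfun.bilinear_simps)+

end

lemma dist_endo_blinfun: "dist (endo_blinfun A) (endo_blinfun B) = dist A B"
  by (simp add: dist_norm norm_endo.rep_eq minus_endo.rep_eq)

instance endo :: (euclidean_space) banach
proof
  fix X :: "nat \<Rightarrow> 'a endo"
  assume "Cauchy X"
  then have "Cauchy (\<lambda>n. endo_blinfun (X n))"
    unfolding Cauchy_def dist_endo_blinfun .
  then obtain L where "(\<lambda>n. endo_blinfun (X n)) \<longlonglongrightarrow> L"
    using Cauchy_convergent convergent_def by blast
  then have "(\<lambda>n. endo_blinfun (X n)) \<longlonglongrightarrow> endo_blinfun (Endo L)"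
    by (simp add: Endo_inverse)
  then have "X \<longlonglongrightarrow> Endo L"
    unfolding lim_sequentially dist_endo_blinfun .
  then show "convergent X"
    by (auto simp: convergent_def)
qed

lift_definition app :: "'a::euclidean_space endo \<Rightarrow> 'a \<Rightarrow> 'a" (infixr "\<bullet>\<^sub>v" 75) is blinfun_apply .

lemma bounded_bilinear_app: "bounded_bilinear (app :: 'a::euclidean_space endo \<Rightarrow> _)"
proof
  show "\<exists>K. \<forall>(A::'a endo) x. norm (A \<bullet>\<^sub>v x) \<le> norm A * norm x * K"
    by (rule exI[of _ 1]) (auto, transfer, rule norm_blinfun)
qed (transfer; simp add: blinfun.bilinear_simps)+

interpretation app: bounded_bilinear "app :: 'a::euclidean_space endo \<Rightarrow> _"
  by (rule bounded_bilinear_app)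

lemma norm_app_le: "norm (A \<bullet>\<^sub>v x) \<le> norm A * norm x"
  by transfer (rule norm_blinfun)

lemma app_mult [simp]: "(A * B) \<bullet>\<^sub>v x = A \<bullet>\<^sub>v B \<bullet>\<^sub>v x"
  by transfer simp

lemma app_one [simp]: "1 \<bullet>\<^sub>v x = x"
  by transfer simp

lemma endo_eqI: "(\<And>x. A \<bullet>\<^sub>v x = B \<bullet>\<^sub>v x) \<Longrightarrow> A = B"
  by transfer (rule blinfun_eqI)

lemma norm_endo_le: "0 \<le> b \<Longrightarrow> (\<And>x. norm (A \<bullet>\<^sub>v x) \<le> b * norm x) \<Longrightarrow> norm A \<le> b"
  by transfer (rule norm_blinfun_bound)

definition lin :: "('a::euclidean_space \<Rightarrow> 'a) \<Rightarrow> 'a endo" where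
  "lin f = Endo (Blinfun f)"

lemma app_lin: "linear f \<Longrightarrow> lin f \<bullet>\<^sub>v x = f x"
  unfolding lin_def by (simp add: app.rep_eq Endo_inverse bounded_linear_Blinfun_apply linear_conv_bounded_linear)

subsection \<open>Functions of class \<open>C\<^sup>k\<close>\<close>

text \<open>Termwise differentiation needs tails that are small in operator norm. A linear map
  bounded by \<open>B n\<close> on the orthonormal basis has operator norm at most
  \<open>d * B n\<close>, so bounds on basis vectors suffice and only rescale the tolerance to
  \<open>e / d\<close>.\<close>

lemma has_derivative_suminf:
  fixes f :: "nat \<Rightarrow> 'a::euclidean_space \<Rightarrow> 'b::banach"
  assumes S: "open S" "convex S" and B: "summable B"
    and der: "\<And>n x. x \<in> S \<Longrightarrow> (f n has_derivative f' n x) (at x)"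
    and bf: "\<And>n x. x \<in> S \<Longrightarrow> norm (f n x) \<le> B n"
    and bd: "\<And>n x b. x \<in> S \<Longrightarrow> b \<in> Basis \<Longrightarrow> norm (f' n x b) \<le> B n"
    and x: "x \<in> S"
  shows "((\<lambda>x. \<Sum>n. f n x) has_derivative (\<lambda>h. \<Sum>n. f' n x h)) (at x)"
proof -
  define d where "d = real DIM('a)"
  have d0: "d > 0" by (simp add: d_def)
  have lin: "bounded_linear (f' n y)" if "y \<in> S" for n y
    using der[OF that] has_derivative_bounded_linear by blast
  have bound: "norm (f' n y h) \<le> d * B n * norm h" if "y \<in> S" for n y h
  proof -
    have "f' n y h = (\<Sum>b\<in>Basis. (h \<bullet> b) *\<^sub>R f' n y b)"
      by (subst euclidean_representation[of h, symmetric])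
         (simp add: bounded_linear.linear[OF lin[OF that]] linear_sum linear_cmul
           del: euclidean_representation)
    also have "norm \<dots> \<le> (\<Sum>b\<in>(Basis::'a set). norm h * B n)"
      by (rule sum_norm_le) (auto intro!: mult_mono bd that Basis_le_norm)
    finally show ?thesis by (simp add: d_def mult_ac)
  qed
  have sf': "summable (\<lambda>n. f' n y h)" if "y \<in> S" for y h
    by (rule summable_comparison_test'[of "\<lambda>n. d * B n * norm h"])
       (use B bound that in \<open>auto intro: summable_mult summable_mult2\<close>)
  have "\<exists>g. \<forall>y\<in>S. (\<lambda>n. f n y) sums g y \<and> (g has_derivative (\<lambda>h. \<Sum>n. f' n y h)) (at y within S)"
  proof (rule has_derivative_series[OF S(2)])
    show "(f n has_derivative f' n y) (at y within S)" if "y \<in> S" for n y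
      using der that has_derivative_at_withinI by blast
    show "x \<in> S" by fact
    show "(\<lambda>n. f n x) sums (\<Sum>n. f n x)"
      by (rule summable_sums, rule summable_comparison_test'[OF B]) (use bf x in auto)
    fix e :: real
    assume e: "e > 0"
    have "(\<lambda>n. \<Sum>k. B (k + n)) \<longlonglongrightarrow> 0"
      by (rule suminf_exist_split2[OF B])
    from tendstoD[OF this, of "e / d"] have "\<forall>\<^sub>F n in sequentially. norm (\<Sum>k. B (k + n)) < e / d"
      using e d0 by simp
    then show "\<forall>\<^sub>F n in sequentially. \<forall>y\<in>S. \<forall>h. norm ((\<Sum>i<n. f' i y h) - (\<Sum>n. f' n y h)) \<le> e * norm h"
    proof eventually_elim
      case (elim n)
      show ?case
      proof (intro ballI allI)
        fix y h assume y: "y \<in> S"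
        have sB: "summable (\<lambda>k. B (k + n))" using B by (rule summable_ignore_initial_segment)
        have "(\<Sum>i<n. f' i y h) - (\<Sum>n. f' n y h) = - (\<Sum>k. f' (k + n) y h)"
          using suminf_minus_initial_segment[OF sf'[OF y, of h], of n] by simp
        also have "norm \<dots> \<le> (\<Sum>k. d * norm h * B (k + n))"
          unfolding norm_minus_cancel
          by (rule norm_suminf_le)
             (use bound[OF y] sB in \<open>simp_all add: mult.assoc mult.left_commute[of "norm h"] mult.commute[of "norm h"] summable_mult summable_mult2\<close>)
        also have "\<dots> = d * norm h * (\<Sum>k. B (k + n))"
          by (rule suminf_mult[OF sB])
        also have "\<dots> \<le> d * norm h * (e / d)"
          using elim d0 by (intro mult_left_mono) auto
        finally show "norm ((\<Sum>i<n. f' i y h) - (\<Sum>n. f' n y h)) \<le> e * norm h"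
          using d0 by (simp add: mult_ac)
      qed
    qed
  qed
  then obtain g where g: "\<And>y. y \<in> S \<Longrightarrow> (\<lambda>n. f n y) sums g y"
    and dg: "(g has_derivative (\<lambda>h. \<Sum>n. f' n x h)) (at x within S)"
    using x by meson
  have "((\<lambda>x. \<Sum>n. f n x) has_derivative (\<lambda>h. \<Sum>n. f' n x h)) (at x within S)"
    by (rule has_derivative_transform[OF x _ dg]) (rule sums_unique[OF g, symmetric])
  then show ?thesis
    by (simp add: at_within_open[OF x S(1)])
qed

text \<open>Recursion through \<open>f' x v\<close> with \<open>v\<close> fixed keeps the codomain
  type unchanged, whereas operator-valued derivatives would change it at every order. In finite
  dimension both give the same class.\<close>

primrec Ck :: "nat \<Rightarrow> 'a::euclidean_space set \<Rightarrow> ('a \<Rightarrow> 'b::real_normed_vector) \<Rightarrow> bool" where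
  "Ck 0 S f \<longleftrightarrow> continuous_on S f"
| "Ck (Suc k) S f \<longleftrightarrow> (\<exists>f'. (\<forall>x\<in>S. (f has_derivative f' x) (at x)) \<and> (\<forall>v. Ck k S (\<lambda>x. f' x v)))"

lemma Ck_SucI:
  "(\<And>x. x \<in> S \<Longrightarrow> (f has_derivative f' x) (at x)) \<Longrightarrow> (\<And>v. Ck k S (\<lambda>x. f' x v)) \<Longrightarrow> Ck (Suc k) S f"
  by auto

lemma Ck_cong:
  assumes "open S" "Ck k S f" "\<And>x. x \<in> S \<Longrightarrow> f x = g x"
  shows "Ck k S g"
proof (cases k)
  case 0
  then show ?thesis using assms by (auto cong: continuous_on_cong)
next
  case (Suc l)
  then obtain f' where f': "\<And>x. x \<in> S \<Longrightarrow> (f has_derivative f' x) (at x)" "\<And>v. Ck l S (\<lambda>x. f' x v)"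
    using assms by auto
  have "(g has_derivative f' x) (at x)" if "x \<in> S" for x
    by (rule has_derivative_transform_within_open[OF f'(1)[OF that] assms(1) that]) (use assms in auto)
  then show ?thesis using f'(2) Suc by auto
qed

text \<open>Replaces the derivative under the existential quantifier by a canonical one, so that
  derivatives coming from different neighbourhoods or different orders agree.\<close>

lemma Ck_frechet_derivative:
  assumes "open S" "Ck (Suc k) S f"
  shows "\<And>x. x \<in> S \<Longrightarrow> (f has_derivative frechet_derivative f (at x)) (at x)"
    and "Ck k S (\<lambda>x. frechet_derivative f (at x) v)"
proof -
  obtain f' where f': "\<And>x. x \<in> S \<Longrightarrow> (f has_derivative f' x) (at x)" "\<And>v. Ck k S (\<lambda>x. f' x v)"
    using assms by auto
  have eq: "frechet_derivative f (at x) = f' x" if "x \<in> S" for x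
    using frechet_derivative_at[OF f'(1)[OF that]] by simp
  show "(f has_derivative frechet_derivative f (at x)) (at x)" if "x \<in> S" for x
    using f'(1) that by (simp add: eq)
  show "Ck k S (\<lambda>x. frechet_derivative f (at x) v)"
    by (rule Ck_cong[OF assms(1) f'(2)[of v]]) (simp add: eq)
qed

lemma Ck_local:
  assumes "\<And>x. x \<in> S \<Longrightarrow> \<exists>T. open T \<and> x \<in> T \<and> Ck k T f"
  shows "Ck k S f"
  using assms
proof (induction k arbitrary: f)
  case 0
  then have "continuous (at x) f" if "x \<in> S" for x
    using that by (metis Ck.simps(1) continuous_on_eq_continuous_at)
  then show ?case by (simp add: continuous_at_imp_continuous_on)
next
  case (Suc k)
  show ?case
  proof (rule Ck_SucI[of _ _ "\<lambda>x. frechet_derivative f (at x)"])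
    show "(f has_derivative frechet_derivative f (at x)) (at x)" if "x \<in> S" for x
    proof -
      obtain T where T: "open T" "x \<in> T" "Ck (Suc k) T f" using Suc.prems[OF \<open>x \<in> S\<close>] by meson
      show ?thesis by (rule Ck_frechet_derivative(1)[OF T(1,3,2)])
    qed
    show "Ck k S (\<lambda>x. frechet_derivative f (at x) v)" for v
    proof (rule Suc.IH)
      fix x assume "x \<in> S"
      then obtain T where T: "open T" "x \<in> T" "Ck (Suc k) T f" using Suc.prems by meson
      show "\<exists>T. open T \<and> x \<in> T \<and> Ck k T (\<lambda>x. frechet_derivative f (at x) v)"
        by (intro exI[of _ T] conjI T Ck_frechet_derivative(2)[OF T(1,3)])
    qed
  qed
qed

lemma Cinf_on_if_Ck:
  fixes f :: "'a::euclidean_space \<Rightarrow> real"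
  assumes S: "open S" and f: "\<And>k. Ck k S f"
  shows "Cinf_on S f"
proof -
  \<comment> \<open>Each \<open>Ck k\<close> brings its own witnesses; iterating the canonical
    derivative gives one family that serves all orders at once.\<close>
  define D where "D = rec_list f (\<lambda>b (vs::'a list) g x. frechet_derivative g (at x) b)"
  have D: "D [] = f" "D (b # vs) = (\<lambda>x. frechet_derivative (D vs) (at x) b)" for b vs
    by (simp_all add: D_def)
  have Dk: "Ck k S (D vs)" for k vs
  proof (induction vs arbitrary: k)
    case Nil
    then show ?case by (simp add: D f)
  next
    case (Cons b vs)
    show ?case unfolding D by (rule Ck_frechet_derivative(2)[OF S Cons])
  qed
  have "(D vs has_derivative (\<lambda>v. \<Sum>b\<in>Basis. (v \<bullet> b) * D (b # vs) x)) (at x)" if "x \<in> S" for vs x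
  proof -
    have der: "(D vs has_derivative frechet_derivative (D vs) (at x)) (at x)"
      by (rule Ck_frechet_derivative(1)[OF S Dk that])
    then have lin: "linear (frechet_derivative (D vs) (at x))"
      using has_derivative_linear by blast
    have "frechet_derivative (D vs) (at x) = (\<lambda>v. \<Sum>b\<in>Basis. (v \<bullet> b) * D (b # vs) x)"
      (is "?L = _")
    proof
      fix v
      have "?L (\<Sum>b\<in>Basis. (v \<bullet> b) *\<^sub>R b) = (\<Sum>b\<in>Basis. (v \<bullet> b) * ?L b)"
        by (simp add: linear_sum[OF lin] linear_cmul[OF lin] del: euclidean_representation)
      then show "?L v = (\<Sum>b\<in>Basis. (v \<bullet> b) * D (b # vs) x)"
        by (simp add: D euclidean_representation)
    qed
    then show ?thesis using der by simp
  qed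
  then show ?thesis
    unfolding Cinf_on_def using D(1) Dk Ck.simps(1) by blast
qed

lemma Ck_subset: "Ck k S f \<Longrightarrow> T \<subseteq> S \<Longrightarrow> Ck k T f"
proof (induction k arbitrary: f)
  case 0
  then show ?case by (auto intro: continuous_on_subset)
next
  case (Suc k)
  then obtain f' where f': "\<And>x. x \<in> S \<Longrightarrow> (f has_derivative f' x) (at x)" "\<And>v. Ck k S (\<lambda>x. f' x v)"
    by auto
  show ?case
    by (rule Ck_SucI[of _ _ f']) (use f' Suc in auto)
qed

lemma Ck_continuous_on: "Ck k S f \<Longrightarrow> continuous_on S f"
proof (cases k)
  case (Suc l)
  assume "Ck k S f"
  then obtain f' where "\<And>x. x \<in> S \<Longrightarrow> (f has_derivative f' x) (at x)"
    unfolding Suc by auto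
  then show ?thesis
    by (intro has_derivative_continuous_on[of S f f']) (auto intro: has_derivative_at_withinI)
qed auto

lemma Ck_antimono: "Ck (Suc k) S f \<Longrightarrow> Ck k S f"
proof (induction k arbitrary: f)
  case 0
  then show ?case using Ck_continuous_on Ck.simps(1) by blast
next
  case (Suc k)
  then show ?case by (metis Ck.simps(2))
qed

lemma Ck_const: "Ck k S (\<lambda>x. c)"
proof (induction k arbitrary: c)
  case (Suc k)
  show ?case by (rule Ck_SucI[of _ _ "\<lambda>x v. 0"]) (use Suc in auto)
qed auto

lemma Ck_linear:
  assumes "bounded_linear L" shows "Ck k S L"
proof (cases k)
  case 0
  then show ?thesis using assms by (simp add: linear_continuous_on)
next
  case (Suc l)
  show ?thesis unfolding Suc
    by (rule Ck_SucI[of _ _ "\<lambda>x. L"]) (use assms in \<open>auto intro: bounded_linear_imp_has_derivative Ck_const\<close>)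
qed

lemma Ck_bounded_linear:
  assumes "bounded_linear L" "Ck k S f" shows "Ck k S (\<lambda>x. L (f x))"
  using assms(2)
proof (induction k arbitrary: f)
  case 0
  then show ?case using assms(1)
    by (simp add: bounded_linear.continuous_on)
next
  case (Suc k)
  then obtain f' where f': "\<And>x. x \<in> S \<Longrightarrow> (f has_derivative f' x) (at x)" "\<And>v. Ck k S (\<lambda>x. f' x v)"
    by auto
  show ?case
    by (rule Ck_SucI[of _ _ "\<lambda>x v. L (f' x v)"])
       (use f' Suc.IH in \<open>auto intro: bounded_linear.has_derivative[OF assms(1)]\<close>)
qed

lemma Ck_add:
  assumes "Ck k S f" "Ck k S g" shows "Ck k S (\<lambda>x. f x + g x)"
  using assms
proof (induction k arbitrary: f g)
  case 0
  then show ?case by (auto intro: continuous_on_add)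
next
  case (Suc k)
  obtain f' where
    f': "\<And>x. x \<in> S \<Longrightarrow> (f has_derivative f' x) (at x)" "\<And>v. Ck k S (\<lambda>x. f' x v)"
    using Suc.prems(1) by auto
  obtain g' where
    g': "\<And>x. x \<in> S \<Longrightarrow> (g has_derivative g' x) (at x)" "\<And>v. Ck k S (\<lambda>x. g' x v)"
    using Suc.prems(2) by auto
  show ?case
    by (rule Ck_SucI[of _ _ "\<lambda>x v. f' x v + g' x v"]) (use f' g' Suc.IH in \<open>auto intro: has_derivative_add\<close>)
qed

lemma Ck_sum:
  assumes "finite A" "\<And>i. i \<in> A \<Longrightarrow> Ck k S (f i)" shows "Ck k S (\<lambda>x. \<Sum>i\<in>A. f i x)"
  using assms by (induction A rule: finite_induct) (auto intro: Ck_const Ck_add)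

lemma Ck_bilinear:
  assumes "bounded_bilinear pr" "Ck k S f" "Ck k S g"
  shows "Ck k S (\<lambda>x. pr (f x) (g x))"
  using assms(2,3)
proof (induction k arbitrary: f g)
  case 0
  then show ?case using assms(1) by (auto intro: bounded_bilinear.continuous_on)
next
  case (Suc k)
  obtain f' where
    f': "\<And>x. x \<in> S \<Longrightarrow> (f has_derivative f' x) (at x)" "\<And>v. Ck k S (\<lambda>x. f' x v)"
    using Suc.prems(1) by auto
  obtain g' where
    g': "\<And>x. x \<in> S \<Longrightarrow> (g has_derivative g' x) (at x)" "\<And>v. Ck k S (\<lambda>x. g' x v)"
    using Suc.prems(2) by auto
  have fg: "Ck k S f" "Ck k S g"
    using Suc.prems Ck_antimono by blast+
  show ?case
    by (rule Ck_SucI[of _ _ "\<lambda>x v. pr (f x) (g' x v) + pr (f' x v) (g x)"])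
       (intro bounded_bilinear.FDERIV[OF assms(1)] f' g' Ck_add Suc.IH fg; assumption)+
qed

lemma Ck_compose:
  fixes g :: "'a::euclidean_space \<Rightarrow> 'b::euclidean_space" and f :: "'b \<Rightarrow> 'c::real_normed_vector"
  assumes "Ck k T f" "Ck k S g" "g ` S \<subseteq> T"
  shows "Ck k S (\<lambda>x. f (g x))"
  using assms(1,2)
proof (induction k arbitrary: f)
  case 0
  then show ?case using assms(3) by (auto intro: continuous_on_compose2)
next
  case (Suc k)
  obtain f' where
    f': "\<And>x. x \<in> T \<Longrightarrow> (f has_derivative f' x) (at x)" "\<And>v. Ck k T (\<lambda>x. f' x v)"
    using Suc.prems(1) by auto
  obtain g' where
    g': "\<And>x. x \<in> S \<Longrightarrow> (g has_derivative g' x) (at x)" "\<And>v. Ck k S (\<lambda>x. g' x v)"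
    using Suc.prems(2) by auto
  \<comment> \<open>Regularity of \<open>f' y b\<close> in \<open>y\<close> is known only for fixed
    \<open>b\<close>, so the moving direction \<open>g' x v\<close> is expanded in the basis, which
    leaves a finite sum of products.\<close>
  have eq: "f' (g x) (g' x v) = (\<Sum>b\<in>Basis. (g' x v \<bullet> b) *\<^sub>R f' (g x) b)" if "x \<in> S" for x v
  proof -
    have "bounded_linear (f' (g x))"
      using f'(1) assms(3) that has_derivative_bounded_linear by blast
    then show ?thesis
      by (subst euclidean_representation[of "g' x v", symmetric])
         (simp add: bounded_linear.linear linear_sum linear_cmul del: euclidean_representation)
  qed
  have der: "((\<lambda>x. f (g x)) has_derivative (\<lambda>v. \<Sum>b\<in>Basis. (g' x v \<bullet> b) *\<^sub>R f' (g x) b)) (at x)"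
    if "x \<in> S" for x
    using has_derivative_compose[OF g'(1)[OF that], of f "f' (g x)"] f'(1) assms(3) that
    unfolding eq[OF that, symmetric] by blast
  show ?case
  proof (rule Ck_SucI[OF der])
    have "Ck k S (\<lambda>x. f' (g x) b)" for b
      using Suc.IH[OF f'(2)[of b]] Suc.prems(2) Ck_antimono by blast
    then show "Ck k S (\<lambda>x. \<Sum>b\<in>Basis. (g' x v \<bullet> b) *\<^sub>R f' (g x) b)" for v
      by (intro Ck_sum Ck_bilinear[OF bounded_bilinear_scaleR]
          Ck_bounded_linear[OF bounded_linear_inner_left] g'(2)) auto
  qed
qed

lemma Ck_Pair:
  assumes "Ck k S f" "Ck k S g" shows "Ck k S (\<lambda>x. (f x, g x))"
proof -
  have "Ck k S (\<lambda>x. (f x, 0) + (0, g x))"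
    by (intro Ck_add Ck_bounded_linear[where L = "\<lambda>u. (u, 0)"] Ck_bounded_linear[where L = "\<lambda>u. (0, u)"] assms)
       (auto intro!: bounded_linear_Pair bounded_linear_ident bounded_linear_zero)
  then show ?thesis by simp
qed

text \<open>Everything rests on \<open>g y - g x = - g y (f y - f x) g x\<close>. Continuity of
  \<open>g\<close> is part of the conclusion: once
  \<open>norm (f y - f x) * norm (g x) < 1/2\<close>, the identity bounds \<open>norm (g y)\<close>
  by \<open>2 * norm (g x)\<close>, and a second use of it gives continuity.\<close>

lemma has_derivative_left_right_inverse:
  fixes f g :: "'a::real_normed_vector \<Rightarrow> 'b::real_normed_algebra_1"
  assumes S: "open S" "x \<in> S" and inv: "\<And>y. y \<in> S \<Longrightarrow> f y * g y = 1 \<and> g y * f y = 1"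
    and der: "(f has_derivative f') (at x)"
  shows "(g has_derivative (\<lambda>h. - (g x * f' h * g x))) (at x)"
proof -
  have diff: "g y - g x = - (g y * (f y - f x) * g x)" if "y \<in> S" for y
  proof -
    have "g y * (f y - f x) * g x = (g y * f y) * g x - g y * (f x * g x)"
      by (simp only: left_diff_distrib right_diff_distrib mult.assoc)
    then show ?thesis using inv[OF that] inv[OF S(2)] by simp
  qed
  have ev: "\<forall>\<^sub>F y in at x. y \<in> S"
    using S by (simp add: eventually_at_topological) blast
  have contf: "(f \<longlongrightarrow> f x) (at x)"
    using has_derivative_continuous[OF der] by (simp add: continuous_within)
  have small: "((\<lambda>y. norm (f y - f x) * norm (g x)) \<longlongrightarrow> 0) (at x)"
    using contf by (auto intro!: tendsto_eq_intros simp: LIM_zero_iff)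
  have bdd: "\<forall>\<^sub>F y in at x. norm (g y) \<le> 2 * norm (g x)"
    using order_tendstoD(2)[OF small, of "1/2", simplified] ev
  proof eventually_elim
    case (elim y)
    have "norm (g y) \<le> norm (g x) + norm (g y - g x)"
      by (metis add.commute diff_add_cancel norm_triangle_ineq)
    also have "norm (g y - g x) \<le> norm (g y) * (norm (f y - f x) * norm (g x))"
      unfolding diff[OF elim(2)] norm_minus_cancel
      by (metis (no_types, lifting) mult.assoc mult_left_mono norm_ge_zero norm_mult_ineq order_trans)
    also have "\<dots> \<le> norm (g y) * (1/2)"
      using elim(1) by (intro mult_left_mono) auto
    finally show ?case by simp
  qed
  have contg: "(g \<longlongrightarrow> g x) (at x)"
  proof -
    have "((\<lambda>y. g y - g x) \<longlongrightarrow> 0) (at x)"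
    proof (rule Lim_null_comparison)
      show "\<forall>\<^sub>F y in at x. norm (g y - g x) \<le> 2 * norm (g x) * (norm (f y - f x) * norm (g x))"
        using bdd ev
      proof eventually_elim
        case (elim y)
        have "norm (g y - g x) \<le> norm (g y) * (norm (f y - f x) * norm (g x))"
          unfolding diff[OF elim(2)] norm_minus_cancel
          by (metis (no_types, lifting) mult.assoc mult_left_mono norm_ge_zero norm_mult_ineq order_trans)
        also have "\<dots> \<le> 2 * norm (g x) * (norm (f y - f x) * norm (g x))"
          using elim by (intro mult_right_mono) auto
        finally show ?case .
      qed
      show "((\<lambda>y. 2 * norm (g x) * (norm (f y - f x) * norm (g x))) \<longlongrightarrow> 0) (at x)"
        using tendsto_mult_left[OF small, of "2 * norm (g x)"] by simp
    qed
    then show ?thesis by (simp add: LIM_zero_iff)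
  qed
  interpret f': bounded_linear f' using der has_derivative_bounded_linear by blast
  \<comment> \<open>The error of the candidate derivative splits into a term carrying
    \<open>g y - g x\<close> and a term carrying the remainder of \<open>f\<close>; both are null,
    the other factors being bounded.\<close>
  have "((\<lambda>y. - ((g y - g x) * f' ((y - x) /\<^sub>R norm (y - x)) * g x)
      - g y * ((f y - f x - f' (y - x)) /\<^sub>R norm (y - x)) * g x) \<longlongrightarrow> 0) (at x)"
  proof -
    obtain K where K: "\<And>h. norm (f' h) \<le> norm h * K" using f'.bounded by blast
    have l1: "((\<lambda>y. (g y - g x) * f' ((y - x) /\<^sub>R norm (y - x))) \<longlongrightarrow> 0) (at x)"
    proof (rule Lim_null_comparison)
      show "\<forall>\<^sub>F y in at x. norm ((g y - g x) * f' ((y - x) /\<^sub>R norm (y - x))) \<le> norm (g y - g x) * \<bar>K\<bar>"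
      proof (intro always_eventually allI)
        fix y
        have "norm (f' ((y - x) /\<^sub>R norm (y - x))) \<le> norm ((y - x) /\<^sub>R norm (y - x)) * K"
          by (rule K)
        also have "\<dots> \<le> 1 * \<bar>K\<bar>"
        proof -
          have "norm ((y - x) /\<^sub>R norm (y - x)) \<le> 1" by (cases "y = x") simp_all
          then show ?thesis
            by (meson abs_ge_self abs_ge_zero mult_mono norm_ge_zero mult_left_mono mult_right_mono order_trans)
        qed
        finally show "norm ((g y - g x) * f' ((y - x) /\<^sub>R norm (y - x))) \<le> norm (g y - g x) * \<bar>K\<bar>"
          by (intro order_trans[OF norm_mult_ineq] mult_left_mono) auto
      qed
      show "((\<lambda>y. norm (g y - g x) * \<bar>K\<bar>) \<longlongrightarrow> 0) (at x)"
        using contg by (auto intro!: tendsto_eq_intros simp: LIM_zero_iff)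
    qed
    have l2: "((\<lambda>y. (f y - f x - f' (y - x)) /\<^sub>R norm (y - x)) \<longlongrightarrow> 0) (at x)"
      using der by (simp add: has_derivative_at2 diff_diff_eq inverse_eq_divide)
    show ?thesis
      using tendsto_diff[OF tendsto_minus[OF tendsto_mult[OF l1 tendsto_const[of "g x"]]]
          tendsto_mult[OF tendsto_mult[OF contg l2] tendsto_const[of "g x"]]] by simp
  qed
  then have "((\<lambda>y. (g y - g x - (- (g x * f' (y - x) * g x))) /\<^sub>R norm (y - x)) \<longlongrightarrow> 0) (at x)"
  proof (rule Lim_transform_eventually, intro eventually_mono[OF ev])
    fix y assume y: "y \<in> S"
    define d D where "d = f' (y - x)" and "D = f y - f x"
    have "- ((g y - g x) * (c *\<^sub>R d) * g x) - g y * (c *\<^sub>R (D - d)) * g x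
        = c *\<^sub>R (- (g y * D * g x) + g x * d * g x)" for c
      by (simp add: algebra_simps)
    moreover have "g y - g x - (- (g x * d * g x)) = - (g y * D * g x) + g x * d * g x"
      using diff[OF y] by (simp add: D_def)
    ultimately show "- ((g y - g x) * f' ((y - x) /\<^sub>R norm (y - x)) * g x)
        - g y * ((f y - f x - f' (y - x)) /\<^sub>R norm (y - x)) * g x
        = (g y - g x - (- (g x * f' (y - x) * g x))) /\<^sub>R norm (y - x)"
      unfolding f'.scaleR d_def D_def by metis
  qed
  moreover have "bounded_linear (\<lambda>h. - (g x * f' h * g x))"
    by (intro bounded_linear_minus bounded_linear_mult_const bounded_linear_const_mult f'.bounded_linear_axioms)
  ultimately show ?thesis
    by (simp add: has_derivative_at2 diff_diff_eq inverse_eq_divide diff_diff_eq2 diff_add_eq)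
qed

text \<open>Since \<open>g' = - g f' g\<close>, smoothness of an inverse bootstraps from its continuity.\<close>
lemma Ck_left_right_inverse:
  fixes f g :: "'a::euclidean_space \<Rightarrow> 'b::real_normed_algebra_1"
  assumes S: "open S" and inv: "\<And>y. y \<in> S \<Longrightarrow> f y * g y = 1 \<and> g y * f y = 1"
    and f: "\<And>k. Ck k S f"
  shows "Ck k S g"
proof (induction k)
  obtain f' where f': "\<And>x. x \<in> S \<Longrightarrow> (f has_derivative f' x) (at x)"
    using f[of "Suc 0"] by auto
  have g': "(g has_derivative (\<lambda>h. - (g x * f' x h * g x))) (at x)" if "x \<in> S" for x
    using has_derivative_left_right_inverse[OF S that inv f'[OF that]] by blast
  case 0
  have "continuous_on S g"
    by (rule has_derivative_continuous_on) (use g' has_derivative_at_withinI in blast)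
  then show ?case by simp
next
  case (Suc k)
  obtain f' where f': "\<And>x. x \<in> S \<Longrightarrow> (f has_derivative f' x) (at x)" "\<And>v. Ck k S (\<lambda>x. f' x v)"
    using f[of "Suc k"] by auto
  have g': "(g has_derivative (\<lambda>h. - (g x * f' x h * g x))) (at x)" if "x \<in> S" for x
    using has_derivative_left_right_inverse[OF S that inv f'(1)[OF that]] by blast
  show ?case
    by (rule Ck_SucI[OF g'])
       (auto intro!: Ck_bounded_linear[OF bounded_linear_minus[OF bounded_linear_ident]]
         Ck_bilinear[OF bounded_bilinear_mult] Suc f')
qed

text \<open>Quantitative version of \<open>Ck\<close>: the same bound for all derivatives up to order \<open>k\<close>.
  The product rule costs a factor \<open>2 ^ k\<close>, which is harmless for power series of infinite
  radius of convergence.\<close>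
primrec Ck_bound :: "nat \<Rightarrow> real \<Rightarrow> 'a::euclidean_space set \<Rightarrow> ('a \<Rightarrow> 'b::real_normed_vector) \<Rightarrow> bool" where
  "Ck_bound 0 B S f \<longleftrightarrow> (\<forall>x\<in>S. norm (f x) \<le> B)"
| "Ck_bound (Suc k) B S f \<longleftrightarrow> (\<forall>x\<in>S. norm (f x) \<le> B) \<and>
    (\<exists>f'. (\<forall>x\<in>S. (f has_derivative f' x) (at x)) \<and> (\<forall>b\<in>Basis. Ck_bound k B S (\<lambda>x. f' x b)))"

lemma Ck_bound_SucI:
  "(\<And>x. x \<in> S \<Longrightarrow> norm (f x) \<le> B) \<Longrightarrow> (\<And>x. x \<in> S \<Longrightarrow> (f has_derivative f' x) (at x)) \<Longrightarrow>
    (\<And>b. b \<in> Basis \<Longrightarrow> Ck_bound k B S (\<lambda>x. f' x b)) \<Longrightarrow> Ck_bound (Suc k) B S f"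
  by auto

lemma Ck_bound_norm: "Ck_bound k B S f \<Longrightarrow> x \<in> S \<Longrightarrow> norm (f x) \<le> B"
  by (cases k) auto

lemma Ck_bound_antimono: "Ck_bound (Suc k) B S f \<Longrightarrow> Ck_bound k B S f"
proof (induction k arbitrary: f)
  case 0
  then show ?case by auto
next
  case (Suc k)
  obtain f' where f': "\<And>x. x \<in> S \<Longrightarrow> (f has_derivative f' x) (at x)"
    "\<And>b. b \<in> Basis \<Longrightarrow> Ck_bound (Suc k) B S (\<lambda>x. f' x b)"
    using Suc.prems by (subst (asm) Ck_bound.simps(2)) blast
  show ?case
    by (rule Ck_bound_SucI[OF Ck_bound_norm[OF Suc.prems] f'(1) Suc.IH[OF f'(2)]])
qed

lemma Ck_bound_const: "norm c \<le> B \<Longrightarrow> Ck_bound k B S (\<lambda>x. c)"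
proof (induction k arbitrary: c)
  case (Suc k)
  have "0 \<le> B" using Suc.prems norm_ge_zero order_trans by blast
  then show ?case
    by (intro Ck_bound_SucI[of _ _ _ "\<lambda>x v. 0"]) (use Suc in auto)
qed auto

lemma Ck_bound_add:
  assumes "Ck_bound k B S f" "Ck_bound k C S g"
  shows "Ck_bound k (B + C) S (\<lambda>x. f x + g x)"
  using assms
proof (induction k arbitrary: f g)
  case 0
  then show ?case by (auto intro: norm_triangle_mono)
next
  case (Suc k)
  obtain f' where f': "\<And>x. x \<in> S \<Longrightarrow> (f has_derivative f' x) (at x)"
    "\<And>b. b \<in> Basis \<Longrightarrow> Ck_bound k B S (\<lambda>x. f' x b)" using Suc.prems(1) by auto
  obtain g' where g': "\<And>x. x \<in> S \<Longrightarrow> (g has_derivative g' x) (at x)"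
    "\<And>b. b \<in> Basis \<Longrightarrow> Ck_bound k C S (\<lambda>x. g' x b)" using Suc.prems(2) by auto
  show ?case
    by (rule Ck_bound_SucI[OF norm_triangle_mono has_derivative_add[OF f'(1) g'(1)] Suc.IH])
       (use f' g' Ck_bound_norm[OF Suc.prems(1)] Ck_bound_norm[OF Suc.prems(2)] in auto)
qed

lemma Ck_bound_mult:
  fixes f g :: "'a::euclidean_space \<Rightarrow> 'b::real_normed_algebra"
  assumes "Ck_bound k B S f" "Ck_bound k C S g" "0 \<le> B" "0 \<le> C"
  shows "Ck_bound k (2 ^ k * B * C) S (\<lambda>x. f x * g x)"
  using assms(1,2)
proof (induction k arbitrary: f g)
  case 0
  then show ?case
    by (auto intro!: order_trans[OF norm_mult_ineq] mult_mono assms(3))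
next
  case (Suc k)
  obtain f' where f': "\<And>x. x \<in> S \<Longrightarrow> (f has_derivative f' x) (at x)"
    "\<And>b. b \<in> Basis \<Longrightarrow> Ck_bound k B S (\<lambda>x. f' x b)" using Suc.prems(1) by auto
  obtain g' where g': "\<And>x. x \<in> S \<Longrightarrow> (g has_derivative g' x) (at x)"
    "\<And>b. b \<in> Basis \<Longrightarrow> Ck_bound k C S (\<lambda>x. g' x b)" using Suc.prems(2) by auto
  have fg: "Ck_bound k B S f" "Ck_bound k C S g"
    using Suc.prems Ck_bound_antimono by blast+
  have two: "2 ^ Suc k * B * C = 2 ^ k * B * C + 2 ^ k * B * C" by simp
  have one: "B * C \<le> 2 ^ Suc k * B * C"
    using assms(3,4) by (metis mult_right_mono mult_1 one_le_power one_le_numeral mult_nonneg_nonneg mult.assoc)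
  show ?case
  proof (rule Ck_bound_SucI[of _ _ _ "\<lambda>x v. f x * g' x v + f' x v * g x"])
    fix x assume x: "x \<in> S"
    have "norm (f x * g x) \<le> B * C"
      using Ck_bound_norm[OF fg(1) x] Ck_bound_norm[OF fg(2) x]
      by (auto intro!: order_trans[OF norm_mult_ineq] mult_mono assms(3))
    then show "norm (f x * g x) \<le> 2 ^ Suc k * B * C" using one by linarith
    show "((\<lambda>x. f x * g x) has_derivative (\<lambda>v. f x * g' x v + f' x v * g x)) (at x)"
      by (rule has_derivative_mult[OF f'(1)[OF x] g'(1)[OF x]])
  next
    fix b :: 'a assume "b \<in> Basis"
    then show "Ck_bound k (2 ^ Suc k * B * C) S (\<lambda>x. f x * g' x b + f' x b * g x)"
      unfolding two by (intro Ck_bound_add Suc.IH fg f' g')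
  qed
qed

lemma Ck_bound_scaleR:
  assumes "Ck_bound k B S f"
  shows "Ck_bound k (\<bar>c\<bar> * B) S (\<lambda>x. c *\<^sub>R f x)"
  using assms
proof (induction k arbitrary: f)
  case 0
  then show ?case by (auto intro: mult_left_mono)
next
  case (Suc k)
  obtain f' where f': "\<And>x. x \<in> S \<Longrightarrow> (f has_derivative f' x) (at x)"
    "\<And>b. b \<in> Basis \<Longrightarrow> Ck_bound k B S (\<lambda>x. f' x b)" using Suc.prems(1) by auto
  show ?case
    by (rule Ck_bound_SucI[OF _ has_derivative_scaleR_right[OF f'(1)] Suc.IH[OF f'(2)]])
       (use Ck_bound_norm[OF Suc.prems] in \<open>auto intro: mult_left_mono\<close>)
qed

lemma Ck_bound_suminf:
  fixes f :: "nat \<Rightarrow> 'a::euclidean_space \<Rightarrow> 'b::banach"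
  assumes S: "open S" "convex S" and B: "summable B" and f: "\<And>n. Ck_bound k (B n) S (f n)"
  shows "Ck_bound k (\<Sum>n. B n) S (\<lambda>x. \<Sum>n. f n x)"
  using f
proof (induction k arbitrary: f)
  case 0
  then show ?case by (auto intro: norm_suminf_le B)
next
  case (Suc k)
  have "\<exists>f'. (\<forall>x\<in>S. (f n has_derivative f' x) (at x)) \<and> (\<forall>b\<in>Basis. Ck_bound k (B n) S (\<lambda>x. f' x b))" for n
    using Suc.prems[of n] by simp
  then obtain f' where f': "\<And>n x. x \<in> S \<Longrightarrow> (f n has_derivative f' n x) (at x)"
    "\<And>n b. b \<in> Basis \<Longrightarrow> Ck_bound k (B n) S (\<lambda>x. f' n x b)"
    by metis
  show ?case
  proof (rule Ck_bound_SucI[of _ _ _ "\<lambda>x h. \<Sum>n. f' n x h"])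
    show "norm (\<Sum>n. f n x) \<le> (\<Sum>n. B n)" if "x \<in> S" for x
      by (rule norm_suminf_le[OF Ck_bound_norm[OF Suc.prems that] B])
    show "((\<lambda>x. \<Sum>n. f n x) has_derivative (\<lambda>h. \<Sum>n. f' n x h)) (at x)" if "x \<in> S" for x
      by (rule has_derivative_suminf[OF S B f'(1) Ck_bound_norm[OF Suc.prems]
            Ck_bound_norm[OF f'(2)] that]) assumption+
    show "Ck_bound k (\<Sum>n. B n) S (\<lambda>x. \<Sum>n. f' n x b)" if "b \<in> Basis" for b
      by (rule Suc.IH[OF f'(2)[OF that]])
  qed
qed

lemma Ck_bound_imp_Ck:
  assumes "Ck_bound (Suc k) B S f"
  shows "Ck k S f"
  using assms
proof (induction k arbitrary: f)
  case 0
  then obtain f' where f': "\<And>x. x \<in> S \<Longrightarrow> (f has_derivative f' x) (at x)" by auto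
  have "continuous_on S f"
    by (rule has_derivative_continuous_on) (use f' has_derivative_at_withinI in blast)
  then show ?case by simp
next
  case (Suc k)
  obtain f' where f': "\<And>x. x \<in> S \<Longrightarrow> (f has_derivative f' x) (at x)"
    "\<And>b. b \<in> Basis \<Longrightarrow> Ck_bound (Suc k) B S (\<lambda>x. f' x b)"
    using Suc.prems by (subst (asm) Ck_bound.simps(2)) blast
  have eq: "f' x v = (\<Sum>b\<in>Basis. (v \<bullet> b) *\<^sub>R f' x b)" if "x \<in> S" for x v
  proof -
    have "bounded_linear (f' x)"
      using f'(1) that has_derivative_bounded_linear by blast
    then show ?thesis
      by (subst euclidean_representation[of v, symmetric])
         (simp add: bounded_linear.linear linear_sum linear_cmul del: euclidean_representation)
  qed
  have der: "(f has_derivative (\<lambda>v. \<Sum>b\<in>Basis. (v \<bullet> b) *\<^sub>R f' x b)) (at x)" if "x \<in> S" for x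
    using f'(1)[OF that] unfolding eq[OF that, symmetric] .
  show ?case
    by (rule Ck_SucI[OF der], assumption)
       (intro Ck_sum Ck_bounded_linear[OF bounded_linear_scaleR_right] Suc.IH f'(2) finite_Basis; assumption)
qed

text \<open>The n-th power of \<open>J\<close> is bounded, with all derivatives up to order
  \<open>k\<close>, by \<open>(2 ^ k * B) ^ n\<close>. Summability at every radius absorbs this
  base, whatever the order and the ball.\<close>

lemma Ck_power_series:
  fixes J :: "'a::euclidean_space \<Rightarrow> 'b::{real_normed_algebra_1,banach}"
  assumes J: "bounded_linear J" and a: "\<And>r. summable (\<lambda>n. \<bar>a n\<bar> * r ^ n)"
  shows "Ck k UNIV (\<lambda>x. \<Sum>n. a n *\<^sub>R J x ^ n)"
proof -
  interpret J: bounded_linear J by fact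
  have ball: "Ck k (ball 0 R) (\<lambda>x. \<Sum>n. a n *\<^sub>R J x ^ n)" for R k
  proof -
    obtain K where K: "\<And>x. norm (J x) \<le> norm x * K" "K \<ge> 0"
      using J.nonneg_bounded by blast
    \<comment> \<open>\<open>R * K\<close> bounds the values of \<open>J\<close> on the ball and
      \<open>K\<close> its derivatives along basis vectors; \<open>max 1 R\<close> covers
      both.\<close>
    define B where "B = max 1 R * K"
    have B0: "B \<ge> 0" using K(2) by (simp add: B_def)
    define S where "S = ball (0::'a) R"
    have cJ: "Ck_bound k B S J" for k
    proof (cases k)
      case 0
      show ?thesis unfolding 0
        by (auto simp: S_def B_def intro!: order_trans[OF K(1)] mult_right_mono K(2))
    next
      case (Suc l)
      show ?thesis unfolding Suc
        by (rule Ck_bound_SucI[of _ _ _ "\<lambda>x. J"])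
           (auto simp: S_def B_def J bounded_linear_imp_has_derivative
              intro!: order_trans[OF K(1)] mult_right_mono K(2) Ck_bound_const)
    qed
    have cP: "Ck_bound k ((2 ^ k * B) ^ n) S (\<lambda>x. J x ^ n)" for k n
    proof (induction n)
      case 0
      show ?case by (simp add: Ck_bound_const)
    next
      case (Suc n)
      show ?case
        using Ck_bound_mult[OF cJ Suc] B0 by (simp add: mult_ac)
    qed
    have "Ck_bound (Suc k) (\<Sum>n. \<bar>a n\<bar> * (2 ^ Suc k * B) ^ n) S (\<lambda>x. \<Sum>n. a n *\<^sub>R J x ^ n)"
      by (rule Ck_bound_suminf[OF _ _ a Ck_bound_scaleR[OF cP]]) (auto simp: S_def)
    then show ?thesis
      unfolding S_def by (rule Ck_bound_imp_Ck)
  qed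
  show ?thesis
  proof (rule Ck_local)
    show "\<exists>T. open T \<and> x \<in> T \<and> Ck k T (\<lambda>x. \<Sum>n. a n *\<^sub>R J x ^ n)" for x
      by (rule exI[of _ "ball 0 (norm x + 1)"]) (use ball in auto)
  qed
qed

subsection \<open>Power series in Banach algebras\<close>

definition pser :: "(nat \<Rightarrow> real) \<Rightarrow> 'b \<Rightarrow> 'b::{real_normed_algebra_1,banach}" where
  "pser a A = (\<Sum>n. a n *\<^sub>R A ^ n)"

definition abs_conv :: "real \<Rightarrow> (nat \<Rightarrow> real) \<Rightarrow> bool" where
  "abs_conv r a \<longleftrightarrow> (\<forall>s. 0 \<le> s \<longrightarrow> s < r \<longrightarrow> summable (\<lambda>n. \<bar>a n\<bar> * s ^ n))"

lemma abs_convD: "abs_conv r a \<Longrightarrow> 0 \<le> s \<Longrightarrow> s < r \<Longrightarrow> summable (\<lambda>n. \<bar>a n\<bar> * s ^ n)"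
  by (simp add: abs_conv_def)

lemma abs_conv_summable_norm:
  fixes A :: "'b::{real_normed_algebra_1,banach}"
  assumes "abs_conv r a" "norm A < r"
  shows "summable (\<lambda>n. norm (a n *\<^sub>R A ^ n))"
  by (rule summable_comparison_test'[OF abs_convD[OF assms(1) norm_ge_zero assms(2)]])
     (auto intro: mult_left_mono norm_power_ineq)

lemma abs_conv_add:
  assumes "abs_conv r a" "abs_conv r b" shows "abs_conv r (\<lambda>n. a n + b n)"
  unfolding abs_conv_def
proof (intro allI impI)
  fix s :: real assume s: "0 \<le> s" "s < r"
  show "summable (\<lambda>n. \<bar>a n + b n\<bar> * s ^ n)"
  proof (rule summable_comparison_test'[OF summable_add[OF abs_convD[OF assms(1) s] abs_convD[OF assms(2) s]]])
    show "norm (\<bar>a n + b n\<bar> * s ^ n) \<le> \<bar>a n\<bar> * s ^ n + \<bar>b n\<bar> * s ^ n" for n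
      using s by (simp add: abs_mult distrib_right[symmetric] mult_right_mono abs_triangle_ineq)
  qed
qed

lemma abs_conv_Cauchy_product:
  assumes "abs_conv r a" "abs_conv r b" shows "abs_conv r (\<lambda>n. \<Sum>i\<le>n. a i * b (n - i))"
  unfolding abs_conv_def
proof (intro allI impI)
  fix s :: real assume s: "0 \<le> s" "s < r"
  have "summable (\<lambda>n. \<Sum>i\<le>n. (\<bar>a i\<bar> * s ^ i) * (\<bar>b (n - i)\<bar> * s ^ (n - i)))"
    by (rule summable_Cauchy_product) (use abs_convD[OF assms(1) s] abs_convD[OF assms(2) s] s in auto)
  then show "summable (\<lambda>n. \<bar>\<Sum>i\<le>n. a i * b (n - i)\<bar> * s ^ n)"
  proof (rule summable_comparison_test')
    fix n
    have "\<bar>\<Sum>i\<le>n. a i * b (n - i)\<bar> * s ^ n \<le> (\<Sum>i\<le>n. \<bar>a i * b (n - i)\<bar>) * s ^ n"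
      using s by (intro mult_right_mono sum_abs) auto
    also have "\<dots> = (\<Sum>i\<le>n. (\<bar>a i\<bar> * s ^ i) * (\<bar>b (n - i)\<bar> * s ^ (n - i)))"
      unfolding sum_distrib_right
    proof (rule sum.cong[OF refl])
      fix i assume "i \<in> {..n}"
      then have "s ^ n = s ^ i * s ^ (n - i)" by (simp flip: power_add)
      then show "\<bar>a i * b (n - i)\<bar> * s ^ n = (\<bar>a i\<bar> * s ^ i) * (\<bar>b (n - i)\<bar> * s ^ (n - i))"
        by (simp add: abs_mult)
    qed
    finally show "norm (\<bar>\<Sum>i\<le>n. a i * b (n - i)\<bar> * s ^ n)
        \<le> (\<Sum>i\<le>n. (\<bar>a i\<bar> * s ^ i) * (\<bar>b (n - i)\<bar> * s ^ (n - i)))"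
      using s by simp
  qed
qed

lemma pser_mult:
  fixes A :: "'b::{real_normed_algebra_1,banach}"
  assumes "abs_conv r a" "abs_conv r b" "norm A < r"
  shows "pser a A * pser b A = pser (\<lambda>n. \<Sum>i\<le>n. a i * b (n - i)) A"
proof -
  have "(\<Sum>i\<le>n. (a i *\<^sub>R A ^ i) * (b (n - i) *\<^sub>R A ^ (n - i))) = (\<Sum>i\<le>n. a i * b (n - i)) *\<^sub>R A ^ n" for n
    by (auto simp: scaleR_sum_left simp flip: power_add intro!: sum.cong)
  then show ?thesis
    unfolding pser_def
    using Cauchy_product[OF abs_conv_summable_norm[OF assms(1,3)] abs_conv_summable_norm[OF assms(2,3)]]
    by simp
qed

lemma pser_add:
  fixes A :: "'b::{real_normed_algebra_1,banach}"
  assumes "abs_conv r a" "abs_conv r b" "norm A < r"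
  shows "pser (\<lambda>n. a n + b n) A = pser a A + pser b A"
  unfolding pser_def scaleR_add_left
  by (intro suminf_add[symmetric] summable_norm_cancel[OF abs_conv_summable_norm[OF assms(1,3)]]
      summable_norm_cancel[OF abs_conv_summable_norm[OF assms(2,3)]])

text \<open>Otherwise the difference would be a zero function with a nonzero coefficient, against
  the isolation of zeros. The constant coefficient is compared separately, because the isolation
  result asks for a nonzero coefficient of positive index.\<close>

lemma pser_uniq:
  assumes r: "0 < r" and "abs_conv r a" "abs_conv r b"
    and eq: "\<And>w::real. \<bar>w\<bar> < r \<Longrightarrow> pser a w = pser b w"
  shows "a = b"
proof (rule ccontr)
  assume "a \<noteq> b"
  then obtain m where m: "a m \<noteq> b m" by blast
  define e where "e n = a n + (-1) * b n" for n
  have b': "abs_conv r (\<lambda>n. (-1) * b n)" using assms(3) by (simp add: abs_conv_def)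
  have e: "abs_conv r e" unfolding e_def by (rule abs_conv_add[OF assms(2) b'])
  have sums: "(\<lambda>n. e n * (w - 0) ^ n) sums 0" if "norm (w - 0) < r" for w :: real
  proof -
    have w: "norm w < r" using that by simp
    have "pser (\<lambda>n. (-1) * b n) w = - pser b w"
      using suminf_minus[OF summable_norm_cancel[OF abs_conv_summable_norm[OF assms(3) w]]]
      by (simp add: pser_def)
    then have "pser e w = 0"
      unfolding e_def pser_add[OF assms(2) b' w] using eq[of w] w by simp
    moreover have "(\<lambda>n. e n *\<^sub>R w ^ n) sums pser e w"
      unfolding pser_def
      by (intro summable_sums summable_norm_cancel[OF abs_conv_summable_norm[OF e w]])
    ultimately show ?thesis by simp
  qed
  have "m \<noteq> 0"
  proof
    assume "m = 0"
    have "(\<lambda>n. e n * 0 ^ n) sums e 0" by (rule powser_sums_zero)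
    then have "e 0 = 0" using sums[of 0] r sums_unique2 by fastforce
    then show False using m \<open>m = 0\<close> by (simp add: e_def)
  qed
  then have m0: "m > 0" by simp
  have em: "e m \<noteq> 0" using m by (simp add: e_def)
  obtain s where s: "0 < s" "\<And>z::real. z \<in> cball 0 s - {0} \<Longrightarrow> (\<lambda>_. 0::real) z \<noteq> 0"
    by (rule powser_0_nonzero[of r 0 e "\<lambda>_. 0::real" m]) (use r sums em m0 in auto)
  show False using s(2)[of s] s(1) by auto
qed

text \<open>An identity between real power series passes to every Banach algebra, because it is an
  identity between coefficients.\<close>
lemma pser_mult_transfer:
  fixes A :: "'b::{real_normed_algebra_1,banach}"
  assumes "abs_conv r a" "abs_conv r b" "abs_conv r c" "norm A < r"
    and eq: "\<And>w::real. \<bar>w\<bar> < r \<Longrightarrow> pser a w * pser b w = pser c w"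
  shows "pser a A * pser b A = pser c A" "pser b A * pser a A = pser c A"
proof -
  have r: "0 < r" using assms(4) norm_ge_zero[of A] by linarith
  have "(\<lambda>n. \<Sum>i\<le>n. a i * b (n - i)) = c"
    by (rule pser_uniq[OF r abs_conv_Cauchy_product[OF assms(1,2)] assms(3)])
       (simp add: eq pser_mult[OF assms(1,2), symmetric])
  then show "pser a A * pser b A = pser c A"
    using pser_mult[OF assms(1,2,4)] by simp
  have "(\<lambda>n. \<Sum>i\<le>n. b i * a (n - i)) = c"
    by (rule pser_uniq[OF r abs_conv_Cauchy_product[OF assms(2,1)] assms(3)])
       (simp add: eq pser_mult[OF assms(2,1), symmetric] mult.commute[of "pser b _"])
  then show "pser b A * pser a A = pser c A"
    using pser_mult[OF assms(2,1,4)] by simp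
qed

section \<open>The exponential series and \<open>Eop\<close>\<close>

lemma abs_conv_exp: "abs_conv r (\<lambda>n. c ^ n / fact n)"
  unfolding abs_conv_def
proof (intro allI impI)
  fix s :: real assume s: "0 \<le> s" "s < r"
  have "summable (\<lambda>n. norm ((\<bar>c\<bar> * s) ^ n /\<^sub>R fact n))" by (rule summable_norm_exp)
  then show "summable (\<lambda>n. \<bar>c ^ n / fact n\<bar> * s ^ n)"
    using s by (simp add: abs_mult power_mult_distrib power_abs field_simps)
qed

lemma pser_exp:
  fixes A :: "'b::{real_normed_algebra_1,banach}"
  shows "pser (\<lambda>n. c ^ n / fact n) A = exp (c *\<^sub>R A)"
  by (simp add: pser_def exp_def power_mult_distrib scaleR_power divide_inverse mult.commute)

definition ecoeff :: "nat \<Rightarrow> real" where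
  "ecoeff n = 2 ^ n / fact (Suc n)"

lemma abs_conv_ecoeff: "abs_conv r ecoeff"
  unfolding abs_conv_def
proof (intro allI impI)
  fix s :: real assume s: "0 \<le> s" "s < r"
  have "summable (\<lambda>n. \<bar>2 ^ n / fact n\<bar> * s ^ n)"
    using abs_convD[OF abs_conv_exp s] .
  then show "summable (\<lambda>n. \<bar>ecoeff n\<bar> * s ^ n)"
  proof (rule summable_comparison_test')
    fix n
    have "fact n \<le> (fact (Suc n)::real)" by (rule fact_mono) simp
    then have "ecoeff n \<le> 2 ^ n / fact n"
      unfolding ecoeff_def by (intro divide_left_mono) auto
    moreover have "0 \<le> ecoeff n" by (simp add: ecoeff_def)
    ultimately show "norm (\<bar>ecoeff n\<bar> * s ^ n) \<le> \<bar>2 ^ n / fact n\<bar> * s ^ n"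
      using s mult_right_mono[of "ecoeff n" "2 ^ n / fact n" "s ^ n"] by (simp add: abs_mult)
  qed
qed

text \<open>\<open>Eop A = (exp (2 A) - 1) / (2 A) = \<integral>\<^sub>0\<^sup>1 exp (2 r A) dr\<close>.\<close>
definition Eop :: "'b \<Rightarrow> 'b::{real_normed_algebra_1,banach}" where
  "Eop A = pser ecoeff A"

lemma Eop_mult: "2 *\<^sub>R (A * Eop A) = exp (2 *\<^sub>R A) - 1" "2 *\<^sub>R (Eop A * A) = exp (2 *\<^sub>R A) - 1"
proof -
  have sm: "summable (\<lambda>n. ecoeff n *\<^sub>R A ^ n)"
    by (rule summable_norm_cancel, rule abs_conv_summable_norm[OF abs_conv_ecoeff, of A "norm A + 1"]) simp
  have eq: "(\<lambda>n. (2 *\<^sub>R A) ^ Suc n /\<^sub>R fact (Suc n)) = (\<lambda>n. (2 *\<^sub>R A) * (ecoeff n *\<^sub>R A ^ n))"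
    by (auto simp: ecoeff_def power_mult_distrib scaleR_power divide_inverse mult_ac)
  have "exp (2 *\<^sub>R A) - 1 = (\<Sum>n. (2 *\<^sub>R A) ^ Suc n /\<^sub>R fact (Suc n))"
    using suminf_split_head[OF summable_exp_generic[of "2 *\<^sub>R A"]] by (simp add: exp_def)
  also have "\<dots> = (2 *\<^sub>R A) * Eop A"
    unfolding eq Eop_def pser_def by (rule suminf_mult[OF sm])
  finally show 1: "2 *\<^sub>R (A * Eop A) = exp (2 *\<^sub>R A) - 1" by simp
  have "A * Eop A = (\<Sum>n. A * (ecoeff n *\<^sub>R A ^ n))"
    unfolding Eop_def pser_def by (rule suminf_mult[OF sm, symmetric])
  also have "\<dots> = (\<Sum>n. (ecoeff n *\<^sub>R A ^ n) * A)"
    by (simp add: power_commutes)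
  also have "\<dots> = Eop A * A"
    unfolding Eop_def pser_def by (rule suminf_mult2[OF sm, symmetric])
  finally show "2 *\<^sub>R (Eop A * A) = exp (2 *\<^sub>R A) - 1" using 1 by simp
qed

lemma Eop_0 [simp]: "Eop 0 = 1"
proof -
  show ?thesis unfolding Eop_def pser_def
    by (subst suminf_finite[of "{0}"]) (auto simp: ecoeff_def gr0_conv_Suc)
qed

lemma Eop_real: "w \<noteq> 0 \<Longrightarrow> Eop w = (exp (2 * w) - 1) / (2 * w)" for w :: real
  using Eop_mult(1)[of w] by (simp add: field_simps)

text \<open>For skew \<open>A\<close> the adjoint of \<open>Eop A\<close> is
  \<open>Eop (- A)\<close>. This relation turns the adjoint back into \<open>Eop A\<close>, and so
  gives access to the adjoint of the inverse \<open>Iop A\<close>.\<close>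

lemma Eop_uminus: "exp (2 *\<^sub>R A) * Eop (- A) = Eop A"
proof -
  define a where "a n = (-1) ^ n * ecoeff n" for n
  have neg: "pser a B = Eop (- B)" for B :: "'b::{real_normed_algebra_1,banach}"
    unfolding pser_def Eop_def a_def by (rule suminf_cong) (metis (no_types, lifting) minus_one_power_iff mult_minus_left mult_1 power_minus scaleR_minus_left scaleR_minus_right)
  have a: "abs_conv r a" for r
    using abs_conv_ecoeff by (simp add: abs_conv_def a_def abs_mult power_abs)
  have "pser (\<lambda>n. 2 ^ n / fact n) A * pser a A = pser ecoeff A"
  proof (rule pser_mult_transfer(1)[OF abs_conv_exp a abs_conv_ecoeff, of _ "norm A + 1"])
    fix w :: real
    show "pser (\<lambda>n. 2 ^ n / fact n) w * pser a w = pser ecoeff w"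
      unfolding neg pser_exp Eop_def[symmetric]
      by (cases "w = 0") (simp_all add: Eop_real[of w] Eop_real[of "- w"] field_simps flip: exp_add)
  qed simp
  then show ?thesis unfolding neg pser_exp Eop_def .
qed

section \<open>The Taylor series of \<open>z cot z\<close> and the inverse of
  \<open>Eop\<close>\<close>

lemma sin_nonzero_ball: "0 < norm z \<Longrightarrow> norm z < pi \<Longrightarrow> sin z \<noteq> (0::complex)"
proof
  assume z: "0 < norm z" "norm z < pi" and "sin z = 0"
  then obtain n :: int where n: "z = of_real (of_int n * pi)"
    by (auto simp: sin_eq_0)
  then have "norm z = \<bar>of_int n\<bar> * pi" by (simp add: norm_mult)
  moreover have "n \<noteq> 0" using n z by auto
  then have "1 * pi \<le> \<bar>of_int n\<bar> * pi" by (intro mult_right_mono) auto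
  ultimately show False using z by simp
qed

text \<open>The only zero of \<open>sin\<close> in this disc is the origin, where the singularity is
  removable. Hence the series behind \<open>mat_zcot\<close> converges up to the radius
  \<open>pi\<close> that also bounds \<open>Omega_star\<close>.\<close>

lemma zcot_holomorphic: "zcot holomorphic_on ball 0 pi"
proof (rule no_isolated_singularity)
  have h: "(\<lambda>z. z * (cos z / sin z)) holomorphic_on ball 0 pi - {0}"
    by (intro holomorphic_intros) (use sin_nonzero_ball in auto)
  then show hol: "zcot holomorphic_on ball 0 pi - {0}"
    by (rule holomorphic_transform) (simp add: zcot_def cot_def)
  have "((\<lambda>z::complex. sin z / z) \<longlongrightarrow> 1) (at 0)"
    using DERIV_sin[of "0::complex"] by (simp add: has_field_derivative_iff)
  then have "((\<lambda>z::complex. cos z / (sin z / z)) \<longlongrightarrow> 1) (at 0)"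
    using tendsto_divide[of cos 1 "at (0::complex)" "\<lambda>z. sin z / z" 1] isCont_cos[of "0::complex"]
    by (simp add: isCont_def)
  then have "(zcot \<longlongrightarrow> 1) (at 0)"
    by (rule Lim_transform_eventually) (auto simp: eventually_at_filter zcot_def cot_def intro!: always_eventually)
  then have "continuous (at 0) zcot"
    by (simp add: continuous_at zcot_def)
  moreover have "continuous (at z) zcot" if "z \<in> ball 0 pi - {0}" for z
    using holomorphic_on_imp_continuous_on[OF hol] that
    by (simp add: continuous_on_eq_continuous_at open_Diff)
  ultimately have "continuous (at z) zcot" if "z \<in> ball 0 pi" for z
    using that by (cases "z = 0") auto
  then show "continuous_on (ball 0 pi) zcot"
    by (simp add: continuous_at_imp_continuous_on)
qed auto

lemma zcot_sums: "norm z < pi \<Longrightarrow> (\<lambda>n. zcot_coeff n * z ^ n) sums zcot z"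
  using holomorphic_power_series[OF zcot_holomorphic, of z] by (simp add: zcot_coeff_def)

lemma zcot_coeff_abs_conv: "abs_conv pi (\<lambda>n. norm (zcot_coeff n))"
  unfolding abs_conv_def
proof (intro allI impI)
  fix s :: real assume s: "0 \<le> s" "s < pi"
  obtain t where t: "s < t" "t < pi" using dense s by blast
  have "summable (\<lambda>n. zcot_coeff n * of_real t ^ n)"
    using zcot_sums[of "of_real t"] t s sums_summable by auto
  from powser_insidea[OF this, of "of_real s"] show "summable (\<lambda>n. \<bar>norm (zcot_coeff n)\<bar> * s ^ n)"
    using s t by (simp add: norm_mult norm_power)
qed

text \<open>The Taylor coefficients of \<open>w coth w\<close>, which is \<open>z cot z\<close> at \<open>z = \<i> w\<close>.\<close>
definition kcoeff :: "nat \<Rightarrow> real" where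
  "kcoeff n = Re (zcot_coeff n * \<i> ^ n)"

lemma abs_conv_kcoeff: "abs_conv pi kcoeff"
  unfolding abs_conv_def
proof (intro allI impI)
  fix s :: real assume s: "0 \<le> s" "s < pi"
  show "summable (\<lambda>n. \<bar>kcoeff n\<bar> * s ^ n)"
  proof (rule summable_comparison_test'[OF abs_convD[OF zcot_coeff_abs_conv s]])
    fix n
    have "\<bar>kcoeff n\<bar> \<le> norm (zcot_coeff n * \<i> ^ n)"
      unfolding kcoeff_def by (rule abs_Re_le_cmod)
    then show "norm (\<bar>kcoeff n\<bar> * s ^ n) \<le> \<bar>cmod (zcot_coeff n)\<bar> * s ^ n"
      using s by (simp add: norm_mult norm_power mult_right_mono)
  qed
qed

lemma pser_kcoeff_real:
  fixes w :: real assumes w: "\<bar>w\<bar> < pi" "w \<noteq> 0"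
  shows "pser kcoeff w = w * cosh w / sinh w"
proof -
  have "(\<lambda>n. zcot_coeff n * (\<i> * of_real w) ^ n) sums zcot (\<i> * of_real w)"
    by (rule zcot_sums) (use w in \<open>simp add: norm_mult\<close>)
  then have "(\<lambda>n. Re (zcot_coeff n * (\<i> * of_real w) ^ n)) sums Re (zcot (\<i> * of_real w))"
    by (rule sums_Re)
  moreover have "Re (zcot_coeff n * (\<i> * of_real w) ^ n) = kcoeff n * w ^ n" for n
    by (simp add: kcoeff_def power_mult_distrib flip: of_real_power) (simp add: algebra_simps)
  moreover have "zcot (\<i> * of_real w) = of_real (w * cosh w / sinh w)"
  proof -
    have c: "cos (\<i> * of_real w) = of_real (cosh w)"
      by (simp add: cos_exp_eq cosh_def exp_of_real exp_minus scaleR_conv_of_real field_simps flip: of_real_exp)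
    have s: "sin (\<i> * of_real w) = \<i> * of_real (sinh w)"
      by (simp add: sin_exp_eq sinh_def exp_of_real exp_minus scaleR_conv_of_real field_simps flip: of_real_exp)
    show ?thesis using w by (simp add: zcot_def cot_def c s)
  qed
  ultimately show ?thesis
    unfolding pser_def by (simp add: sums_iff)
qed

text \<open>\<open>Iop A = A coth A - A\<close>, the inverse of \<open>Eop A\<close> when \<open>norm A < pi\<close>.\<close>
definition Iop :: "'b \<Rightarrow> 'b::{real_normed_algebra_1,banach}" where
  "Iop A = pser kcoeff A - A"

text \<open>On the real line \<open>w coth w - w = 2 w / (exp (2 w) - 1)\<close>, the reciprocal of
  the function behind \<open>Eop\<close>; comparison of coefficients carries this to the
  algebra.\<close>

lemma Eop_Iop:
  fixes A :: "'b::{real_normed_algebra_1,banach}"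
  assumes A: "norm A < pi"
  shows "Eop A * Iop A = 1" "Iop A * Eop A = 1"
proof -
  \<comment> \<open>\<open>l\<close> and \<open>u\<close> are the coefficient sequences of
    \<open>- w\<close> and of the constant 1, so that \<open>Iop\<close> and the unit are power
    series as well.\<close>
  define l :: "nat \<Rightarrow> real" where "l n = (if n = 1 then -1 else 0)" for n
  define u :: "nat \<Rightarrow> real" where "u n = (if n = 0 then 1 else 0)" for n
  have fin: "summable (\<lambda>n. if n = k then f n else 0)" for f :: "nat \<Rightarrow> real" and k
    by (rule summable_finite[of "{k}"]) auto
  have "abs_conv pi l"
    unfolding abs_conv_def l_def using fin[of 1] by (auto simp: if_distrib[of "\<lambda>x. x * _"] if_distrib[of abs] cong: if_cong)
  moreover have u: "abs_conv pi u"
    unfolding abs_conv_def u_def using fin[of 0] by (auto simp: if_distrib[of "\<lambda>x. x * _"] if_distrib[of abs] cong: if_cong)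
  ultimately have c: "abs_conv pi (\<lambda>n. kcoeff n + l n)"
    by (intro abs_conv_add abs_conv_kcoeff)
  have pl: "pser l B = - B" for B :: "'c::{real_normed_algebra_1,banach}"
  proof -
    show ?thesis unfolding pser_def
      by (subst suminf_finite[of "{1}"]) (auto simp: l_def)
  qed
  have pu: "pser u B = 1" for B :: "'c::{real_normed_algebra_1,banach}"
  proof -
    show ?thesis unfolding pser_def
      by (subst suminf_finite[of "{0}"]) (auto simp: u_def)
  qed
  have kl: "pser (\<lambda>n. kcoeff n + l n) B = Iop B" if "norm B < pi" for B :: "'c::{real_normed_algebra_1,banach}"
    using pser_add[OF abs_conv_kcoeff \<open>abs_conv pi l\<close> that] by (simp add: pl Iop_def)
  have eq: "pser ecoeff w * pser (\<lambda>n. kcoeff n + l n) w = pser u w" if w: "\<bar>w\<bar> < pi" for w :: real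
  proof (cases "w = 0")
    case True
    have "Re (zcot_coeff 0) = 1" by (simp add: zcot_coeff_def zcot_def)
    then have "pser (\<lambda>n. kcoeff n + l n) (0::real) = 1"
      unfolding pser_def by (subst suminf_finite[of "{0}"]) (auto simp: kcoeff_def l_def)
    then show ?thesis unfolding True pu by (simp add: Eop_def[symmetric])
  next
    case False
    have "sinh w \<noteq> 0" using False by simp
    moreover have "cosh w - sinh w = exp (- w)" by (simp add: cosh_minus_sinh)
    moreover have "exp (2 * w) - 1 = 2 * exp w * sinh w"
      unfolding sinh_def exp_double by (simp add: exp_minus field_simps power2_eq_square)
    ultimately have "Eop w * Iop w = exp w * exp (- w)"
      unfolding Eop_real[OF False] Iop_def pser_kcoeff_real[OF w False]
      using False by (simp add: field_simps)
    then show ?thesis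
      using kl[of w] w by (simp add: pu Eop_def exp_minus_inverse)
  qed
  from pser_mult_transfer[OF abs_conv_ecoeff c u A eq]
  show "Eop A * Iop A = 1" "Iop A * Eop A = 1"
    by (simp_all add: kl[OF A] pu Eop_def)
qed

subsection \<open>The operators attached to a family of matrices\<close>

unbundle no fps_syntax

definition Jop :: "('m::finite \<Rightarrow> real^'q::finite^'q) \<Rightarrow> real^'m \<Rightarrow> (real^'q) endo" where
  "Jop U \<tau> = lin (\<lambda>x. \<Sum>j\<in>UNIV. \<tau>$j *\<^sub>R (U j *v x))"

lemma app_Jop: "Jop U \<tau> \<bullet>\<^sub>v x = (\<Sum>j\<in>UNIV. \<tau>$j *\<^sub>R (U j *v x))"
  unfolding Jop_def
  by (rule app_lin) (intro linear_compose_sum linear_compose_scale_right ballI matrix_vector_mul_linear)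

lemma bounded_linear_Jop: "bounded_linear (Jop U)"
proof -
  have "linear (Jop U)"
    by (rule linearI; rule endo_eqI)
       (simp_all add: app_Jop app.add_left app.scaleR_left scaleR_add_left sum.distrib scaleR_sum_right)
  then show ?thesis by (simp add: linear_conv_bounded_linear)
qed

lemma Jop_scaleR: "Jop U (s *\<^sub>R \<tau>) = s *\<^sub>R Jop U \<tau>"
  by (rule linear_cmul[OF bounded_linear.linear[OF bounded_linear_Jop]])

lemma inner_skew:
  assumes "transpose A = - (A :: real^'q::finite^'q)" shows "(A *v x) \<bullet> y = - (x \<bullet> (A *v y))"
proof -
  have "(A *v x) \<bullet> y = x \<bullet> (transpose A *v y)"
    by (metis dot_lmul_matrix inner_commute transpose_matrix_vector)
  also have "transpose A *v y = - (A *v y)"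
    by (simp add: assms vec_eq_iff matrix_vector_mult_def sum_negf)
  finally show ?thesis by simp
qed

lemma Jop_skew:
  assumes "\<And>j. transpose (U j) = - U j"
  shows "(Jop U \<tau> \<bullet>\<^sub>v x) \<bullet> y = - (x \<bullet> (Jop U \<tau> \<bullet>\<^sub>v y))"
  by (simp add: app_Jop inner_sum_left inner_sum_right inner_skew[OF assms] sum_negf)

lemma Jop_nth: "(Jop U \<tau> \<bullet>\<^sub>v x) $ a = (\<Sum>b\<in>UNIV. (\<Sum>j\<in>UNIV. \<tau>$j * U j $ a $ b) * x $ b)"
  unfolding app_Jop
  by (simp add: matrix_vector_mult_def sum_distrib_left sum_distrib_right mult.assoc) (rule sum.swap)

section \<open>The complex matrix \<open>Utau\<close> in terms of the real operator
  \<open>Jop\<close>\<close>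

lemma Utau_mult_nth:
  "(Utau U \<tau> *v v) $ a = \<i> * Complex ((Jop U \<tau> \<bullet>\<^sub>v (\<chi> b. Re (v $ b))) $ a) ((Jop U \<tau> \<bullet>\<^sub>v (\<chi> b. Im (v $ b))) $ a)"
  by (simp add: matrix_vector_mult_def Utau_def Jop_nth complex_eq_iff Re_sum Im_sum sum_negf flip: sum_distrib_left)

lemma norm_complex_vec_sq:
  "(norm (v::complex^'q::finite))\<^sup>2 = (norm (\<chi> b. Re (v $ b)))\<^sup>2 + (norm (\<chi> b. Im (v $ b)))\<^sup>2"
  by (simp add: norm_vec_def L2_set_def sum_nonneg real_sqrt_pow2 cmod_power2 sum.distrib)

lemma norm_Utau_mult_sq:
  "(norm (Utau U \<tau> *v v))\<^sup>2 = (norm (Jop U \<tau> \<bullet>\<^sub>v (\<chi> b. Re (v $ b))))\<^sup>2 + (norm (Jop U \<tau> \<bullet>\<^sub>v (\<chi> b. Im (v $ b))))\<^sup>2"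
  unfolding norm_complex_vec_sq[of "Utau U \<tau> *v v"] Utau_mult_nth
  by (simp add: vec_lambda_eta norm_vec_def L2_set_def)

text \<open>\<open>Utau\<close> is \<open>i J\<close> with \<open>J\<close> real, so it acts on real
  and imaginary parts separately and the squared norms add up. Real vectors give the reverse
  inequality.\<close>

lemma opnorm_Utau:
  fixes U :: "'m::finite \<Rightarrow> real^'q::finite^'q"
  shows "opnorm (Utau U \<tau>) = norm (Jop U \<tau>)"
proof (rule antisym)
  let ?J = "Jop U \<tau>"
  have lin: "bounded_linear (\<lambda>v. Utau U \<tau> *v v)"
  proof -
    have "linear (\<lambda>v. Utau U \<tau> *v v)"
      by (rule linearI)
         (simp_all add: matrix_vector_right_distrib vec_eq_iff matrix_vector_mult_def scaleR_sum_right distrib_left sum.distrib)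
    then show ?thesis by (simp add: linear_conv_bounded_linear)
  qed
  show "opnorm (Utau U \<tau>) \<le> norm ?J"
    unfolding opnorm_def
  proof (rule onorm_le)
    fix v :: "complex^'q"
    have "(norm (Utau U \<tau> *v v))\<^sup>2 \<le> (norm ?J * norm (\<chi> b. Re (v $ b)))\<^sup>2 + (norm ?J * norm (\<chi> b. Im (v $ b)))\<^sup>2"
      unfolding norm_Utau_mult_sq by (intro add_mono power_mono norm_app_le) auto
    also have "\<dots> = (norm ?J * norm v)\<^sup>2"
      by (simp add: power_mult_distrib norm_complex_vec_sq[of v] distrib_left)
    finally show "norm (Utau U \<tau> *v v) \<le> norm ?J * norm v"
      by (rule power2_le_imp_le) simp
  qed
  show "norm ?J \<le> opnorm (Utau U \<tau>)"
  proof (rule norm_endo_le)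
    show "0 \<le> opnorm (Utau U \<tau>)" unfolding opnorm_def by (rule onorm_pos_le[OF lin])
    fix x :: "real^'q"
    define v :: "complex^'q" where "v = (\<chi> b. of_real (x $ b))"
    have "(norm (Utau U \<tau> *v v))\<^sup>2 = (norm (?J \<bullet>\<^sub>v x))\<^sup>2"
      unfolding norm_Utau_mult_sq by (simp add: v_def app.zero_right vec_lambda_eta flip: zero_vec_def)
    moreover have "(norm v)\<^sup>2 = (norm x)\<^sup>2"
      unfolding norm_complex_vec_sq by (simp add: v_def vec_lambda_eta flip: zero_vec_def)
    ultimately have "norm (?J \<bullet>\<^sub>v x) = norm (Utau U \<tau> *v v)" "norm v = norm x"
      by (simp_all add: power2_eq_iff_nonneg)
    then show "norm (?J \<bullet>\<^sub>v x) \<le> opnorm (Utau U \<tau>) * norm x"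
      using onorm[OF lin, of v] unfolding opnorm_def by simp
  qed
qed

lemma Omega_star_eq: "Omega_star U = {\<tau>. norm (Jop U \<tau>) < pi}"
  by (simp add: Omega_star_def opnorm_Utau)

lemma cmatpow_Utau: "cmatpow (Utau U \<tau>) n $ a $ b = \<i> ^ n * of_real ((Jop U \<tau> ^ n \<bullet>\<^sub>v axis b 1) $ a)"
proof (induction n arbitrary: a)
  case 0
  show ?case by (simp add: cmatpow_def mat_def axis_def)
next
  case (Suc n)
  have "cmatpow (Utau U \<tau>) (Suc n) $ a $ b = (\<Sum>c\<in>UNIV. Utau U \<tau> $ a $ c * cmatpow (Utau U \<tau>) n $ c $ b)"
    by (simp add: cmatpow_def matrix_matrix_mult_def)
  also have "\<dots> = \<i> ^ Suc n * of_real (\<Sum>c\<in>UNIV. (\<Sum>j\<in>UNIV. \<tau>$j * U j $ a $ c) * (Jop U \<tau> ^ n \<bullet>\<^sub>v axis b 1) $ c)"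
  proof -
    have "Utau U \<tau> $ a $ c * (\<i> ^ n * of_real y) = \<i> ^ Suc n * of_real ((\<Sum>j\<in>UNIV. \<tau>$j * U j $ a $ c) * y)"
      for c y by (simp add: Utau_def mult_ac)
    then show ?thesis unfolding Suc of_real_sum sum_distrib_left by (intro sum.cong) auto
  qed
  finally show ?case by (simp add: Jop_nth)
qed

lemma bounded_linear_app_nth: "bounded_linear (\<lambda>A. (A \<bullet>\<^sub>v x) $ a)" for x :: "real^'q::finite"
  by (rule bounded_linear_compose[OF bounded_linear_vec_nth app.bounded_linear_left])

text \<open>The powers of \<open>i J\<close> are \<open>i ^ n J ^ n\<close>, so taking real parts
  term by term turns the coefficients of \<open>z cot z\<close> into \<open>kcoeff\<close>.\<close>

lemma Re_mat_zcot:
  assumes "norm (Jop U \<tau>) < pi"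
  shows "Re (mat_zcot (Utau U \<tau>) $ a $ b) = (pser kcoeff (Jop U \<tau>) \<bullet>\<^sub>v axis b 1) $ a"
proof -
  let ?J = "Jop U \<tau>"
  define e where "e n a b = zcot_coeff n * (\<i> ^ n * of_real ((?J ^ n \<bullet>\<^sub>v axis b 1) $ a))" for n a b
  have bound: "norm (e n a b) \<le> \<bar>norm (zcot_coeff n)\<bar> * norm ?J ^ n" for n a b
  proof -
    have "\<bar>(?J ^ n \<bullet>\<^sub>v axis b 1) $ a\<bar> \<le> norm (?J ^ n \<bullet>\<^sub>v axis b 1)"
      by (rule component_le_norm_cart)
    also have "\<dots> \<le> norm (?J ^ n)"
      using norm_app_le[of "?J ^ n" "axis b 1"] by simp
    also have "\<dots> \<le> norm ?J ^ n" by (rule norm_power_ineq)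
    finally show ?thesis by (simp add: e_def norm_mult norm_power mult_left_mono)
  qed
  have sm: "summable (\<lambda>n. e n a b)" for a b
    by (rule summable_comparison_test'[OF abs_convD[OF zcot_coeff_abs_conv norm_ge_zero assms] bound])
  have "(\<lambda>n. cmat_scale (zcot_coeff n) (cmatpow (Utau U \<tau>) n)) sums (\<chi> a b. \<Sum>n. e n a b)"
    unfolding sums_def
  proof (intro vec_tendstoI)
    fix a b
    have "(\<lambda>N. \<Sum>n<N. e n a b) \<longlonglongrightarrow> (\<Sum>n. e n a b)"
      using summable_sums[OF sm] by (simp add: sums_def)
    then show "(\<lambda>N. (\<Sum>n<N. cmat_scale (zcot_coeff n) (cmatpow (Utau U \<tau>) n)) $ a $ b) \<longlonglongrightarrow> (\<chi> a b. \<Sum>n. e n a b) $ a $ b"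
      by (simp add: cmat_scale_def cmatpow_Utau e_def)
  qed
  then have "mat_zcot (Utau U \<tau>) $ a $ b = (\<Sum>n. e n a b)"
    unfolding mat_zcot_def by (simp add: sums_iff)
  then have "Re (mat_zcot (Utau U \<tau>) $ a $ b) = (\<Sum>n. Re (e n a b))"
    by (simp add: Re_suminf sm)
  also have "\<dots> = (\<Sum>n. ((kcoeff n *\<^sub>R ?J ^ n) \<bullet>\<^sub>v axis b 1) $ a)"
  proof (rule suminf_cong)
    fix n
    have "e n a b = (zcot_coeff n * \<i> ^ n) * of_real ((?J ^ n \<bullet>\<^sub>v axis b 1) $ a)"
      by (simp add: e_def mult.assoc)
    then show "Re (e n a b) = ((kcoeff n *\<^sub>R ?J ^ n) \<bullet>\<^sub>v axis b 1) $ a"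
      unfolding kcoeff_def app.scaleR_left by (metis Re_complex_of_real Im_complex_of_real times_complex.sel(1) mult_zero_right diff_zero real_scaleR_def vector_scaleR_component)
  qed
  also have "\<dots> = (pser kcoeff ?J \<bullet>\<^sub>v axis b 1) $ a"
    unfolding pser_def
    by (rule bounded_linear.suminf[OF bounded_linear_app_nth, symmetric])
       (rule summable_norm_cancel[OF abs_conv_summable_norm[OF abs_conv_kcoeff assms]])
  finally show ?thesis .
qed

lemma phi_eq:
  assumes skew: "\<And>j. transpose (U j) = - U j" and \<tau>: "norm (Jop U \<tau>) < pi"
  shows "phi U g \<tau> = (Iop (Jop U \<tau>) \<bullet>\<^sub>v fst g) \<bullet> fst g + 4 * (snd g \<bullet> \<tau>)"
proof -
  let ?J = "Jop U \<tau>" and ?K = "pser kcoeff (Jop U \<tau>)"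
  define x where "x = fst g"
  have "x = (\<Sum>b\<in>UNIV. x $ b *\<^sub>R axis b 1)"
    by (simp add: vec_eq_iff axis_def if_distrib cong: if_cong)
  then have "?K \<bullet>\<^sub>v x = (\<Sum>b\<in>UNIV. x $ b *\<^sub>R (?K \<bullet>\<^sub>v axis b 1))"
    by (metis (no_types, lifting) app.scaleR_right app.sum_right sum.cong)
  then have K: "(?K \<bullet>\<^sub>v x) $ a = (\<Sum>b\<in>UNIV. x $ b * (?K \<bullet>\<^sub>v axis b 1) $ a)" for a
    by simp
  have "Re (\<Sum>a\<in>UNIV. \<Sum>b\<in>UNIV. mat_zcot (Utau U \<tau>) $ a $ b * complex_of_real (x $ b) * complex_of_real (x $ a))
      = (?K \<bullet>\<^sub>v x) \<bullet> x"
    by (simp add: Re_sum Re_mat_zcot[OF \<tau>] inner_vec_def K sum_distrib_right sum_distrib_left mult_ac)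
  moreover have "(?J \<bullet>\<^sub>v x) \<bullet> x = 0"
    using Jop_skew[where U=U and \<tau>=\<tau> and x=x and y=x, OF skew] by (simp add: inner_commute)
  ultimately show ?thesis
    unfolding phi_def Let_def Iop_def x_def[symmetric] by (simp add: app.diff_left inner_diff_left)
qed

subsection \<open>Adjoints and the Riccati equation\<close>

definition adj :: "'a::euclidean_space endo \<Rightarrow> 'a endo \<Rightarrow> bool" where
  "adj A B \<longleftrightarrow> (\<forall>x y. (A \<bullet>\<^sub>v x) \<bullet> y = x \<bullet> (B \<bullet>\<^sub>v y))"

lemma adjD: "adj A B \<Longrightarrow> (A \<bullet>\<^sub>v x) \<bullet> y = x \<bullet> (B \<bullet>\<^sub>v y)"
  by (simp add: adj_def)

lemma adj_power: "adj A B \<Longrightarrow> adj (A ^ n) (B ^ n)"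
proof (induction n)
  case (Suc n)
  then show ?case
    unfolding adj_def power_Suc by (metis app_mult power_commutes)
qed (simp add: adj_def)

lemma adj_scaleR: "adj A B \<Longrightarrow> adj (c *\<^sub>R A) (c *\<^sub>R B)"
  by (simp add: adj_def app.scaleR_left)

lemma adj_pser:
  assumes "abs_conv r a" "norm A < r" "norm B < r" "adj A B"
  shows "adj (pser a A) (pser a B)"
  unfolding adj_def
proof (intro allI)
  fix x y
  have "(pser a A \<bullet>\<^sub>v x) \<bullet> y = (\<Sum>n. ((a n *\<^sub>R A ^ n) \<bullet>\<^sub>v x) \<bullet> y)"
    unfolding pser_def
    by (rule bounded_linear.suminf[OF bounded_linear_compose[OF bounded_linear_inner_left app.bounded_linear_left]])
       (rule summable_norm_cancel[OF abs_conv_summable_norm[OF assms(1,2)]])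
  also have "\<dots> = (\<Sum>n. x \<bullet> ((a n *\<^sub>R B ^ n) \<bullet>\<^sub>v y))"
    by (simp only: adjD[OF adj_scaleR[OF adj_power[OF assms(4)]]])
  also have "\<dots> = x \<bullet> (pser a B \<bullet>\<^sub>v y)"
    unfolding pser_def
    by (rule bounded_linear.suminf[OF bounded_linear_compose[OF bounded_linear_inner_right app.bounded_linear_left], symmetric])
       (rule summable_norm_cancel[OF abs_conv_summable_norm[OF assms(1,3)]])
  finally show "(pser a A \<bullet>\<^sub>v x) \<bullet> y = x \<bullet> (pser a B \<bullet>\<^sub>v y)" .
qed

lemma adj_exp:
  assumes "adj J (- J)" shows "adj (exp (c *\<^sub>R J)) (exp (- (c *\<^sub>R J)))"
proof -
  have "adj (pser (\<lambda>n. c ^ n / fact n) J) (pser (\<lambda>n. c ^ n / fact n) (- J))"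
    by (rule adj_pser[OF abs_conv_exp _ _ assms, of "norm J + 1"]) auto
  then show ?thesis by (simp add: pser_exp)
qed

lemma norm_exp_skew:
  assumes "adj J (- J)" shows "norm (exp (c *\<^sub>R J) \<bullet>\<^sub>v x) = norm x"
proof -
  have "(exp (c *\<^sub>R J) \<bullet>\<^sub>v x) \<bullet> (exp (c *\<^sub>R J) \<bullet>\<^sub>v x) = x \<bullet> ((exp (- (c *\<^sub>R J)) * exp (c *\<^sub>R J)) \<bullet>\<^sub>v x)"
    by (simp add: adjD[OF adj_exp[OF assms]])
  also have "exp (- (c *\<^sub>R J)) * exp (c *\<^sub>R J) = 1"
    using exp_minus_inverse[of "- (c *\<^sub>R J)"] by simp
  finally show ?thesis by (simp add: norm_eq_sqrt_inner)
qed

section \<open>The Riccati equation for \<open>J coth (s J)\<close>\<close>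

lemma Iop_exp:
  fixes A :: "'b::{real_normed_algebra_1,banach}"
  assumes "norm A < pi"
  shows "Iop A * exp (2 *\<^sub>R A) = Iop A + 2 *\<^sub>R A" "exp (2 *\<^sub>R A) * Iop A = Iop A + 2 *\<^sub>R A"
proof -
  have e: "exp (2 *\<^sub>R A) = 1 + 2 *\<^sub>R (Eop A * A)" "exp (2 *\<^sub>R A) = 1 + 2 *\<^sub>R (A * Eop A)"
    using Eop_mult[of A] by (simp_all add: algebra_simps)
  show "Iop A * exp (2 *\<^sub>R A) = Iop A + 2 *\<^sub>R A"
    unfolding e(1) by (simp add: distrib_left mult.assoc[symmetric] Eop_Iop[OF assms])
  show "exp (2 *\<^sub>R A) * Iop A = Iop A + 2 *\<^sub>R A"
    unfolding e(2) by (simp add: distrib_right mult.assoc Eop_Iop[OF assms])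
qed

text \<open>In classical terms \<open>A coth A\<close> is symmetric and \<open>A\<close> is skew, so
  the adjoint of their difference is their sum. The proof writes both vectors as images under
  \<open>Eop A\<close>, which reduces the claim to the adjoint of an entire series.\<close>

lemma Iop_adj:
  assumes skew: "adj A (- A)" and A: "norm A < pi"
  shows "adj (Iop A) (Iop A + 2 *\<^sub>R A)"
  unfolding adj_def
proof (intro allI)
  fix x y
  define u v where "u = Iop A \<bullet>\<^sub>v x" and "v = Iop A \<bullet>\<^sub>v y"
  have x: "x = Eop A \<bullet>\<^sub>v u" and y: "y = Eop A \<bullet>\<^sub>v v"
    unfolding u_def v_def by (metis app_mult app_one Eop_Iop(1)[OF A])+
  have EE: "adj (Eop (- A)) (Eop A)"
    unfolding Eop_def
    by (rule adj_pser[OF abs_conv_ecoeff, of _ "norm A + 1"]) (use skew in \<open>auto simp: adj_def app.minus_left\<close>)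
  have exEm: "Eop (- A) = exp (- (2 *\<^sub>R A)) * Eop A"
    using Eop_uminus[of "- A"] by simp
  have "u \<bullet> y = (Eop (- A) \<bullet>\<^sub>v u) \<bullet> v"
    unfolding y by (rule adjD[OF EE, symmetric])
  also have "\<dots> = (exp (- (2 *\<^sub>R A)) \<bullet>\<^sub>v x) \<bullet> v"
    unfolding exEm app_mult x[symmetric] ..
  also have "\<dots> = x \<bullet> (exp (2 *\<^sub>R A) \<bullet>\<^sub>v v)"
    using adjD[OF adj_exp[OF skew, of "-2"]] by simp
  also have "\<dots> = x \<bullet> ((Iop A + 2 *\<^sub>R A) \<bullet>\<^sub>v y)"
    unfolding v_def by (simp flip: app_mult add: Iop_exp[OF A])
  finally show "(Iop A \<bullet>\<^sub>v x) \<bullet> y = x \<bullet> ((Iop A + 2 *\<^sub>R A) \<bullet>\<^sub>v y)"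
    unfolding u_def .
qed

text \<open>\<open>s Eop (s A)\<close> is the integral of \<open>exp (2 r A)\<close> over
  \<open>[0, s]\<close>. This yields the position on a geodesic and, after inversion, the derivative
  of \<open>Iscaled\<close>.\<close>

lemma Eop_has_derivative:
  fixes A :: "'b::{real_normed_algebra_1,banach}"
  shows "((\<lambda>s. s *\<^sub>R Eop (s *\<^sub>R A)) has_derivative (\<lambda>h. h *\<^sub>R exp ((2 * s) *\<^sub>R A))) (at s)"
proof -
  define R where "R = \<bar>s\<bar> + 1"
  have R: "R > 0" "s \<in> ball 0 R" by (auto simp: R_def)
  define f f' where "f n s = (ecoeff n * s ^ Suc n) *\<^sub>R A ^ n"
    and "f' n s h = (h * (2 ^ n / fact n * s ^ n)) *\<^sub>R A ^ n" for n :: nat and s h :: real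
  \<comment> \<open>The first summand majorises the terms, the second their derivatives.\<close>
  define B where "B n = R * (ecoeff n * (R * norm A) ^ n) + 2 ^ n / fact n * (R * norm A) ^ n" for n
  have e0: "ecoeff n \<ge> 0" for n by (simp add: ecoeff_def)
  have sB: "summable B"
  proof -
    have "summable (\<lambda>n. \<bar>ecoeff n\<bar> * (R * norm A) ^ n)"
      by (rule abs_convD[OF abs_conv_ecoeff, of _ "R * norm A + 1"]) (use R in auto)
    moreover have "summable (\<lambda>n. \<bar>2 ^ n / fact n\<bar> * (R * norm A) ^ n)"
      by (rule abs_convD[OF abs_conv_exp, of _ "R * norm A + 1"]) (use R in auto)
    ultimately show ?thesis
      unfolding B_def using e0 by (intro summable_add summable_mult) auto
  qed
  have An: "norm (A ^ n) \<le> norm A ^ n" for n by (rule norm_power_ineq)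
  have "((\<lambda>s. \<Sum>n. f n s) has_derivative (\<lambda>h. \<Sum>n. f' n s h)) (at s)"
  proof (rule has_derivative_suminf[OF _ _ sB _ _ _ R(2)])
    fix n and u :: real assume u: "u \<in> ball 0 R"
    have "((\<lambda>s. (ecoeff n * s ^ Suc n)) has_field_derivative ecoeff n * (real (Suc n) * u ^ n)) (at u)"
      using DERIV_cmult[OF DERIV_pow[of "Suc n" u]] by simp
    moreover have "ecoeff n * (real (Suc n) * u ^ n) = 2 ^ n / fact n * u ^ n"
      by (simp add: ecoeff_def fact_Suc del: of_nat_Suc)
    ultimately have "((\<lambda>s. (ecoeff n * s ^ Suc n)) has_derivative (\<lambda>h. h * (2 ^ n / fact n * u ^ n))) (at u)"
      unfolding has_field_derivative_def by (simp only: mult_commute_abs)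
    then show "(f n has_derivative f' n u) (at u)"
      unfolding f_def f'_def by (rule has_derivative_scaleR_left)
    have un: "\<bar>u\<bar> ^ n \<le> R ^ n" and uR: "\<bar>u\<bar> \<le> R" using u by (auto intro: power_mono)
    have 1: "\<bar>u\<bar> ^ n * norm (A ^ n) \<le> (R * norm A) ^ n"
      unfolding power_mult_distrib using un An R by (intro mult_mono) auto
    have "norm (f n u) = \<bar>u\<bar> * (ecoeff n * (\<bar>u\<bar> ^ n * norm (A ^ n)))"
      using e0 by (simp add: f_def abs_mult power_abs)
    also have "\<dots> \<le> R * (ecoeff n * (R * norm A) ^ n)"
      using uR 1 e0 R by (intro mult_mono) auto
    also have "\<dots> \<le> B n" using R by (simp add: B_def)
    finally show "norm (f n u) \<le> B n" .
    show "norm (f' n u b) \<le> B n" if "b \<in> Basis" for b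
    proof -
      have "norm (f' n u b) = 2 ^ n / fact n * (\<bar>u\<bar> ^ n * norm (A ^ n))"
        using that by (simp add: f'_def abs_mult power_abs)
      also have "\<dots> \<le> 2 ^ n / fact n * (R * norm A) ^ n"
        using 1 by (intro mult_left_mono) auto
      also have "\<dots> \<le> B n" using R e0 by (simp add: B_def)
      finally show ?thesis .
    qed
  qed auto
  moreover have "(\<Sum>n. f n s) = s *\<^sub>R Eop (s *\<^sub>R A)" for s
  proof -
    have "summable (\<lambda>n. ecoeff n *\<^sub>R (s *\<^sub>R A) ^ n)"
      by (rule summable_norm_cancel, rule abs_conv_summable_norm[OF abs_conv_ecoeff, of _ "norm (s *\<^sub>R A) + 1"]) simp
    from suminf_scaleR_right[OF this, of s] show ?thesis
      unfolding Eop_def pser_def f_def by (simp add: power_mult_distrib scaleR_power mult_ac)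
  qed
  moreover have "(\<Sum>n. f' n s h) = h *\<^sub>R exp ((2 * s) *\<^sub>R A)" for h
  proof -
    have "summable (\<lambda>n. (2 ^ n / fact n) *\<^sub>R (s *\<^sub>R A) ^ n)"
      by (rule summable_norm_cancel, rule abs_conv_summable_norm[OF abs_conv_exp, of _ "norm (s *\<^sub>R A) + 1"]) simp
    from suminf_scaleR_right[OF this, of h] show ?thesis
      using pser_exp[of 2 "s *\<^sub>R A"] unfolding pser_def f'_def by (simp add: power_mult_distrib scaleR_power mult_ac)
  qed
  ultimately show ?thesis by simp
qed

text \<open>This is \<open>A coth (s A) - A\<close>, the inverse of \<open>s Eop (s A)\<close>; it
  blows up like \<open>1 / s\<close> at the origin.\<close>

definition Iscaled :: "'b \<Rightarrow> real \<Rightarrow> 'b::{real_normed_algebra_1,banach}" where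
  "Iscaled A s = (1 / s) *\<^sub>R Iop (s *\<^sub>R A)"

lemma norm_scaleR_less_pi:
  assumes "0 < s" "s \<le> 1" "norm A < pi" shows "norm (s *\<^sub>R A) < pi"
proof -
  have "s * norm A \<le> 1 * norm A" using assms by (intro mult_right_mono) auto
  then show ?thesis using assms by simp
qed

text \<open>The Riccati equation in disguise: by \<open>Iscaled_exp\<close> the product
  \<open>I exp (2 s A) I\<close> is \<open>(I + 2 A) I\<close>, and with \<open>K = I + A\<close>
  this reads \<open>(K + A) (K - A) = K^2 - A^2\<close>.\<close>

lemma Iscaled_has_derivative:
  fixes A :: "'b::{real_normed_algebra_1,banach}"
  assumes s: "0 < s" "s \<le> 1" and A: "norm A < pi"
  shows "(Iscaled A has_derivative
    (\<lambda>h. - (h *\<^sub>R (Iscaled A s * exp ((2 * s) *\<^sub>R A) * Iscaled A s)))) (at s)"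
proof -
  define S where "S = {s. 0 < s \<and> s * norm A < pi}"
  have "open S"
    unfolding S_def by (intro open_Collect_conj open_Collect_less continuous_intros)
  moreover have "s \<in> S" using norm_scaleR_less_pi[OF s A] s by (simp add: S_def)
  moreover have "(u *\<^sub>R Eop (u *\<^sub>R A)) * Iscaled A u = 1 \<and> Iscaled A u * (u *\<^sub>R Eop (u *\<^sub>R A)) = 1"
    if "u \<in> S" for u
    using that Eop_Iop[of "u *\<^sub>R A"] by (simp add: S_def Iscaled_def)
  ultimately have "(Iscaled A has_derivative
    (\<lambda>h. - (Iscaled A s * (h *\<^sub>R exp ((2 * s) *\<^sub>R A)) * Iscaled A s))) (at s)"
    by (rule has_derivative_left_right_inverse[OF _ _ _ Eop_has_derivative])
  then show ?thesis by simp
qed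

lemma Iscaled_exp:
  assumes s: "0 < s" "s \<le> 1" and A: "norm A < pi"
  shows "Iscaled A s * exp ((2 * s) *\<^sub>R A) = Iscaled A s + 2 *\<^sub>R A"
    "exp ((2 * s) *\<^sub>R A) * Iscaled A s = Iscaled A s + 2 *\<^sub>R A"
  using Iop_exp[OF norm_scaleR_less_pi[OF s A]] s by (simp_all add: Iscaled_def scaleR_add_right)

lemma Iscaled_adj:
  assumes skew: "adj A (- A)" and s: "0 < s" "s \<le> 1" and A: "norm A < pi"
  shows "adj (Iscaled A s) (Iscaled A s + 2 *\<^sub>R A)"
proof -
  have "adj (Iop (s *\<^sub>R A)) (Iop (s *\<^sub>R A) + 2 *\<^sub>R (s *\<^sub>R A))"
    by (rule Iop_adj[OF _ norm_scaleR_less_pi[OF s A]]) (use adj_scaleR[OF skew, of s] in simp)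
  from adj_scaleR[OF this, of "1 / s"] show ?thesis
    using s by (simp add: Iscaled_def scaleR_add_right)
qed

text \<open>Along a curve \<open>x\<close> with derivative \<open>h\<close>, the function
  \<open>r \<mapsto> \<langle>I(\<sigma>(r)) x(r), x(r)\<rangle> + \<integral>\<^sub>0\<^sup>r 2\<langle>J x, h\<rangle>\<close>, where \<open>I(s)\<close> is the scaled operator
  \<open>(J coth (s J)) - J\<close>, grows at most at the rate \<open>|h|\<^sup>2 / \<sigma>'\<close>: this is the Riccati equation
  for \<open>I(s)\<close>. The clock \<open>\<sigma>\<close> is a regularised arc length.\<close>
lemma phi_le_length_sq_continuous:
  fixes h :: "real \<Rightarrow> 'a::euclidean_space"
  assumes skew: "adj J (- J)" and J: "norm J < pi" and h: "continuous_on {0..1} h"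
  defines "x \<equiv> \<lambda>s. integral {0..s} h"
  shows "(Iop J \<bullet>\<^sub>v x 1) \<bullet> x 1 + integral {0..1} (\<lambda>r. 2 * ((J \<bullet>\<^sub>v x r) \<bullet> h r))
    \<le> (integral {0..1} (\<lambda>r. norm (h r)))\<^sup>2"
proof -
  define L where "L = integral {0..1} (\<lambda>r. norm (h r))"
  have nh: "continuous_on {0..1} (\<lambda>r. norm (h r))" using h by (rule continuous_on_norm)
  have L0: "0 \<le> L" unfolding L_def by (rule integral_nonneg[OF integrable_continuous_real[OF nh]]) simp
  have dx: "(x has_vector_derivative h r) (at r within {0..1})" if "r \<in> {0..1}" for r
    unfolding x_def by (rule integral_has_vector_derivative[OF h that])
  have cx: "continuous_on {0..1} x"
    by (rule continuous_on_vector_derivative[OF dx])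
  have cT: "continuous_on {0..1} (\<lambda>r. 2 * ((J \<bullet>\<^sub>v x r) \<bullet> h r))"
    by (intro continuous_intros cx h app.continuous_on)
  define T where "T s = integral {0..s} (\<lambda>r. 2 * ((J \<bullet>\<^sub>v x r) \<bullet> h r))" for s
  have dT: "(T has_vector_derivative 2 * ((J \<bullet>\<^sub>v x r) \<bullet> h r)) (at r within {0..1})" if "r \<in> {0..1}" for r
    unfolding T_def by (rule integral_has_vector_derivative[OF cT that])
  define N where "N s = integral {0..s} (\<lambda>r. norm (h r))" for s
  have dN: "(N has_vector_derivative norm (h r)) (at r within {0..1})" if "r \<in> {0..1}" for r
    unfolding N_def by (rule integral_has_vector_derivative[OF nh that])
  have "(Iop J \<bullet>\<^sub>v x 1) \<bullet> x 1 + T 1 \<le> (L + 2 * e) * L" if e: "e > 0" for e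
  proof -
    \<comment> \<open>The starting value \<open>e / m\<close> keeps \<open>\<sigma>\<close> away
      from the pole of \<open>Iscaled J\<close> at 0. The normalisation by \<open>m\<close> makes
      the clock end at 1, where \<open>Iscaled J\<close> is \<open>Iop J\<close>.\<close>
    define m where "m = L + 2 * e"
    have m: "m > 0" using L0 e by (simp add: m_def)
    define \<sigma> where "\<sigma> s = (e + N s + e * s) / m" for s
    define \<sigma>' where "\<sigma>' r = (norm (h r) + e) / m" for r
    have d\<sigma>: "(\<sigma> has_vector_derivative \<sigma>' r) (at r within {0..1})" if "r \<in> {0..1}" for r
      unfolding \<sigma>_def \<sigma>'_def has_real_derivative_iff_has_vector_derivative[symmetric]
      using dN[OF that] m
      by (auto intro!: derivative_eq_intros simp: has_real_derivative_iff_has_vector_derivative[symmetric])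
    have N1: "N 1 = L" by (simp add: N_def L_def)
    have N_mono: "0 \<le> N r" "N r \<le> L" if "r \<in> {0..1}" for r
    proof -
      have i: "(\<lambda>r. norm (h r)) integrable_on {0..1}" by (rule integrable_continuous_real[OF nh])
      have i': "(\<lambda>r. norm (h r)) integrable_on {0..r}"
        by (rule integrable_subinterval_real[OF i]) (use that in auto)
      show "0 \<le> N r" unfolding N_def by (rule integral_nonneg[OF i']) simp
      show "N r \<le> L" unfolding N_def L_def by (rule integral_subset_le[OF _ i' i]) (use that in auto)
    qed
    have \<sigma>: "0 < \<sigma> r" "\<sigma> r \<le> 1" if "r \<in> {0..1}" for r
    proof -
      show "0 < \<sigma> r" using N_mono(1)[OF that] that e m by (auto simp: \<sigma>_def intro!: divide_pos_pos add_pos_nonneg)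
      have "e * r \<le> e * 1" using that e by (intro mult_left_mono) auto
      then show "\<sigma> r \<le> 1" using N_mono(2)[OF that] m by (simp add: \<sigma>_def m_def)
    qed
    have \<sigma>1: "\<sigma> 1 = 1" using m by (simp add: \<sigma>_def N1 m_def)
    \<comment> \<open>\<open>Y\<close> is the adjoint of \<open>Iscaled J\<close> at time
      \<open>\<sigma> r\<close>, applied to \<open>x r\<close>. The deficit \<open>P\<close>
      vanishes at the start, so it is enough that it does not decrease.\<close>
    define Y where "Y r = (Iscaled J (\<sigma> r) + 2 *\<^sub>R J) \<bullet>\<^sub>v x r" for r
    define P where "P r = m * N r - ((Iscaled J (\<sigma> r) \<bullet>\<^sub>v x r) \<bullet> x r + T r)" for r
    define P' where "P' r = m * norm (h r) - (2 * (h r \<bullet> Y r) - \<sigma>' r * (Y r \<bullet> Y r))" for r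
    have dP: "(P has_derivative (\<lambda>k. k * P' r)) (at r within {0..1})" if r: "0 \<le> r" "r \<le> 1" for r
    proof -
      have r': "r \<in> {0..1}" using r by simp
      note sr = \<sigma>[OF r']
      let ?I = "Iscaled J (\<sigma> r)" and ?X = "exp ((2 * \<sigma> r) *\<^sub>R J)"
      note f = Iscaled_exp[OF sr J]
      have dI: "((\<lambda>r. Iscaled J (\<sigma> r)) has_derivative (\<lambda>k. - ((k * \<sigma>' r) *\<^sub>R (?I * ?X * ?I)))) (at r within {0..1})"
        using has_derivative_compose[OF d\<sigma>[OF r', unfolded has_vector_derivative_def] Iscaled_has_derivative[OF sr J]]
        by simp
      have dx': "(x has_derivative (\<lambda>k. k *\<^sub>R h r)) (at r within {0..1})"
        using dx[OF r'] by (simp add: has_vector_derivative_def)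
      have dIx: "((\<lambda>r. Iscaled J (\<sigma> r) \<bullet>\<^sub>v x r) has_derivative
          (\<lambda>k. ?I \<bullet>\<^sub>v (k *\<^sub>R h r) + (- ((k * \<sigma>' r) *\<^sub>R (?I * ?X * ?I))) \<bullet>\<^sub>v x r)) (at r within {0..1})"
        by (rule app.FDERIV[OF dI dx'])
      have dQ: "((\<lambda>r. (Iscaled J (\<sigma> r) \<bullet>\<^sub>v x r) \<bullet> x r) has_derivative
          (\<lambda>k. (?I \<bullet>\<^sub>v x r) \<bullet> (k *\<^sub>R h r) + (?I \<bullet>\<^sub>v (k *\<^sub>R h r) + (- ((k * \<sigma>' r) *\<^sub>R (?I * ?X * ?I))) \<bullet>\<^sub>v x r) \<bullet> x r))
          (at r within {0..1})"
        by (rule has_derivative_inner[OF dIx dx'])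
      have dT': "(T has_derivative (\<lambda>k. k * (2 * ((J \<bullet>\<^sub>v x r) \<bullet> h r)))) (at r within {0..1})"
        using dT[OF r'] by (simp add: has_vector_derivative_def)
      have dN': "((\<lambda>r. m * N r) has_derivative (\<lambda>k. m * (k * norm (h r)))) (at r within {0..1})"
        using has_derivative_mult_right[OF dN[OF r', unfolded has_vector_derivative_def], of m] by simp
      have "(P has_derivative (\<lambda>k. m * (k * norm (h r)) - (((?I \<bullet>\<^sub>v x r) \<bullet> (k *\<^sub>R h r)
            + (?I \<bullet>\<^sub>v (k *\<^sub>R h r) + (- ((k * \<sigma>' r) *\<^sub>R (?I * ?X * ?I))) \<bullet>\<^sub>v x r) \<bullet> x r)
            + k * (2 * ((J \<bullet>\<^sub>v x r) \<bullet> h r))))) (at r within {0..1})"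
        unfolding P_def by (rule has_derivative_diff[OF dN' has_derivative_add[OF dQ dT']])
      moreover have "m * (k * norm (h r)) - (((?I \<bullet>\<^sub>v x r) \<bullet> (k *\<^sub>R h r)
            + (?I \<bullet>\<^sub>v (k *\<^sub>R h r) + (- ((k * \<sigma>' r) *\<^sub>R (?I * ?X * ?I))) \<bullet>\<^sub>v x r) \<bullet> x r)
            + k * (2 * ((J \<bullet>\<^sub>v x r) \<bullet> h r))) = k * P' r" for k
      proof -
        \<comment> \<open>Passing to the adjoint makes every term a product with \<open>Y\<close>:
          both derivatives of \<open>x\<close> and the area term add up to
          \<open>2 h \<bullet> Y\<close>, the Riccati term to
          \<open>- \<sigma>' |Y|^2\<close>.\<close>
        have 1: "(?I \<bullet>\<^sub>v h r) \<bullet> x r = h r \<bullet> Y r"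
          unfolding Y_def by (rule adjD[OF Iscaled_adj[OF skew sr J]])
        have "((?I * ?X * ?I) \<bullet>\<^sub>v x r) = ?I \<bullet>\<^sub>v Y r"
          unfolding Y_def by (simp only: mult.assoc f(2) app_mult)
        then have 2: "((?I * ?X * ?I) \<bullet>\<^sub>v x r) \<bullet> x r = Y r \<bullet> Y r"
          using adjD[OF Iscaled_adj[OF skew sr J], of "Y r" "x r"] by (simp add: Y_def)
        have 3: "(?I \<bullet>\<^sub>v x r) \<bullet> h r + 2 * ((J \<bullet>\<^sub>v x r) \<bullet> h r) = h r \<bullet> Y r"
          unfolding Y_def by (simp add: app.add_left app.scaleR_left inner_add_right inner_commute)
        have "m * (k * norm (h r)) - (((?I \<bullet>\<^sub>v x r) \<bullet> (k *\<^sub>R h r)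
            + (?I \<bullet>\<^sub>v (k *\<^sub>R h r) + (- ((k * \<sigma>' r) *\<^sub>R (?I * ?X * ?I))) \<bullet>\<^sub>v x r) \<bullet> x r)
            + k * (2 * ((J \<bullet>\<^sub>v x r) \<bullet> h r)))
          = k * (m * norm (h r) - (((?I \<bullet>\<^sub>v x r) \<bullet> h r + 2 * ((J \<bullet>\<^sub>v x r) \<bullet> h r)) + (?I \<bullet>\<^sub>v h r) \<bullet> x r
            - \<sigma>' r * (((?I * ?X * ?I) \<bullet>\<^sub>v x r) \<bullet> x r)))"
          by (simp add: app.scaleR_left app.scaleR_right app.minus_left inner_add_left inner_diff_left algebra_simps del: app_mult)
        then show ?thesis unfolding 1 2 3 P'_def by (simp add: algebra_simps)
      qed
      ultimately show ?thesis by simp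
    qed
    have P'0: "0 \<le> P' r" for r
    proof -
      define a b where "a = norm (h r)" and "b = norm (Y r)"
      have a: "a \<ge> 0" by (simp add: a_def)
      have "h r \<bullet> Y r \<le> a * b" unfolding a_def b_def by (rule norm_cauchy_schwarz)
      moreover have "Y r \<bullet> Y r = b\<^sup>2" by (simp add: b_def power2_norm_eq_inner)
      moreover have "a / m * b\<^sup>2 \<le> \<sigma>' r * b\<^sup>2"
        unfolding \<sigma>'_def a_def using e m by (intro mult_right_mono divide_right_mono) auto
      \<comment> \<open>Completing the square: since \<open>\<sigma>'\<close> is at least
        \<open>a / m\<close>, the derivative \<open>P'\<close> is at least
        \<open>(a / m) (b - m)^2\<close>.\<close>
      moreover have "0 \<le> a / m * (b - m)\<^sup>2" using a m by simp
      then have "2 * (a * b) \<le> a / m * b\<^sup>2 + m * a"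
        using m by (simp add: power2_eq_square field_simps)
      ultimately show ?thesis unfolding P'_def a_def[symmetric] by simp
    qed
    obtain r where "P 1 - P 0 = (1 - 0) * P' r"
      using mvt_simple[of 0 1 P "\<lambda>r k. k * P' r"] dP by auto
    then have "P 0 \<le> P 1" using P'0[of r] by simp
    moreover have "P 0 = 0" by (simp add: P_def N_def T_def x_def app.zero_right)
    ultimately show ?thesis
      unfolding P_def \<sigma>1 N1 Iscaled_def m_def by simp
  qed
  note main = this
  have "((\<lambda>e. (L + 2 * e) * L) \<longlongrightarrow> (L + 2 * 0) * L) (at_right 0)"
    by (intro tendsto_intros)
  then have "(Iop J \<bullet>\<^sub>v x 1) \<bullet> x 1 + T 1 \<le> (L + 2 * 0) * L"
    by (rule tendsto_lowerbound) (use main in \<open>auto simp: eventually_at_filter\<close>)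
  then show ?thesis unfolding T_def L_def power2_eq_square by simp
qed

subsection \<open>Curves with integrable velocity\<close>

definition trunc :: "real \<Rightarrow> 'a::real_normed_vector \<Rightarrow> 'a" where
  "trunc M v = (M / max M (norm v)) *\<^sub>R v"

lemma trunc_id: "0 < M \<Longrightarrow> norm v \<le> M \<Longrightarrow> trunc M v = v"
  by (simp add: trunc_def max_absorb1)

lemma norm_trunc_le: assumes "0 < M" shows "norm (trunc M v) \<le> M" "norm (trunc M v) \<le> norm v"
proof -
  have p: "0 < max M (norm v)" using assms by simp
  have "norm (trunc M v) = M * (norm v / max M (norm v))" using assms by (simp add: trunc_def)
  also have "\<dots> \<le> M * 1" using assms p by (intro mult_left_mono) (auto simp: divide_le_eq)
  finally show "norm (trunc M v) \<le> M" by simp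
  have "norm (trunc M v) = (M / max M (norm v)) * norm v" using assms by (simp add: trunc_def)
  also have "\<dots> \<le> 1 * norm v" using assms p by (intro mult_right_mono) (auto simp: divide_le_eq)
  finally show "norm (trunc M v) \<le> norm v" by simp
qed

lemma continuous_on_trunc: "0 < M \<Longrightarrow> continuous_on S (trunc M)"
  unfolding trunc_def by (intro continuous_intros) auto

text \<open>Two dominated convergences. Truncating \<open>h\<close> at a high level \<open>M\<close>
  costs little. A measurable function is an almost everywhere limit of continuous ones, which need
  not be dominated; truncating these at the same level keeps them continuous and bounds the
  differences by \<open>2 * M\<close>.\<close>

lemma continuous_dense_L1:
  fixes h :: "real \<Rightarrow> 'a::euclidean_space"
  assumes h: "h absolutely_integrable_on {a..b}" and e: "e > 0"
  shows "\<exists>k. continuous_on {a..b} k \<and> integral {a..b} (\<lambda>r. norm (h r - k r)) < e"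
proof -
  let ?S = "{a..b}"
  have S: "?S \<in> sets lebesgue" by simp
  have mh: "h \<in> borel_measurable (lebesgue_on ?S)"
    by (rule absolutely_integrable_imp_borel_measurable[OF h S])
  have nh: "(\<lambda>r. norm (h r)) integrable_on ?S"
    using h by (simp add: absolutely_integrable_on_def)
  have absP: "(\<lambda>r. trunc M (h r)) absolutely_integrable_on ?S" if "M > 0" for M
  proof (rule measurable_bounded_by_integrable_imp_absolutely_integrable[OF _ S nh])
    have "trunc M \<in> borel_measurable (borel :: 'a measure)"
      by (rule borel_measurable_continuous_onI[OF continuous_on_trunc[OF that]])
    then show "(\<lambda>r. trunc M (h r)) \<in> borel_measurable (lebesgue_on ?S)"
      using measurable_compose[OF mh] by blast
  qed (rule norm_trunc_le[OF that])
  have "(\<lambda>n. integral ?S (\<lambda>r. norm (h r - trunc (real (Suc n)) (h r)))) \<longlonglongrightarrow> integral ?S (\<lambda>r. 0::real)"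
  proof (rule dominated_convergence(2)[where h = "\<lambda>r. 2 * norm (h r)"])
    show "(\<lambda>r. norm (h r - trunc (real (Suc n)) (h r))) integrable_on ?S" for n
      using set_integral_diff(1)[OF h absP, of "real (Suc n)"] by (simp add: absolutely_integrable_on_def)
    show "(\<lambda>r. 2 * norm (h r)) integrable_on ?S"
      using integrable_on_mult_right[OF nh, of 2] by simp
    show "norm (norm (h r - trunc (real (Suc n)) (h r))) \<le> 2 * norm (h r)" for n r
      using norm_triangle_ineq4[of "h r" "trunc (real (Suc n)) (h r)"] norm_trunc_le(2)[of "real (Suc n)" "h r"] by simp
    show "(\<lambda>n. norm (h r - trunc (real (Suc n)) (h r))) \<longlonglongrightarrow> 0" for r
    proof (rule tendsto_eventually)
      obtain N :: nat where N: "norm (h r) \<le> real N" using real_arch_simple by blast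
      show "\<forall>\<^sub>F n in sequentially. norm (h r - trunc (real (Suc n)) (h r)) = 0"
        using eventually_ge_at_top[of N] by eventually_elim (use N in \<open>auto simp: trunc_id\<close>)
    qed
  qed
  from tendstoD[OF this, of "e / 2"] e
  obtain n where n: "\<bar>integral ?S (\<lambda>r. norm (h r - trunc (real (Suc n)) (h r)))\<bar> < e / 2"
    by (auto simp: dist_real_def dest: eventually_happens)
  define M where "M = real (Suc n)"
  have M: "M > 0" by (simp add: M_def)
  have "h measurable_on ?S"
    using mh S measurable_on_iff_borel_measurable by blast
  then obtain N g where N: "negligible N" and g: "\<And>n. continuous_on UNIV (g n)"
    and lim: "\<And>x. x \<notin> N \<Longrightarrow> (\<lambda>n. g n x) \<longlonglongrightarrow> (if x \<in> ?S then h x else 0)"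
    unfolding measurable_on_def by blast
  have cg: "continuous_on ?S (\<lambda>r. trunc M (g k r))" for k
    by (rule continuous_on_compose2[OF continuous_on_trunc[OF M] continuous_on_subset[OF g]]) auto
  define F where "F k r = norm (trunc M (h r) - trunc M (g k r))" for k r
  have iF: "F k integrable_on ?S" for k
    unfolding F_def
    using set_integral_diff(1)[OF absP[OF M] absolutely_integrable_continuous_real[OF cg]]
    by (simp add: absolutely_integrable_on_def)
  have "(\<lambda>k. integral ?S (\<lambda>r. if r \<in> N then 0 else F k r)) \<longlonglongrightarrow> integral ?S (\<lambda>r. 0::real)"
  proof (rule dominated_convergence(2)[where h = "\<lambda>r. 2 * M"])
    show "(\<lambda>r. if r \<in> N then 0 else F k r) integrable_on ?S" for k
      by (rule integrable_spike[OF iF N]) auto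
    show "norm (if r \<in> N then 0 else F k r) \<le> 2 * M" for k r
      using norm_triangle_ineq4[of "trunc M (h r)" "trunc M (g k r)"] norm_trunc_le(1)[OF M, of "h r"]
        norm_trunc_le(1)[OF M, of "g k r"] M by (simp add: F_def)
    show "(\<lambda>k. if r \<in> N then 0 else F k r) \<longlonglongrightarrow> 0" if r: "r \<in> ?S" for r
    proof (cases "r \<in> N")
      case False
      have "(\<lambda>k. trunc M (g k r)) \<longlonglongrightarrow> trunc M (h r)"
        using lim[OF False] r continuous_on_trunc[OF M, of UNIV]
        by (auto simp: continuous_on_eq_continuous_at intro: isCont_tendsto_compose)
      then have "(\<lambda>k. F k r) \<longlonglongrightarrow> norm (trunc M (h r) - trunc M (h r))"
        unfolding F_def by (intro tendsto_intros)
      then show ?thesis using False by simp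
    qed simp
  qed auto
  moreover have "integral ?S (\<lambda>r. if r \<in> N then 0 else F k r) = integral ?S (F k)" for k
    by (rule integral_spike[OF N]) auto
  ultimately have "(\<lambda>k. integral ?S (F k)) \<longlonglongrightarrow> 0" by simp
  from tendstoD[OF this, of "e / 2"] e obtain k where k: "\<bar>integral ?S (F k)\<bar> < e / 2"
    by (auto simp: dist_real_def dest: eventually_happens)
  let ?k = "\<lambda>r. trunc M (g k r)"
  have i1: "(\<lambda>r. norm (h r - trunc M (h r))) integrable_on ?S"
    using set_integral_diff(1)[OF h absP[OF M]] by (simp add: absolutely_integrable_on_def)
  have "integral ?S (\<lambda>r. norm (h r - ?k r)) \<le> integral ?S (\<lambda>r. norm (h r - trunc M (h r)) + F k r)"
  proof (rule integral_le[OF _ integrable_add[OF i1 iF]])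
    show "(\<lambda>r. norm (h r - ?k r)) integrable_on ?S"
      using set_integral_diff(1)[OF h absolutely_integrable_continuous_real[OF cg]]
      by (simp add: absolutely_integrable_on_def)
    show "norm (h r - ?k r) \<le> norm (h r - trunc M (h r)) + F k r" for r
      unfolding F_def using norm_triangle_ineq[of "h r - trunc M (h r)" "trunc M (h r) - ?k r"] by simp
  qed
  also have "\<dots> = integral ?S (\<lambda>r. norm (h r - trunc M (h r))) + integral ?S (F k)"
    by (rule integral_add[OF i1 iF])
  also have "\<dots> < e" using n k unfolding M_def by linarith
  finally show ?thesis using cg by blast
qed

lemma absolutely_integrable_inner_continuous:
  fixes x h :: "real \<Rightarrow> 'a::euclidean_space"
  assumes x: "continuous_on {a..b} x" and h: "h absolutely_integrable_on {a..b}"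
  shows "(\<lambda>r. x r \<bullet> h r) absolutely_integrable_on {a..b}"
proof (rule absolutely_integrable_bounded_measurable_product[where h = "(\<bullet>)" and f = x, OF _ _ _ _ h])
  show "bilinear ((\<bullet>) :: 'a \<Rightarrow> 'a \<Rightarrow> real)" by (rule bilinear_conv_bounded_bilinear[THEN iffD2, OF bounded_bilinear_inner])
  show "x \<in> borel_measurable (lebesgue_on {a..b})"
    by (rule continuous_imp_measurable_on_sets_lebesgue[OF x]) simp
  show "bounded (x ` {a..b})"
    by (intro compact_imp_bounded compact_continuous_image x compact_Icc)
qed simp

text \<open>For a merely integrable velocity the pointwise differentiation of the continuous case
  breaks down. Both sides are continuous in \<open>h\<close> for the L1 norm, so the inequality
  passes to the limit along continuous velocities.\<close>

lemma phi_le_length_sq: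
  fixes h :: "real \<Rightarrow> 'a::euclidean_space"
  assumes skew: "adj J (- J)" and J: "norm J < pi" and h: "h absolutely_integrable_on {0..1}"
  defines "x \<equiv> \<lambda>s. integral {0..s} h"
  shows "(Iop J \<bullet>\<^sub>v x 1) \<bullet> x 1 + integral {0..1} (\<lambda>r. 2 * ((J \<bullet>\<^sub>v x r) \<bullet> h r))
    \<le> (integral {0..1} (\<lambda>r. norm (h r)))\<^sup>2"
proof -
  let ?S = "{0..1::real}"
  have "\<forall>n. \<exists>k. continuous_on ?S k \<and> integral ?S (\<lambda>r. norm (h r - k r)) < 1 / real (Suc n)"
    using continuous_dense_L1[OF h] by simp
  then obtain k where ck: "\<And>n. continuous_on ?S (k n)"
    and kn: "\<And>n. integral ?S (\<lambda>r. norm (h r - k n r)) < 1 / real (Suc n)"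
    by metis
  define d where "d n r = norm (h r - k n r)" for n r
  define \<epsilon> where "\<epsilon> n = integral ?S (d n)" for n
  have ak: "k n absolutely_integrable_on ?S" for n
    by (rule absolutely_integrable_continuous_real[OF ck])
  have dk: "(\<lambda>r. h r - k n r) absolutely_integrable_on ?S" for n
    by (rule set_integral_diff(1)[OF h ak])
  have id: "d n integrable_on ?S" for n
    using dk unfolding d_def absolutely_integrable_on_def by blast
  have \<epsilon>0: "\<epsilon> n \<ge> 0" for n unfolding \<epsilon>_def by (rule integral_nonneg[OF id]) (simp add: d_def)
  have \<epsilon>1: "\<epsilon> n \<le> 1 / real (Suc n)" for n
    using kn[of n] unfolding \<epsilon>_def d_def by (rule less_imp_le)
  have \<epsilon>: "\<epsilon> \<longlonglongrightarrow> 0"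
    by (rule tendsto_sandwich[of "\<lambda>_. 0" _ _ "\<lambda>n. 1 / real (Suc n)"])
       (use \<epsilon>0 \<epsilon>1 LIMSEQ_inverse_real_of_nat in \<open>auto simp: inverse_eq_divide intro!: always_eventually\<close>)
  define L where "L = integral ?S (\<lambda>r. norm (h r))"
  define Ln where "Ln n = integral ?S (\<lambda>r. norm (k n r))" for n
  define y where "y n s = integral {0..s} (k n)" for n s
  have hi: "h integrable_on ?S" and nhi: "(\<lambda>r. norm (h r)) integrable_on ?S"
    using h by (auto simp: absolutely_integrable_on_def)
  have ki: "k n integrable_on ?S" and nki: "(\<lambda>r. norm (k n r)) integrable_on ?S" for n
    using ak by (auto simp: absolutely_integrable_on_def)
  have sub: "f integrable_on {0..s}" if "f integrable_on ?S" "s \<in> ?S" for s and f :: "real \<Rightarrow> 'c::banach"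
    by (rule integrable_subinterval_real[OF that(1)]) (use that in auto)
  have yx: "norm (x s - y n s) \<le> \<epsilon> n" if s: "s \<in> ?S" for n s
  proof -
    have "x s - y n s = integral {0..s} (\<lambda>r. h r - k n r)"
      unfolding x_def y_def by (rule integral_diff[symmetric, OF sub[OF hi s] sub[OF ki s]])
    also have "norm \<dots> \<le> integral {0..s} (d n)"
      by (rule integral_norm_bound_integral[OF integrable_diff[OF sub[OF hi s] sub[OF ki s]] sub[OF id s]])
         (simp add: d_def)
    also have "\<dots> \<le> \<epsilon> n"
      unfolding \<epsilon>_def by (rule integral_subset_le[OF _ sub[OF id s] id]) (use s in \<open>auto simp: d_def\<close>)
    finally show ?thesis .
  qed
  have xL: "norm (x s) \<le> L" if s: "s \<in> ?S" for s
  proof -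
    have "norm (x s) \<le> integral {0..s} (\<lambda>r. norm (h r))"
      unfolding x_def by (rule integral_norm_bound_integral[OF sub[OF hi s] sub[OF nhi s]]) simp
    also have "\<dots> \<le> L"
      unfolding L_def by (rule integral_subset_le[OF _ sub[OF nhi s] nhi]) (use s in auto)
    finally show ?thesis .
  qed
  have LL: "Ln n \<le> L + \<epsilon> n" for n
  proof -
    have "Ln n \<le> integral ?S (\<lambda>r. norm (h r) + d n r)"
      unfolding Ln_def
    proof (rule integral_le[OF nki integrable_add[OF nhi id]])
      show "norm (k n r) \<le> norm (h r) + d n r" for r
        unfolding d_def using norm_triangle_ineq4[of "h r" "h r - k n r"] by simp
    qed
    also have "\<dots> = L + \<epsilon> n" unfolding L_def \<epsilon>_def by (rule integral_add[OF nhi id])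
    finally show ?thesis .
  qed
  have cx: "continuous_on ?S x" unfolding x_def by (rule indefinite_integral_continuous_1[OF hi])
  have cy: "continuous_on ?S (y n)" for n unfolding y_def by (rule indefinite_integral_continuous_1[OF ki])
  have iT: "(\<lambda>r. 2 * ((J \<bullet>\<^sub>v x r) \<bullet> h r)) integrable_on ?S"
  proof -
    have "continuous_on ?S (\<lambda>r. J \<bullet>\<^sub>v x r)" by (intro app.continuous_on continuous_on_const cx)
    from absolutely_integrable_inner_continuous[OF this h] show ?thesis
      by (simp add: absolutely_integrable_on_def integrable_on_mult_right)
  qed
  have iTn: "(\<lambda>r. 2 * ((J \<bullet>\<^sub>v y n r) \<bullet> k n r)) integrable_on ?S" for n
    by (intro integrable_continuous_real continuous_intros app.continuous_on cy ck)
  define T where "T = integral ?S (\<lambda>r. 2 * ((J \<bullet>\<^sub>v x r) \<bullet> h r))"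
  define Tn where "Tn n = integral ?S (\<lambda>r. 2 * ((J \<bullet>\<^sub>v y n r) \<bullet> k n r))" for n
  have TT: "norm (Tn n - T) \<le> 2 * norm J * (L + \<epsilon> n) * \<epsilon> n + 2 * norm J * \<epsilon> n * L" for n
  proof -
    have "Tn n - T = integral ?S (\<lambda>r. 2 * ((J \<bullet>\<^sub>v y n r) \<bullet> k n r) - 2 * ((J \<bullet>\<^sub>v x r) \<bullet> h r))"
      unfolding Tn_def T_def by (rule integral_diff[symmetric, OF iTn iT])
    also have "norm \<dots> \<le> integral ?S (\<lambda>r. (2 * norm J * (L + \<epsilon> n)) * d n r + (2 * norm J * \<epsilon> n) * norm (h r))"
    proof (rule integral_norm_bound_integral[OF integrable_diff[OF iTn iT]])
      show "(\<lambda>r. (2 * norm J * (L + \<epsilon> n)) * d n r + (2 * norm J * \<epsilon> n) * norm (h r)) integrable_on ?S"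
        by (intro integrable_add integrable_on_mult_right id nhi)
      fix r assume r: "r \<in> ?S"
      have ny: "norm (y n r) \<le> L + \<epsilon> n"
        using norm_triangle_ineq4[of "x r" "x r - y n r"] xL[OF r] yx[OF r, of n] by simp
      \<comment> \<open>One factor changes at a time: \<open>d n\<close> is the error of the
        velocity and \<open>\<epsilon> n\<close> bounds that of the position.\<close>
      have "(J \<bullet>\<^sub>v y n r) \<bullet> k n r - (J \<bullet>\<^sub>v x r) \<bullet> h r = - ((J \<bullet>\<^sub>v y n r) \<bullet> (h r - k n r)) - (J \<bullet>\<^sub>v (x r - y n r)) \<bullet> h r"
        by (simp add: inner_diff_right inner_diff_left app.diff_right)
      also have "\<bar>\<dots>\<bar> \<le> \<bar>(J \<bullet>\<^sub>v y n r) \<bullet> (h r - k n r)\<bar> + \<bar>(J \<bullet>\<^sub>v (x r - y n r)) \<bullet> h r\<bar>" by linarith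
      also have "\<dots> \<le> norm J * (L + \<epsilon> n) * d n r + norm J * \<epsilon> n * norm (h r)"
        unfolding d_def
        by (intro add_mono order_trans[OF Cauchy_Schwarz_ineq2] mult_right_mono
            order_trans[OF norm_app_le] mult_left_mono ny yx r) auto
      finally have "\<bar>(J \<bullet>\<^sub>v y n r) \<bullet> k n r - (J \<bullet>\<^sub>v x r) \<bullet> h r\<bar> \<le> norm J * (L + \<epsilon> n) * d n r + norm J * \<epsilon> n * norm (h r)" .
      then show "norm (2 * ((J \<bullet>\<^sub>v y n r) \<bullet> k n r) - 2 * ((J \<bullet>\<^sub>v x r) \<bullet> h r))
          \<le> (2 * norm J * (L + \<epsilon> n)) * d n r + (2 * norm J * \<epsilon> n) * norm (h r)"
        by (simp add: abs_if split: if_splits)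
    qed
    also have "\<dots> = 2 * norm J * (L + \<epsilon> n) * \<epsilon> n + 2 * norm J * \<epsilon> n * L"
      unfolding \<epsilon>_def L_def
      by (subst integral_add) (auto intro!: integrable_on_mult_right id nhi)
    finally show ?thesis .
  qed
  have "(\<lambda>n. Tn n - T) \<longlonglongrightarrow> 0"
  proof (rule Lim_null_comparison[OF always_eventually[OF allI[OF TT]]])
    have "(\<lambda>n. 2 * norm J * (L + \<epsilon> n) * \<epsilon> n + 2 * norm J * \<epsilon> n * L) \<longlonglongrightarrow> 2 * norm J * (L + 0) * 0 + 2 * norm J * 0 * L"
      by (intro tendsto_intros \<epsilon>)
    then show "(\<lambda>n. 2 * norm J * (L + \<epsilon> n) * \<epsilon> n + 2 * norm J * \<epsilon> n * L) \<longlonglongrightarrow> 0" by simp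
  qed
  then have Tlim: "Tn \<longlonglongrightarrow> T" by (simp add: LIM_zero_iff)
  have "(\<lambda>n. x 1 - y n 1) \<longlonglongrightarrow> 0"
    by (rule Lim_null_comparison[OF always_eventually \<epsilon>]) (use yx in auto)
  from tendsto_diff[OF tendsto_const[of "x 1"] this] have ylim: "(\<lambda>n. y n 1) \<longlonglongrightarrow> x 1" by simp
  have "(\<lambda>n. (Iop J \<bullet>\<^sub>v y n 1) \<bullet> y n 1 + Tn n) \<longlonglongrightarrow> (Iop J \<bullet>\<^sub>v x 1) \<bullet> x 1 + T"
    by (intro tendsto_intros app.tendsto ylim Tlim)
  moreover have "(\<lambda>n. (L + \<epsilon> n)\<^sup>2) \<longlonglongrightarrow> (L + 0)\<^sup>2" by (intro tendsto_intros \<epsilon>)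
  moreover have "(Iop J \<bullet>\<^sub>v y n 1) \<bullet> y n 1 + Tn n \<le> (L + \<epsilon> n)\<^sup>2" for n
  proof -
    have "(Iop J \<bullet>\<^sub>v y n 1) \<bullet> y n 1 + Tn n \<le> (Ln n)\<^sup>2"
      unfolding y_def Tn_def Ln_def by (rule phi_le_length_sq_continuous[OF skew J ck])
    also have "\<dots> \<le> (L + \<epsilon> n)\<^sup>2"
      by (rule power_mono[OF LL]) (auto simp: Ln_def intro!: integral_nonneg nki)
    finally show ?thesis .
  qed
  ultimately have "(Iop J \<bullet>\<^sub>v x 1) \<bullet> x 1 + T \<le> (L + 0)\<^sup>2"
    by (intro LIMSEQ_le) auto
  then show ?thesis unfolding T_def L_def by simp
qed

subsection \<open>Smooth local inverses\<close>

text \<open>Smoothness in each fixed direction becomes smoothness of one algebra-valued map, to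
  which \<open>Ck_left_right_inverse\<close> applies. The \<open>E b c\<close> are the matrix units
  of the basis.\<close>

lemma linear_endo_smooth:
  fixes f' :: "'a::euclidean_space \<Rightarrow> 'b::euclidean_space \<Rightarrow> 'b"
  assumes "open S" and lin: "\<And>x. x \<in> S \<Longrightarrow> linear (f' x)" and Ck: "\<And>v. Ck k S (\<lambda>x. f' x v)"
  shows "Ck k S (\<lambda>x. lin (f' x))"
proof -
  define E where "E b c = lin (\<lambda>v::'b. (v \<bullet> b) *\<^sub>R c)" for b c :: 'b
  have E: "E b c \<bullet>\<^sub>v v = (v \<bullet> b) *\<^sub>R c" for b c v
    unfolding E_def by (rule app_lin) (auto intro!: linearI simp: inner_add_left scaleR_add_left)
  have "Ck k S (\<lambda>x. \<Sum>b\<in>Basis. \<Sum>c\<in>Basis. (f' x b \<bullet> c) *\<^sub>R E b c)"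
    by (intro Ck_sum finite_Basis Ck_bounded_linear[OF bounded_linear_scaleR_left]
        Ck_bounded_linear[OF bounded_linear_inner_left] Ck)
  moreover have "(\<Sum>b\<in>Basis. \<Sum>c\<in>Basis. (f' x b \<bullet> c) *\<^sub>R E b c) = lin (f' x)" if "x \<in> S" for x
  proof (rule endo_eqI)
    fix v
    note l = lin[OF that]
    have "(\<Sum>b\<in>Basis. \<Sum>c\<in>Basis. (f' x b \<bullet> c) *\<^sub>R E b c) \<bullet>\<^sub>v v
        = (\<Sum>b\<in>Basis. (v \<bullet> b) *\<^sub>R (\<Sum>c\<in>Basis. (f' x b \<bullet> c) *\<^sub>R c))"
      by (simp add: app.sum_left app.scaleR_left E scaleR_sum_right mult.commute del: euclidean_representation)
    also have "\<dots> = f' x (\<Sum>b\<in>Basis. (v \<bullet> b) *\<^sub>R b)"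
      by (simp only: euclidean_representation[of "f' x _"] linear_sum[OF l] linear_cmul[OF l])
    finally show "(\<Sum>b\<in>Basis. \<Sum>c\<in>Basis. (f' x b \<bullet> c) *\<^sub>R E b c) \<bullet>\<^sub>v v = lin (f' x) \<bullet>\<^sub>v v"
      by (simp add: euclidean_representation app_lin[OF l])
  qed
  ultimately show ?thesis by (rule Ck_cong[OF assms(1)])
qed

text \<open>The inverse function theorem gives a continuous \<open>g\<close> with derivative
  \<open>R (g y)\<close>, where \<open>R x\<close> inverts \<open>f' x\<close>. As \<open>R\<close>
  is smooth, each order of regularity of \<open>g\<close> yields the next.\<close>

lemma smooth_local_inverse:
  fixes f :: "'a::euclidean_space \<Rightarrow> 'a"
  assumes W: "open W" "x0 \<in> W" and f: "\<And>k. Ck k W f"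
    and der: "(f has_derivative f0') (at x0)" and inj: "inj f0'"
  obtains V g where "open V" "f x0 \<in> V" "\<And>y. y \<in> V \<Longrightarrow> g y \<in> W \<and> f (g y) = y" "\<And>k. Ck k V g"
proof -
  define f' where "f' x = frechet_derivative f (at x)" for x
  have f': "(f has_derivative f' x) (at x)" if "x \<in> W" for x
    unfolding f'_def by (rule Ck_frechet_derivative(1)[OF W(1) f that])
  have Ckf': "Ck k W (\<lambda>x. f' x v)" for k v
    unfolding f'_def by (rule Ck_frechet_derivative(2)[OF W(1) f])
  have lin: "linear (f' x)" if "x \<in> W" for x using f'[OF that] has_derivative_linear by blast
  define P where "P x = lin (f' x)" for x
  have CkP: "Ck k W P" for k unfolding P_def by (rule linear_endo_smooth[OF W(1) lin Ckf'])
  have appP: "P x \<bullet>\<^sub>v v = f' x v" if "x \<in> W" for x v unfolding P_def by (rule app_lin[OF lin[OF that]])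
  have blP: "blinfun_apply (endo_blinfun (P x)) = f' x" if "x \<in> W" for x
    using appP[OF that] by (auto simp: app.rep_eq)
  have "f0' = f' x0" using has_derivative_unique[OF der f'[OF W(2)]] .
  then obtain l where l: "linear l" "l \<circ> f' x0 = id"
    using linear_injective_left_inverse[OF lin[OF W(2)]] inj by blast
  have contP: "continuous_on W (\<lambda>x. endo_blinfun (P x))"
    using Ck_continuous_on[OF CkP[of 0]] by (simp add: continuous_on_iff dist_endo_blinfun)
  have bl: "bounded_linear l" using l(1) by (simp add: linear_conv_bounded_linear)
  have "Blinfun l o\<^sub>L endo_blinfun (P x0) = id_blinfun"
    using l(2) by (intro blinfun_eqI) (simp add: bounded_linear_Blinfun_apply[OF bl] blP[OF W(2)] o_def fun_eq_iff)
  from inverse_function_theorem[OF W(1) _ contP W(2) this]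
  obtain U' V g g' where IFT: "open U'" "U' \<subseteq> W" "x0 \<in> U'" "open V" "f x0 \<in> V" "homeomorphism U' V f g"
    "\<And>y. y \<in> V \<Longrightarrow> (g has_derivative (g' y)) (at y)"
    "\<And>y. y \<in> V \<Longrightarrow> g' y = inv (blinfun_apply (endo_blinfun (P (g y))))"
    "\<And>y. y \<in> V \<Longrightarrow> bij (blinfun_apply (endo_blinfun (P (g y))))"
    using f' blP by metis
  have gU: "g y \<in> U'" "f (g y) = y" if "y \<in> V" for y
    using IFT(6) that by (auto simp: homeomorphism_def)
  have bij: "bij (f' x)" if "x \<in> U'" for x
  proof -
    have "f x \<in> V" "g (f x) = x" using IFT(6) that by (auto simp: homeomorphism_def)
    then show ?thesis using IFT(9)[of "f x"] blP that IFT(2) by auto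
  qed
  define R where "R x = lin (inv (f' x))" for x
  have linv: "linear (inv (f' x))" if "x \<in> U'" for x
    using bij[OF that] lin that IFT(2) by (metis bij_is_inj inj_linear_imp_inv_linear subsetD)
  have appR: "R x \<bullet>\<^sub>v v = inv (f' x) v" if "x \<in> U'" for x v
    unfolding R_def by (rule app_lin[OF linv[OF that]])
  have CkR: "Ck k U' R" for k
  proof (rule Ck_left_right_inverse[OF IFT(1) _ Ck_subset[OF CkP IFT(2)]])
    fix x assume x: "x \<in> U'"
    then have "x \<in> W" using IFT(2) by blast
    then show "P x * R x = 1 \<and> R x * P x = 1"
      using bij[OF x] by (auto intro!: endo_eqI simp: appP appR[OF x] bij_is_surj surj_f_inv_f bij_is_inj inv_f_f)
  qed
  have Ckg: "Ck k V g" for k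
  proof (induction k)
    case 0
    show ?case using IFT(6) by (simp add: homeomorphism_def)
  next
    case (Suc k)
    have dg: "(g has_derivative (\<lambda>v. R (g y) \<bullet>\<^sub>v v)) (at y)" if "y \<in> V" for y
      using IFT(7,8)[OF that] gU(1)[OF that] IFT(2) by (simp add: appR blP subset_eq)
    have "Ck k V (\<lambda>y. R (g y))"
      by (rule Ck_compose[OF CkR Suc]) (use gU in auto)
    then show ?case
      by (intro Ck_SucI[OF dg] Ck_bounded_linear[OF app.bounded_linear_left]) auto
  qed
  show ?thesis
    by (rule that[OF IFT(4,5) _ Ckg]) (use gU IFT(2) in auto)
qed

lemma dense_open_sequence:
  fixes g :: "'a::metric_space"
  assumes "closure D = UNIV" "open S" "g \<in> S"
  obtains u where "\<And>n. u n \<in> D \<inter> S" "u \<longlonglongrightarrow> g"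
proof -
  have "g \<in> closure (D \<inter> S)"
    using assms open_Int_closure_subset[OF assms(2), of D] by (auto simp: Int_commute)
  then obtain u where "\<forall>n. u n \<in> D \<inter> S" "u \<longlonglongrightarrow> g"
    unfolding closure_sequential by blast
  then show ?thesis using that[of u] by blast
qed

lemma continuous_eq_on_dense:
  fixes f g :: "'a::metric_space \<Rightarrow> 'b::t2_space"
  assumes D: "closure D = UNIV" "open S" and f: "continuous_on S f" "continuous_on S g"
    and eq: "\<And>x. x \<in> D \<Longrightarrow> x \<in> S \<Longrightarrow> f x = g x" and x: "x \<in> S"
  shows "f x = g x"
proof -
  obtain u where u: "\<And>n. u n \<in> D \<inter> S" "u \<longlonglongrightarrow> x"
    using dense_open_sequence[OF D x] by blast
  have "(\<lambda>n. f (u n)) \<longlonglongrightarrow> f x" "(\<lambda>n. g (u n)) \<longlonglongrightarrow> g x"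
    using continuous_on_tendsto_compose[OF f(1) u(2) x] continuous_on_tendsto_compose[OF f(2) u(2) x] u(1) by auto
  moreover have "(\<lambda>n. f (u n)) = (\<lambda>n. g (u n))" using eq u(1) by auto
  ultimately show ?thesis using LIMSEQ_unique by metis
qed

subsection \<open>Geodesics and the distance\<close>

locale skew_family =
  fixes U :: "'m::finite \<Rightarrow> real^'q::finite^'q"
  assumes skew: "\<And>j. transpose (U j) = - U j"
begin

abbreviation J :: "real^'m \<Rightarrow> (real^'q) endo" where "J \<equiv> Jop U"

abbreviation \<Omega> :: "(real^'m) set" where "\<Omega> \<equiv> Omega_star U"

lemma adj_J: "adj (J \<tau>) (- J \<tau>)"
  unfolding adj_def by (simp add: Jop_skew[OF skew] app.minus_left)

lemma mem_Omega: "\<tau> \<in> \<Omega> \<longleftrightarrow> norm (J \<tau>) < pi"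
  by (simp add: Omega_star_eq)

lemma continuous_on_J: "continuous_on S J"
  by (rule linear_continuous_on[OF bounded_linear_Jop])

lemma open_Omega: "open \<Omega>"
  unfolding Omega_star_eq
  by (intro open_Collect_less continuous_on_norm continuous_on_J continuous_on_const)

text \<open>The velocity of the geodesic with covector \<open>\<tau>\<close> and initial velocity \<open>\<zeta>\<close>; its endpoint is
  \<open>(Eop (J \<tau>) \<zeta>, Tend \<zeta> \<tau>)\<close>.\<close>
definition geod :: "real^'q \<Rightarrow> real^'m \<Rightarrow> real \<Rightarrow> real^'q" where
  "geod \<zeta> \<tau> r = exp ((2 * r) *\<^sub>R J \<tau>) \<bullet>\<^sub>v \<zeta>"

definition Tend :: "real^'q \<Rightarrow> real^'m \<Rightarrow> real^'m" where
  "Tend \<zeta> \<tau> = ht U (geod \<zeta> \<tau>) 1"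

lemma continuous_on_exp_J:
  assumes "continuous_on S f" "continuous_on S g"
  shows "continuous_on S (\<lambda>x. exp ((2 * f x) *\<^sub>R J (g x)))"
proof -
  have "Ck 0 UNIV (\<lambda>\<tau>. \<Sum>n. (2 ^ n / fact n) *\<^sub>R J \<tau> ^ n)"
  proof (rule Ck_power_series[OF bounded_linear_Jop])
    fix r :: real
    have "summable (\<lambda>n. \<bar>2 ^ n / fact n\<bar> * \<bar>r\<bar> ^ n)"
      by (rule abs_convD[OF abs_conv_exp, of _ "\<bar>r\<bar> + 1"]) auto
    then show "summable (\<lambda>n. \<bar>2 ^ n / fact n\<bar> * r ^ n)"
      by (rule summable_comparison_test') (simp add: abs_mult power_abs)
  qed
  then have c: "continuous_on UNIV (\<lambda>\<tau>. exp (2 *\<^sub>R J \<tau>))"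
    unfolding pser_exp[symmetric] pser_def by simp
  have "continuous_on S (\<lambda>x. exp (2 *\<^sub>R J (f x *\<^sub>R g x)))"
    by (rule continuous_on_compose2[OF c]) (auto intro!: continuous_intros assms)
  then show ?thesis by (simp add: Jop_scaleR)
qed

lemma continuous_on_geod: "continuous_on S (\<lambda>(p, r). geod (fst p) (snd p) r)"
  unfolding geod_def case_prod_beta
  by (intro app.continuous_on continuous_on_exp_J continuous_intros)

lemma continuous_on_geod': "continuous_on S (geod \<zeta> \<tau>)"
  unfolding geod_def by (intro app.continuous_on continuous_on_exp_J continuous_intros)

lemma hx_geod:
  assumes "0 \<le> s" shows "hx (geod \<zeta> \<tau>) s = (s *\<^sub>R Eop (s *\<^sub>R J \<tau>)) \<bullet>\<^sub>v \<zeta>"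
proof -
  have "((\<lambda>s. (s *\<^sub>R Eop (s *\<^sub>R J \<tau>)) \<bullet>\<^sub>v \<zeta>) has_vector_derivative geod \<zeta> \<tau> r) (at r within {0..s})" for r
    using has_derivative_at_withinI[OF bounded_linear.has_derivative[OF app.bounded_linear_left Eop_has_derivative]]
    unfolding has_vector_derivative_def geod_def by (simp add: app.scaleR_left)
  then have "(geod \<zeta> \<tau> has_integral (s *\<^sub>R Eop (s *\<^sub>R J \<tau>)) \<bullet>\<^sub>v \<zeta> - (0 *\<^sub>R Eop (0 *\<^sub>R J \<tau>)) \<bullet>\<^sub>v \<zeta>) {0..s}"
    by (intro fundamental_theorem_of_calculus[OF assms]) auto
  then show ?thesis unfolding hx_def by (simp add: integral_unique app.zero_left)
qed

lemma length_geod: "integral {0..1} (\<lambda>r. norm (geod \<zeta> \<tau> r)) = norm \<zeta>"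
  unfolding geod_def by (simp add: norm_exp_skew[OF adj_J])

text \<open>The factor 4 of \<open>phi\<close> times the 1/2 of the group law gives the 2; pairing
  with \<open>\<tau>\<close> merges the matrices \<open>U j\<close> into the single operator
  \<open>J \<tau>\<close>.\<close>

lemma ht_inner:
  assumes h: "h absolutely_integrable_on {0..1}"
  shows "4 * (ht U h 1 \<bullet> \<tau>) = integral {0..1} (\<lambda>r. 2 * ((J \<tau> \<bullet>\<^sub>v hx h r) \<bullet> h r))"
proof -
  have cx: "continuous_on {0..1} (hx h)"
    using h unfolding hx_def absolutely_integrable_on_def by (auto intro: indefinite_integral_continuous_1)
  define f where "f r = (1/2) *\<^sub>R (\<chi> j. (U j *v hx h r) \<bullet> h r)" for r
  have "(\<lambda>r. (U j *v hx h r) \<bullet> h r) absolutely_integrable_on {0..1}" for j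
    by (rule absolutely_integrable_inner_continuous[OF _ h])
       (intro continuous_on_compose2[OF linear_continuous_on[of "(*v) (U j)" UNIV] cx], auto simp: matrix_vector_mul_bounded_linear)
  then have "(\<lambda>r. (U j *v hx h r) \<bullet> h r) integrable_on {0..1}" for j
    using absolutely_integrable_on_def by blast
  then have "f integrable_on {0..1}"
    unfolding f_def
    by (intro integrable_cmul, subst integrable_componentwise_iff)
       (auto simp: Basis_vec_def inner_axis)
  then have a: "integral {0..1} (\<lambda>r. f r \<bullet> (4 *\<^sub>R \<tau>)) = integral {0..1} f \<bullet> (4 *\<^sub>R \<tau>)"
    using integral_linear[OF _ bounded_linear_inner_left[of "4 *\<^sub>R \<tau>"], of f "{0..1}"] by (simp add: o_def)
  have b: "f r \<bullet> (4 *\<^sub>R \<tau>) = 2 * ((J \<tau> \<bullet>\<^sub>v hx h r) \<bullet> h r)" for r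
    unfolding f_def app_Jop by (simp add: inner_vec_def[of _ \<tau>] inner_sum_left sum_distrib_left mult.commute)
  show ?thesis unfolding ht_def f_def[symmetric] b[symmetric] a by simp
qed

lemma phi_le_length:
  assumes "\<tau> \<in> \<Omega>" "h absolutely_integrable_on {0..1}"
  shows "phi U (hx h 1, ht U h 1) \<tau> \<le> (integral {0..1} (\<lambda>r. norm (h r)))\<^sup>2"
  using phi_le_length_sq[OF adj_J assms(1)[unfolded mem_Omega] assms(2)]
  unfolding phi_eq[OF skew assms(1)[unfolded mem_Omega]] fst_conv snd_conv ht_inner[OF assms(2)] hx_def .

lemma geod_integrable: "geod \<zeta> \<tau> absolutely_integrable_on {0..1}"
  by (rule absolutely_integrable_continuous_real[OF continuous_on_geod'])

lemma Tend_inner: "4 * (Tend \<zeta> \<tau> \<bullet> \<tau>) = (norm \<zeta>)\<^sup>2 - \<zeta> \<bullet> (Eop (J \<tau>) \<bullet>\<^sub>v \<zeta>)"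
proof -
  \<comment> \<open>The velocity \<open>h\<close> of the geodesic solves \<open>h' = 2 J h\<close>
    with \<open>h 0 = \<zeta>\<close>, hence \<open>2 J x = h - \<zeta>\<close>; and
    \<open>|h| = |\<zeta>|\<close> because the flow is orthogonal.\<close>
  have "2 * ((J \<tau> \<bullet>\<^sub>v hx (geod \<zeta> \<tau>) r) \<bullet> geod \<zeta> \<tau> r) = (norm \<zeta>)\<^sup>2 - \<zeta> \<bullet> geod \<zeta> \<tau> r" if "r \<in> {0..1}" for r
  proof -
    have "2 *\<^sub>R (J \<tau> \<bullet>\<^sub>v hx (geod \<zeta> \<tau>) r) = (2 *\<^sub>R ((r *\<^sub>R J \<tau>) * Eop (r *\<^sub>R J \<tau>))) \<bullet>\<^sub>v \<zeta>"
      using that by (simp add: hx_geod app.scaleR_left app.scaleR_right)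
    also have "\<dots> = geod \<zeta> \<tau> r - \<zeta>"
      unfolding Eop_mult by (simp add: app.diff_left geod_def)
    finally have "2 * ((J \<tau> \<bullet>\<^sub>v hx (geod \<zeta> \<tau>) r) \<bullet> geod \<zeta> \<tau> r) = (geod \<zeta> \<tau> r - \<zeta>) \<bullet> geod \<zeta> \<tau> r"
      by (metis inner_scaleR_left)
    then show ?thesis
      using norm_exp_skew[OF adj_J, of "2 * r" \<tau> \<zeta>]
      by (simp add: inner_diff_left geod_def flip: power2_norm_eq_inner)
  qed
  then have "4 * (Tend \<zeta> \<tau> \<bullet> \<tau>) = integral {0..1} (\<lambda>r. (norm \<zeta>)\<^sup>2 - \<zeta> \<bullet> geod \<zeta> \<tau> r)"
    unfolding Tend_def ht_inner[OF geod_integrable] by (intro integral_cong) auto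
  also have "\<dots> = (norm \<zeta>)\<^sup>2 - integral {0..1} (\<lambda>r. \<zeta> \<bullet> geod \<zeta> \<tau> r)"
    by (subst integral_diff) (auto intro!: integrable_continuous_real continuous_intros continuous_on_geod')
  also have "integral {0..1} (\<lambda>r. \<zeta> \<bullet> geod \<zeta> \<tau> r) = \<zeta> \<bullet> hx (geod \<zeta> \<tau>) 1"
    unfolding hx_def
    using integral_linear[OF integrable_continuous_real[OF continuous_on_geod'] bounded_linear_inner_right[of \<zeta>]]
    by (simp add: o_def)
  finally show ?thesis by (simp add: hx_geod)
qed

lemma phi_Tend:
  assumes "\<tau> \<in> \<Omega>"
  shows "phi U (Eop (J \<tau>) \<bullet>\<^sub>v \<zeta>, Tend \<zeta> \<tau>) \<tau> = (norm \<zeta>)\<^sup>2"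
proof -
  have "Iop (J \<tau>) \<bullet>\<^sub>v Eop (J \<tau>) \<bullet>\<^sub>v \<zeta> = \<zeta>"
    by (metis app_mult app_one Eop_Iop(2) assms mem_Omega)
  then show ?thesis
    unfolding phi_eq[OF skew assms[unfolded mem_Omega]] by (simp add: Tend_inner)
qed

lemma phi_le_Tend:
  assumes "\<sigma> \<in> \<Omega>"
  shows "phi U (Eop (J \<tau>) \<bullet>\<^sub>v \<zeta>, Tend \<zeta> \<tau>) \<sigma> \<le> (norm \<zeta>)\<^sup>2"
  using phi_le_length[OF assms geod_integrable, of \<zeta> \<tau>] by (simp add: hx_geod Tend_def length_geod)

lemma cc_dist_Tend:
  assumes "\<tau> \<in> \<Omega>"
  shows "cc_dist U (Eop (J \<tau>) \<bullet>\<^sub>v \<zeta>, Tend \<zeta> \<tau>) = norm \<zeta>"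
  unfolding cc_dist_def
proof (rule cInf_eq_minimum)
  show "norm \<zeta> \<in> {integral {0..1} (\<lambda>r. norm (h r)) |h. h absolutely_integrable_on {0..1} \<and>
      (hx h 1, ht U h 1) = (Eop (J \<tau>) \<bullet>\<^sub>v \<zeta>, Tend \<zeta> \<tau>)}"
    using geod_integrable length_geod by (auto simp: hx_geod Tend_def intro!: exI[of _ "geod \<zeta> \<tau>"])
next
  fix l assume "l \<in> {integral {0..1} (\<lambda>r. norm (h r)) |h. h absolutely_integrable_on {0..1} \<and>
      (hx h 1, ht U h 1) = (Eop (J \<tau>) \<bullet>\<^sub>v \<zeta>, Tend \<zeta> \<tau>)}"
  then obtain h where h: "l = integral {0..1} (\<lambda>r. norm (h r))" "h absolutely_integrable_on {0..1}"
    "(hx h 1, ht U h 1) = (Eop (J \<tau>) \<bullet>\<^sub>v \<zeta>, Tend \<zeta> \<tau>)" by blast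
  have "(norm \<zeta>)\<^sup>2 \<le> l\<^sup>2"
    using phi_le_length[OF assms h(2)] unfolding h(3) phi_Tend[OF assms] h(1) .
  moreover have "0 \<le> l"
    using h(1,2) by (auto simp: absolutely_integrable_on_def intro!: integral_nonneg)
  ultimately show "norm \<zeta> \<le> l" by (rule power2_le_imp_le)
qed

lemma Ck_Eop_J: "Ck k UNIV (\<lambda>\<tau>. Eop (J \<tau>))"
  unfolding Eop_def pser_def
proof (rule Ck_power_series[OF bounded_linear_Jop])
  fix r :: real
  have "summable (\<lambda>n. \<bar>ecoeff n\<bar> * \<bar>r\<bar> ^ n)"
    by (rule abs_convD[OF abs_conv_ecoeff, of _ "\<bar>r\<bar> + 1"]) auto
  then show "summable (\<lambda>n. \<bar>ecoeff n\<bar> * r ^ n)"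
    by (rule summable_comparison_test') (simp add: abs_mult power_abs)
qed

text \<open>The series of \<open>Iop\<close> has a finite radius and is out of reach of
  \<open>Ck_power_series\<close>; smoothness is inherited from the entire \<open>Eop\<close> by
  inversion.\<close>

lemma Ck_Iop_J: "Ck k \<Omega> (\<lambda>\<tau>. Iop (J \<tau>))"
  by (rule Ck_left_right_inverse[OF open_Omega _ Ck_subset[OF Ck_Eop_J subset_UNIV]])
     (auto simp: mem_Omega Eop_Iop)

lemma continuous_on_Eop_J: "continuous_on S g \<Longrightarrow> continuous_on S (\<lambda>x. Eop (J (g x)))"
  by (rule continuous_on_compose2[OF Ck_continuous_on[OF Ck_Eop_J]]) auto

lemma continuous_on_Tend:
  assumes "continuous_on S f" "continuous_on S g"
  shows "continuous_on S (\<lambda>x. Tend (f x) (g x))"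
proof -
  define F where "F p r = (1/2) *\<^sub>R (\<chi> j. (U j *v (r *\<^sub>R Eop (J (r *\<^sub>R snd p)) \<bullet>\<^sub>v fst p)) \<bullet> geod (fst p) (snd p) r)"
    for p :: "(real^'q) \<times> (real^'m)" and r
  have "continuous_on (UNIV \<times> cbox 0 1) (\<lambda>(p, r). F p r)"
  proof -
    have 1: "continuous_on (UNIV \<times> cbox 0 1) (\<lambda>z. geod (fst (fst z)) (snd (fst z)) (snd z))"
      using continuous_on_geod[of "UNIV \<times> cbox 0 1"] by (simp add: case_prod_beta)
    have "continuous_on UNIV ((*v) (U j))" for j
      by (rule linear_continuous_on) (rule matrix_vector_mul_bounded_linear)
    note 2 = continuous_on_compose2[OF this]
    show ?thesis
      unfolding F_def case_prod_beta
      by (intro continuous_intros continuous_on_vec_lambda 1 2 app.continuous_on continuous_on_Eop_J) auto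
  qed
  then have "continuous_on UNIV (\<lambda>p. integral (cbox 0 1) (F p))"
    by (rule integral_continuous_on_param)
  moreover have "integral (cbox 0 1) (F p) = Tend (fst p) (snd p)" for p
    unfolding Tend_def ht_def F_def
    by (auto intro!: integral_cong simp: hx_geod Jop_scaleR app.scaleR_left)
  ultimately have "continuous_on UNIV (\<lambda>p. Tend (fst p) (snd p))" by simp
  from continuous_on_compose2[OF this continuous_on_Pair[OF assms]] show ?thesis by simp
qed

section \<open>The gradient of \<open>phi\<close> in the covector and its critical points\<close>

definition Q :: "(real^'q) \<times> (real^'m) \<Rightarrow> real" where
  "Q p = (Iop (J (snd p)) \<bullet>\<^sub>v fst p) \<bullet> fst p"

abbreviation W :: "((real^'q) \<times> (real^'m)) set" where "W \<equiv> UNIV \<times> \<Omega>"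

lemma open_W: "open W"
  by (intro open_Times open_UNIV open_Omega)

lemma phi_Q: "\<tau> \<in> \<Omega> \<Longrightarrow> phi U (x, t) \<tau> = Q (x, \<tau>) + 4 * (t \<bullet> \<tau>)"
  by (simp add: phi_eq[OF skew] mem_Omega Q_def)

lemma Ck_Q: "Ck k W Q"
proof -
  have "Ck k W (\<lambda>p. Iop (J (snd p)))"
    by (rule Ck_compose[OF Ck_Iop_J Ck_linear[OF bounded_linear_snd]]) auto
  then have "Ck k W (\<lambda>p. (Iop (J (snd p)) \<bullet>\<^sub>v fst p) \<bullet> fst p)"
    by (intro Ck_bilinear[OF bounded_bilinear_inner] Ck_bilinear[OF bounded_bilinear_app]
        Ck_linear[OF bounded_linear_fst])
  then show ?thesis unfolding Q_def[abs_def] .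
qed

text \<open>The partial gradient of \<open>Q\<close> in \<open>\<tau>\<close>. As \<open>t\<close>
  enters \<open>phi\<close> linearly, critical covectors for \<open>(x, t)\<close> solve
  \<open>GQ (x, \<tau>) = - 4 t\<close>, and the Hessian of \<open>phi\<close> is the derivative of
  \<open>GQ\<close> in \<open>\<tau>\<close>.\<close>

definition GQ :: "(real^'q) \<times> (real^'m) \<Rightarrow> real^'m" where
  "GQ p = (\<Sum>b\<in>Basis. frechet_derivative Q (at p) (0, b) *\<^sub>R b)"

lemma Ck_GQ: "Ck k W GQ"
  unfolding GQ_def[abs_def]
  by (intro Ck_sum finite_Basis Ck_bounded_linear[OF bounded_linear_scaleR_left]
      Ck_frechet_derivative(2)[OF open_W Ck_Q])

lemma Q_has_derivative:
  assumes "\<tau> \<in> \<Omega>"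
  shows "((\<lambda>\<sigma>. Q (x, \<sigma>)) has_derivative (\<lambda>h. GQ (x, \<tau>) \<bullet> h)) (at \<tau>)"
proof -
  let ?D = "frechet_derivative Q (at (x, \<tau>))"
  have D: "(Q has_derivative ?D) (at (x, \<tau>))"
    by (rule Ck_frechet_derivative(1)[OF open_W Ck_Q]) (use assms in auto)
  have "((\<lambda>\<sigma>. Q (x, \<sigma>)) has_derivative (\<lambda>h. ?D (0, h))) (at \<tau>)"
    by (rule has_derivative_compose[of "\<lambda>\<sigma>. (x, \<sigma>)" "\<lambda>h. (0, h)", OF _ D]) (auto intro!: derivative_eq_intros)
  moreover have "?D (0, h) = GQ (x, \<tau>) \<bullet> h" for h
  proof -
    have lin: "linear ?D" using D has_derivative_linear by blast
    have "(0::real^'q, h) = (\<Sum>b\<in>Basis. (h \<bullet> b) *\<^sub>R (0, b))"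
      by (simp add: prod_eq_iff fst_sum snd_sum euclidean_representation)
    then have "?D (0, h) = ?D (\<Sum>b\<in>Basis. (h \<bullet> b) *\<^sub>R (0, b))" by simp
    also have "\<dots> = (\<Sum>b\<in>Basis. (h \<bullet> b) * ?D (0, b))"
      by (simp only: linear_sum[OF lin] linear_cmul[OF lin] real_scaleR_def)
    also have "\<dots> = GQ (x, \<tau>) \<bullet> h"
      unfolding GQ_def inner_sum_left inner_scaleR_left
      by (intro sum.cong) (auto simp: inner_commute mult.commute)
    finally show ?thesis .
  qed
  ultimately show ?thesis by simp
qed

lemma phi_has_derivative:
  assumes "\<tau> \<in> \<Omega>"
  shows "(phi U (x, t) has_derivative (\<lambda>h. (GQ (x, \<tau>) + 4 *\<^sub>R t) \<bullet> h)) (at \<tau>)"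
proof -
  have "((\<lambda>\<sigma>. Q (x, \<sigma>) + 4 * (t \<bullet> \<sigma>)) has_derivative (\<lambda>h. (GQ (x, \<tau>) + 4 *\<^sub>R t) \<bullet> h)) (at \<tau>)"
    by (rule has_derivative_eq_rhs[OF has_derivative_add[OF Q_has_derivative[OF assms]
          has_derivative_mult_right[OF has_derivative_inner_right[OF has_derivative_ident]]]])
       (auto simp: inner_add_left)
  then show ?thesis
    by (rule has_derivative_transform_within_open[OF _ open_Omega assms]) (simp add: phi_Q)
qed

text \<open>Along the geodesic with parameters \<open>\<zeta>\<close>, \<open>\<tau>\<close>, the function \<open>\<phi>\<close> attains its upper bound
  at \<open>\<tau>\<close>, which is therefore a critical point.\<close>
lemma GQ_eq_Tend:
  assumes "\<tau> \<in> \<Omega>"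
  shows "GQ (x, \<tau>) = - 4 *\<^sub>R Tend (Iop (J \<tau>) \<bullet>\<^sub>v x) \<tau>"
proof -
  define \<zeta> where "\<zeta> = Iop (J \<tau>) \<bullet>\<^sub>v x"
  have x: "Eop (J \<tau>) \<bullet>\<^sub>v \<zeta> = x"
    unfolding \<zeta>_def by (metis app_mult app_one Eop_Iop(1) assms mem_Omega)
  have "(\<lambda>h. (GQ (x, \<tau>) + 4 *\<^sub>R Tend \<zeta> \<tau>) \<bullet> h) = (\<lambda>h. 0)"
  proof (rule differential_zero_maxmin[OF assms open_Omega phi_has_derivative[OF assms]])
    show "(\<forall>\<sigma>\<in>\<Omega>. phi U (x, Tend \<zeta> \<tau>) \<sigma> \<le> phi U (x, Tend \<zeta> \<tau>) \<tau>) \<or>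
        (\<forall>\<sigma>\<in>\<Omega>. phi U (x, Tend \<zeta> \<tau>) \<tau> \<le> phi U (x, Tend \<zeta> \<tau>) \<sigma>)"
      using phi_le_Tend[of _ \<tau> \<zeta>] phi_Tend[OF assms, of \<zeta>] unfolding x by simp
  qed
  then have "GQ (x, \<tau>) + 4 *\<^sub>R Tend \<zeta> \<tau> = 0"
    by (metis inner_eq_zero_iff)
  then show ?thesis unfolding \<zeta>_def by (simp add: eq_neg_iff_add_eq_0)
qed

lemma crit_Tend:
  assumes "\<tau> \<in> \<Omega>" "GQ (x, \<tau>) = - 4 *\<^sub>R t"
  shows "t = Tend (Iop (J \<tau>) \<bullet>\<^sub>v x) \<tau>" "x = Eop (J \<tau>) \<bullet>\<^sub>v Iop (J \<tau>) \<bullet>\<^sub>v x"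
  using GQ_eq_Tend[OF assms(1), of x] assms
  by (simp, metis app_mult app_one Eop_Iop(1) mem_Omega)

text \<open>A critical covector exhibits \<open>(x, t)\<close> as the endpoint of its geodesic,
  whose length is then the distance. The second claim supplies the lower barrier used later to
  compare derivatives.\<close>

lemma crit_cc_dist:
  assumes "\<tau> \<in> \<Omega>" "GQ (x, \<tau>) = - 4 *\<^sub>R t"
  shows "(cc_dist U (x, t))\<^sup>2 = Q (x, \<tau>) + 4 * (t \<bullet> \<tau>)"
    and "\<sigma> \<in> \<Omega> \<Longrightarrow> Q (x, \<sigma>) + 4 * (t \<bullet> \<sigma>) \<le> (cc_dist U (x, t))\<^sup>2"
proof -
  define \<zeta> where "\<zeta> = Iop (J \<tau>) \<bullet>\<^sub>v x"
  have g: "(x, t) = (Eop (J \<tau>) \<bullet>\<^sub>v \<zeta>, Tend \<zeta> \<tau>)"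
    using crit_Tend[OF assms] unfolding \<zeta>_def by simp
  have c: "(cc_dist U (x, t))\<^sup>2 = (norm \<zeta>)\<^sup>2"
    by (subst g) (simp add: cc_dist_Tend[OF assms(1)])
  show "(cc_dist U (x, t))\<^sup>2 = Q (x, \<tau>) + 4 * (t \<bullet> \<tau>)"
    unfolding c phi_Q[OF assms(1), symmetric] by (subst g) (simp add: phi_Tend[OF assms(1)])
  show "Q (x, \<sigma>) + 4 * (t \<bullet> \<sigma>) \<le> (cc_dist U (x, t))\<^sup>2" if "\<sigma> \<in> \<Omega>"
    unfolding c phi_Q[OF that, symmetric] by (subst g) (rule phi_le_Tend[OF that])
qed

text \<open>\<open>nondeg_crit\<close> admits any gradient field \<open>G\<close> near the point;
  uniqueness of derivatives forces \<open>G = GQ + 4 t\<close> on a neighbourhood, so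
  \<open>H\<close> is the derivative of \<open>GQ\<close>.\<close>

lemma mem_MM_iff:
  "(x, t) \<in> MM U \<longleftrightarrow> (\<exists>\<tau>\<in>\<Omega>. GQ (x, \<tau>) = - 4 *\<^sub>R t \<and>
    (\<exists>H. ((\<lambda>\<sigma>. GQ (x, \<sigma>)) has_derivative H) (at \<tau>) \<and> inj H))"
proof -
  have "nondeg_crit (phi U (x, t)) \<tau> \<longleftrightarrow> GQ (x, \<tau>) = - 4 *\<^sub>R t \<and>
      (\<exists>H. ((\<lambda>\<sigma>. GQ (x, \<sigma>)) has_derivative H) (at \<tau>) \<and> inj H)" if \<tau>: "\<tau> \<in> \<Omega>" for \<tau>
  proof
    assume "nondeg_crit (phi U (x, t)) \<tau>"
    then obtain G H where ev: "\<forall>\<^sub>F \<sigma> in nhds \<tau>. (phi U (x, t) has_derivative (\<lambda>h. G \<sigma> \<bullet> h)) (at \<sigma>)"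
      and G: "G \<tau> = 0" "(G has_derivative H) (at \<tau>)" "inj H"
      unfolding nondeg_crit_def by blast
    have "\<forall>\<^sub>F \<sigma> in nhds \<tau>. G \<sigma> = GQ (x, \<sigma>) + 4 *\<^sub>R t"
      using ev eventually_nhds_in_open[OF open_Omega \<tau>]
    proof eventually_elim
      case (elim \<sigma>)
      have "(\<lambda>h. G \<sigma> \<bullet> h) = (\<lambda>h. (GQ (x, \<sigma>) + 4 *\<^sub>R t) \<bullet> h)"
        by (rule has_derivative_unique[OF elim(1) phi_has_derivative[OF elim(2)]])
      then show ?case by (metis vector_eq_rdot)
    qed
    then obtain S where S: "open S" "\<tau> \<in> S" "\<And>\<sigma>. \<sigma> \<in> S \<Longrightarrow> G \<sigma> = GQ (x, \<sigma>) + 4 *\<^sub>R t"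
      unfolding eventually_nhds by blast
    have "((\<lambda>\<sigma>. G \<sigma> - 4 *\<^sub>R t) has_derivative H) (at \<tau>)"
      using has_derivative_diff[OF G(2) has_derivative_const] by simp
    then have "((\<lambda>\<sigma>. GQ (x, \<sigma>)) has_derivative H) (at \<tau>)"
      by (rule has_derivative_transform_within_open[OF _ S(1,2)]) (simp add: S(3))
    moreover have "GQ (x, \<tau>) = - 4 *\<^sub>R t"
      using S(3)[OF S(2)] G(1) by (simp add: eq_neg_iff_add_eq_0)
    ultimately show "GQ (x, \<tau>) = - 4 *\<^sub>R t \<and> (\<exists>H. ((\<lambda>\<sigma>. GQ (x, \<sigma>)) has_derivative H) (at \<tau>) \<and> inj H)"
      using G(3) by blast
  next
    assume "GQ (x, \<tau>) = - 4 *\<^sub>R t \<and> (\<exists>H. ((\<lambda>\<sigma>. GQ (x, \<sigma>)) has_derivative H) (at \<tau>) \<and> inj H)"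
    then obtain H where G: "GQ (x, \<tau>) + 4 *\<^sub>R t = 0" "((\<lambda>\<sigma>. GQ (x, \<sigma>)) has_derivative H) (at \<tau>)" "inj H"
      by auto
    have "((\<lambda>\<sigma>. GQ (x, \<sigma>) + 4 *\<^sub>R t) has_derivative H) (at \<tau>)"
      using has_derivative_add[OF G(2) has_derivative_const] by simp
    moreover have "\<forall>\<^sub>F \<sigma> in nhds \<tau>. (phi U (x, t) has_derivative (\<lambda>h. (GQ (x, \<sigma>) + 4 *\<^sub>R t) \<bullet> h)) (at \<sigma>)"
      using eventually_nhds_in_open[OF open_Omega \<tau>] by eventually_elim (rule phi_has_derivative)
    ultimately show "nondeg_crit (phi U (x, t)) \<tau>"
      unfolding nondeg_crit_def using G
      by (intro exI[of _ "\<lambda>\<sigma>. GQ (x, \<sigma>) + 4 *\<^sub>R t"] exI[of _ H]) simp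
  qed
  then show ?thesis unfolding MM_def by auto
qed

text \<open>The implicit function theorem for the critical equation, written as
  \<open>\<Psi> (x, \<tau>) = (x, t)\<close>. The derivative of \<open>\<Psi>\<close> is block
  triangular, with the identity and \<open>- 1/4\<close> times the Hessian on the diagonal, so an
  injective Hessian makes it injective.\<close>

lemma MM_local_parameter:
  assumes "g0 \<in> MM U"
  obtains V \<theta> where "open V" "g0 \<in> V" "\<And>k. Ck k V \<theta>"
    "\<And>g. g \<in> V \<Longrightarrow> \<theta> g \<in> \<Omega> \<and> GQ (fst g, \<theta> g) = - 4 *\<^sub>R snd g"
proof -
  obtain x0 t0 where g0: "g0 = (x0, t0)" by fastforce
  obtain \<tau>0 H where \<tau>0: "\<tau>0 \<in> \<Omega>" "GQ (x0, \<tau>0) = - 4 *\<^sub>R t0"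
    and H: "((\<lambda>\<sigma>. GQ (x0, \<sigma>)) has_derivative H) (at \<tau>0)" "inj H"
    using assms unfolding g0 mem_MM_iff by blast
  define \<Psi> where "\<Psi> p = (fst p, (- 1/4) *\<^sub>R GQ p)" for p
  have Ck\<Psi>: "Ck k W \<Psi>" for k
    unfolding \<Psi>_def[abs_def]
    by (intro Ck_Pair Ck_linear[OF bounded_linear_fst] Ck_bounded_linear[OF bounded_linear_scaleR_right] Ck_GQ)
  define D where "D = frechet_derivative GQ (at (x0, \<tau>0))"
  have p0: "(x0, \<tau>0) \<in> W" using \<tau>0 by simp
  have D: "(GQ has_derivative D) (at (x0, \<tau>0))"
    unfolding D_def by (rule Ck_frechet_derivative(1)[OF open_W Ck_GQ p0])
  have "((\<lambda>\<sigma>. GQ (x0, \<sigma>)) has_derivative (\<lambda>h. D (0, h))) (at \<tau>0)"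
    by (rule has_derivative_compose[of "\<lambda>\<sigma>. (x0, \<sigma>)" "\<lambda>h. (0, h)", OF _ D]) (auto intro!: derivative_eq_intros)
  then have HD: "H = (\<lambda>h. D (0, h))" by (rule has_derivative_unique[OF H(1)])
  have d\<Psi>: "(\<Psi> has_derivative (\<lambda>v. (fst v, (- 1/4) *\<^sub>R D v))) (at (x0, \<tau>0))"
    unfolding \<Psi>_def[abs_def]
    by (intro has_derivative_Pair has_derivative_fst has_derivative_ident has_derivative_scaleR_right D)
  have linD: "linear D" using D has_derivative_linear by blast
  have "inj (\<lambda>v. (fst v, (- 1/4) *\<^sub>R D v))"
  proof (rule injI)
    fix v w :: "(real^'q) \<times> (real^'m)"
    assume eq: "(fst v, (- 1/4) *\<^sub>R D v) = (fst w, (- 1/4) *\<^sub>R D w)"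
    then have "D (v - w) = 0" by (simp add: linear_diff[OF linD])
    moreover have "v - w = (0, snd v - snd w)" using eq by (simp add: prod_eq_iff)
    ultimately have "H (snd v - snd w) = 0" using HD by simp
    also have "0 = H 0" using linear_0[OF linD] HD by (simp flip: zero_prod_def)
    finally have "snd v - snd w = 0" using H(2) by (simp add: inj_eq)
    then show "v = w" using eq by (simp add: prod_eq_iff)
  qed
  from smooth_local_inverse[OF open_W p0 Ck\<Psi> d\<Psi> this]
  obtain V G where V: "open V" "\<Psi> (x0, \<tau>0) \<in> V" "\<And>y. y \<in> V \<Longrightarrow> G y \<in> W \<and> \<Psi> (G y) = y" "\<And>k. Ck k V G"
    by metis
  show ?thesis
  proof (rule that[of V "\<lambda>g. snd (G g)"])
    show "open V" by fact
    show "g0 \<in> V" using V(2) \<tau>0 by (simp add: \<Psi>_def g0)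
    show "Ck k V (\<lambda>g. snd (G g))" for k
      by (rule Ck_bounded_linear[OF bounded_linear_snd V(4)])
    fix g assume "g \<in> V"
    then have GW: "G g \<in> W" and P: "fst (G g) = fst g" "(- 1/4) *\<^sub>R GQ (G g) = snd g"
      using V(3)[of g] by (auto simp: \<Psi>_def prod_eq_iff)
    have "GQ (fst g, snd (G g)) = GQ (G g)" using P(1) by (metis prod.collapse)
    also have "\<dots> = - 4 *\<^sub>R snd g" using P(2)[symmetric] by simp
    finally show "snd (G g) \<in> \<Omega> \<and> GQ (fst g, snd (G g)) = - 4 *\<^sub>R snd g"
      using GW by auto
  qed
qed

lemma MM_not_cut: "MM U \<inter> cut_locus U = {}"
proof -
  have "g0 \<notin> cut_locus U" if g0: "g0 \<in> MM U" for g0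
  proof -
    obtain V \<theta> where V: "open V" "g0 \<in> V" "\<And>k. Ck k V \<theta>"
      "\<And>g. g \<in> V \<Longrightarrow> \<theta> g \<in> \<Omega> \<and> GQ (fst g, \<theta> g) = - 4 *\<^sub>R snd g"
      using MM_local_parameter[OF g0] by blast
    have "Ck k V (\<lambda>g. Q (fst g, \<theta> g) + 4 * (snd g \<bullet> \<theta> g))" for k
      by (intro Ck_add Ck_compose[OF Ck_Q] Ck_Pair Ck_linear[OF bounded_linear_fst] V(3)
          Ck_bounded_linear[OF bounded_linear_mult_right] Ck_bilinear[OF bounded_bilinear_inner]
          Ck_linear[OF bounded_linear_snd]) (use V(4) in auto)
    moreover have "Q (fst g, \<theta> g) + 4 * (snd g \<bullet> \<theta> g) = (cc_dist U g)\<^sup>2" if "g \<in> V" for g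
      using crit_cc_dist(1)[of "\<theta> g" "fst g" "snd g"] V(4)[OF that] by simp
    ultimately have "Ck k V (\<lambda>g. (cc_dist U g)\<^sup>2)" for k
      by (rule Ck_cong[OF V(1)])
    then have "Cinf_on V (\<lambda>g. (cc_dist U g)\<^sup>2)"
      by (rule Cinf_on_if_Ck[OF V(1)])
    then show ?thesis using V(1,2) unfolding cut_locus_def by blast
  qed
  then show ?thesis by blast
qed

subsection \<open>Points where the squared distance is smooth\<close>

lemma Q_has_derivative_fst:
  assumes "\<tau> \<in> \<Omega>"
  shows "((\<lambda>y. Q (y, \<tau>)) has_derivative (\<lambda>\<xi>. 2 * (((Iop (J \<tau>) + J \<tau>) \<bullet>\<^sub>v x) \<bullet> \<xi>))) (at x)"
proof -
  let ?I = "Iop (J \<tau>)"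
  have "((\<lambda>y. (?I \<bullet>\<^sub>v y) \<bullet> y) has_derivative (\<lambda>\<xi>. (?I \<bullet>\<^sub>v x) \<bullet> \<xi> + (?I \<bullet>\<^sub>v \<xi>) \<bullet> x)) (at x)"
    by (intro has_derivative_inner has_derivative_ident bounded_linear_imp_has_derivative app.bounded_linear_right)
  \<comment> \<open>\<open>Iop\<close> plus its adjoint is twice the symmetric operator
    \<open>J coth J\<close>, which is \<open>Iop + J\<close>.\<close>
  moreover have "(?I \<bullet>\<^sub>v x) \<bullet> \<xi> + (?I \<bullet>\<^sub>v \<xi>) \<bullet> x = 2 * (((?I + J \<tau>) \<bullet>\<^sub>v x) \<bullet> \<xi>)" for \<xi>
    using adjD[OF Iop_adj[OF adj_J], of \<tau> \<xi> x] assms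
    by (simp add: mem_Omega app.add_left app.scaleR_left inner_add_left inner_add_right inner_commute)
  ultimately show ?thesis by (simp add: Q_def)
qed

text \<open>Near a point of \<open>MM\<close> the squared distance dominates \<open>\<phi>(\<cdot>; \<tau>)\<close>, with equality at the
  point, so both have the same derivative there.\<close>
lemma sq_dist_derivative_MM:
  assumes g: "(x, t) \<in> MM U" and f': "((\<lambda>p. (cc_dist U p)\<^sup>2) has_derivative f') (at (x, t))"
  obtains \<tau> where "\<tau> \<in> \<Omega>" "GQ (x, \<tau>) = - 4 *\<^sub>R t"
    "\<And>\<xi> s. f' (\<xi>, s) = 2 * (((Iop (J \<tau>) + J \<tau>) \<bullet>\<^sub>v x) \<bullet> \<xi>) + 4 * (\<tau> \<bullet> s)"
proof -
  obtain V \<theta> where V: "open V" "(x, t) \<in> V"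
    "\<And>g. g \<in> V \<Longrightarrow> \<theta> g \<in> \<Omega> \<and> GQ (fst g, \<theta> g) = - 4 *\<^sub>R snd g"
    using MM_local_parameter[OF g] by metis
  define \<tau> where "\<tau> = \<theta> (x, t)"
  have \<tau>: "\<tau> \<in> \<Omega>" "GQ (x, \<tau>) = - 4 *\<^sub>R t" using V(3)[OF V(2)] by (auto simp: \<tau>_def)
  define D where "D v = 2 * (((Iop (J \<tau>) + J \<tau>) \<bullet>\<^sub>v x) \<bullet> fst v) + 4 * (\<tau> \<bullet> snd v)" for v
  have dQ: "((\<lambda>p. Q (fst p, \<tau>)) has_derivative (\<lambda>v. 2 * (((Iop (J \<tau>) + J \<tau>) \<bullet>\<^sub>v x) \<bullet> fst v))) (at (x, t))"
    using has_derivative_compose[OF has_derivative_fst[OF has_derivative_ident], of "\<lambda>y. Q (y, \<tau>)" _ "(x, t)" UNIV]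
      Q_has_derivative_fst[OF \<tau>(1), of x] by simp
  have dt: "((\<lambda>p. 4 * (snd p \<bullet> \<tau>)) has_derivative (\<lambda>v. 4 * (\<tau> \<bullet> snd v))) (at (x, t))"
    by (auto intro!: derivative_eq_intros simp: inner_commute)
  have "((\<lambda>p. (cc_dist U p)\<^sup>2 - (Q (fst p, \<tau>) + 4 * (snd p \<bullet> \<tau>))) has_derivative (\<lambda>v. f' v - D v)) (at (x, t))"
    unfolding D_def by (intro has_derivative_diff f' has_derivative_add dQ dt)
  then have "(\<lambda>v. f' v - D v) = (\<lambda>v. 0)"
  proof (rule differential_zero_maxmin[OF V(2,1)])
    have "(cc_dist U (x, t))\<^sup>2 - (Q (fst (x, t), \<tau>) + 4 * (snd (x, t) \<bullet> \<tau>)) = 0"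
      using crit_cc_dist(1)[OF \<tau>] by simp
    \<comment> \<open>Each \<open>p\<close> in \<open>V\<close> has its own critical covector
      \<open>\<theta> p\<close>; this licenses the lower bound at \<open>p\<close> with the fixed
      covector \<open>\<tau>\<close>.\<close>
    moreover have "0 \<le> (cc_dist U p)\<^sup>2 - (Q (fst p, \<tau>) + 4 * (snd p \<bullet> \<tau>))" if "p \<in> V" for p
      using crit_cc_dist(2)[OF _ _ \<tau>(1), of "\<theta> p" "fst p" "snd p"] V(3)[OF that] by simp
    ultimately show "(\<forall>p\<in>V. (cc_dist U p)\<^sup>2 - (Q (fst p, \<tau>) + 4 * (snd p \<bullet> \<tau>))
          \<le> (cc_dist U (x, t))\<^sup>2 - (Q (fst (x, t), \<tau>) + 4 * (snd (x, t) \<bullet> \<tau>))) \<or>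
        (\<forall>p\<in>V. (cc_dist U (x, t))\<^sup>2 - (Q (fst (x, t), \<tau>) + 4 * (snd (x, t) \<bullet> \<tau>))
          \<le> (cc_dist U p)\<^sup>2 - (Q (fst p, \<tau>) + 4 * (snd p \<bullet> \<tau>)))" by simp
  qed
  then have "f' v = D v" for v by (metis right_minus_eq)
  then show ?thesis using that[OF \<tau>] by (simp add: D_def)
qed

lemma smooth_imp_MM:
  assumes dense: "closure (MM U) = UNIV" and S: "open S" "g0 \<in> S"
    and smooth: "Cinf_on S (\<lambda>p. (cc_dist U p)\<^sup>2)"
  shows "g0 \<in> MM U"
proof -
  obtain D where D0: "D [] = (\<lambda>p. (cc_dist U p)\<^sup>2)" and contD: "\<And>vs. continuous_on S (D vs)"
    and derD: "\<And>vs x. x \<in> S \<Longrightarrow> (D vs has_derivative (\<lambda>v. \<Sum>b\<in>Basis. (v \<bullet> b) * D (b # vs) x)) (at x)"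
    using smooth unfolding Cinf_on_def by blast
  define f' where "f' g v = (\<Sum>b\<in>Basis. (v \<bullet> b) * D [b] g)" for g v
  have f': "((\<lambda>p. (cc_dist U p)\<^sup>2) has_derivative f' g) (at g)" if "g \<in> S" for g
    using derD[OF that, of "[]"] unfolding D0 f'_def .
  have f'_Basis: "f' g b = D [b] g" if "b \<in> Basis" for g b
    using that unfolding f'_def by (simp add: inner_Basis if_distrib[of "\<lambda>x. x * _"] cong: if_cong)
  \<comment> \<open>These definitions invert the formula of \<open>sq_dist_derivative_MM\<close>:
    the vertical gradient is \<open>4 \<tau>\<close> and the horizontal one
    \<open>2 (Iop + J) x\<close>, from which \<open>\<zeta> = Iop x\<close> is recovered without
    mentioning \<open>Iop\<close>.\<close>
  define \<tau> where "\<tau> g = (1/4) *\<^sub>R (\<Sum>b\<in>Basis. f' g (0, b) *\<^sub>R b)" for g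
  define p where "p g = (\<Sum>b\<in>Basis. f' g (b, 0) *\<^sub>R b)" for g
  define \<zeta> where "\<zeta> g = (1/2) *\<^sub>R p g - J (\<tau> g) \<bullet>\<^sub>v fst g" for g
  have \<tau>D: "\<tau> = (\<lambda>g. (1/4) *\<^sub>R (\<Sum>b\<in>Basis. D [(0, b)] g *\<^sub>R b))"
    unfolding \<tau>_def by (intro ext arg_cong[of _ _ "scaleR _"] sum.cong refl) (simp add: f'_Basis Basis_prod_def)
  have pD: "p = (\<lambda>g. \<Sum>b\<in>Basis. D [(b, 0)] g *\<^sub>R b)"
    unfolding p_def by (intro ext sum.cong refl) (simp add: f'_Basis Basis_prod_def)
  have cont\<tau>: "continuous_on S \<tau>" unfolding \<tau>D by (intro continuous_intros contD)
  have contp: "continuous_on S p" unfolding pD by (intro continuous_intros contD)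
  have contJ\<tau>: "continuous_on S (\<lambda>g. J (\<tau> g))"
    by (rule continuous_on_compose2[OF continuous_on_J cont\<tau>]) auto
  have cont\<zeta>: "continuous_on S \<zeta>"
    unfolding \<zeta>_def by (intro continuous_intros contp app.continuous_on contJ\<tau>)
  \<comment> \<open>Second derivatives of the squared distance enter here, for the Hessian argument
    at the end.\<close>
  have diff\<tau>: "\<exists>\<tau>'. (\<tau> has_derivative \<tau>') (at g)" if "g \<in> S" for g
    unfolding \<tau>D
    by (rule exI, rule has_derivative_scaleR_right, rule has_derivative_sum,
        rule has_derivative_scaleR_left, rule derD[OF that])
  have onMM: "\<tau> g \<in> \<Omega> \<and> GQ (fst g, \<tau> g) = - 4 *\<^sub>R snd g \<and> \<zeta> g = Iop (J (\<tau> g)) \<bullet>\<^sub>v fst g"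
    if "g \<in> MM U" "g \<in> S" for g
  proof -
    obtain x t where g: "g = (x, t)" by fastforce
    from sq_dist_derivative_MM[OF that(1)[unfolded g] f'[OF that(2)[unfolded g]]]
    obtain \<theta> where \<theta>: "\<theta> \<in> \<Omega>" "GQ (x, \<theta>) = - 4 *\<^sub>R t"
      "\<And>\<xi> s. f' (x, t) (\<xi>, s) = 2 * (((Iop (J \<theta>) + J \<theta>) \<bullet>\<^sub>v x) \<bullet> \<xi>) + 4 * (\<theta> \<bullet> s)"
      by metis
    have \<tau>\<theta>: "\<tau> g = \<theta>"
    proof -
      have "(\<Sum>b\<in>Basis. f' g (0, b) *\<^sub>R b) = 4 *\<^sub>R (\<Sum>b\<in>Basis. (\<theta> \<bullet> b) *\<^sub>R b)"
        unfolding g \<theta>(3) by (simp add: scaleR_sum_right del: euclidean_representation)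
      then show ?thesis unfolding \<tau>_def by (simp add: euclidean_representation)
    qed
    have "p g = 2 *\<^sub>R (\<Sum>b\<in>Basis. (((Iop (J \<theta>) + J \<theta>) \<bullet>\<^sub>v x) \<bullet> b) *\<^sub>R b)"
      unfolding p_def g \<theta>(3) by (simp add: scaleR_sum_right del: euclidean_representation)
    then have "p g = 2 *\<^sub>R ((Iop (J \<theta>) + J \<theta>) \<bullet>\<^sub>v x)" by (simp add: euclidean_representation)
    then have "\<zeta> g = Iop (J \<theta>) \<bullet>\<^sub>v x"
      unfolding \<zeta>_def \<tau>\<theta> by (simp add: g app.add_left)
    then show ?thesis using \<theta>(1,2) \<tau>\<theta> g by simp
  qed
  \<comment> \<open>The critical equation is meaningful only inside \<open>\<Omega>\<close>. Its
    form through \<open>Eop\<close> and \<open>Tend\<close> is continuous in all covectors and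
    survives in the limit even if \<open>\<tau> g\<close> were to leave
    \<open>\<Omega>\<close>.\<close>
  have endpoint: "(Eop (J (\<tau> g)) \<bullet>\<^sub>v \<zeta> g, Tend (\<zeta> g) (\<tau> g)) = g" if "g \<in> S" for g
  proof (rule continuous_eq_on_dense[OF dense S(1) _ continuous_on_id _ that])
    show "continuous_on S (\<lambda>g. (Eop (J (\<tau> g)) \<bullet>\<^sub>v \<zeta> g, Tend (\<zeta> g) (\<tau> g)))"
      by (intro continuous_on_Pair app.continuous_on continuous_on_Eop_J continuous_on_Tend cont\<tau> cont\<zeta>)
    fix g assume g: "g \<in> MM U" "g \<in> S"
    show "(Eop (J (\<tau> g)) \<bullet>\<^sub>v \<zeta> g, Tend (\<zeta> g) (\<tau> g)) = g"
      using onMM[OF g] crit_Tend[of "\<tau> g" "fst g" "snd g"] by (metis prod.collapse)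
  qed
  have norm_le: "norm (J (\<tau> g)) \<le> pi" if g: "g \<in> S" for g
  proof -
    obtain u where u: "\<And>n. u n \<in> MM U \<inter> S" "u \<longlonglongrightarrow> g"
      using dense_open_sequence[OF dense S(1) g] by blast
    have "(\<lambda>n. J (\<tau> (u n))) \<longlonglongrightarrow> J (\<tau> g)"
      using continuous_on_tendsto_compose[OF contJ\<tau> u(2) g] u(1) by auto
    then have "(\<lambda>n. norm (J (\<tau> (u n)))) \<longlonglongrightarrow> norm (J (\<tau> g))" by (rule tendsto_norm)
    moreover have "norm (J (\<tau> (u n))) \<le> pi" for n
      using onMM[of "u n"] u(1)[of n] mem_Omega[of "\<tau> (u n)"] by auto
    ultimately show ?thesis by (intro LIMSEQ_le_const2) auto
  qed
  define \<Phi> where "\<Phi> g = (\<zeta> g, \<tau> g)" for g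
  have "inj_on \<Phi> S"
    by (rule inj_on_inverseI[of _ "\<lambda>q. (Eop (J (snd q)) \<bullet>\<^sub>v fst q, Tend (fst q) (snd q))"])
       (simp add: \<Phi>_def endpoint)
  \<comment> \<open>The pair \<open>(\<zeta>, \<tau>)\<close> lives in a space of the same dimension
    as the group, as invariance of domain requires.\<close>
  then have open\<Phi>: "open (\<Phi> ` S)"
    by (intro invariance_of_domain S) (auto simp: \<Phi>_def intro!: continuous_on_Pair cont\<zeta> cont\<tau>)
  define \<tau>0 where "\<tau>0 = \<tau> g0"
  have \<tau>0: "\<tau>0 \<in> \<Omega>"
  proof (rule ccontr)
    assume "\<tau>0 \<notin> \<Omega>"
    then have pi: "norm (J \<tau>0) = pi" using norm_le[OF S(2)] by (simp add: mem_Omega \<tau>0_def)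
    \<comment> \<open>On the boundary, openness of the image would admit a dilate
      \<open>(1 + c) \<tau>0\<close> with \<open>c > 0\<close>, whose operator norm
      \<open>(1 + c) * pi\<close> violates \<open>norm_le\<close>.\<close>
    have "((\<lambda>c::real. (\<zeta> g0, (1 + c) *\<^sub>R \<tau>0)) \<longlongrightarrow> (\<zeta> g0, (1 + 0) *\<^sub>R \<tau>0)) (at_right 0)"
      by (intro tendsto_intros)
    moreover have "(\<zeta> g0, (1 + 0) *\<^sub>R \<tau>0) \<in> \<Phi> ` S"
      using S(2) by (auto simp: \<Phi>_def \<tau>0_def)
    ultimately have "\<forall>\<^sub>F c in at_right 0. (\<zeta> g0, (1 + c) *\<^sub>R \<tau>0) \<in> \<Phi> ` S"
      using open\<Phi> topological_tendstoD by blast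
    moreover have "\<forall>\<^sub>F c::real in at_right 0. 0 < c" by (simp add: eventually_at_right_less)
    ultimately have "\<forall>\<^sub>F c in at_right 0. (\<zeta> g0, (1 + c) *\<^sub>R \<tau>0) \<in> \<Phi> ` S \<and> 0 < (c::real)"
      by (rule eventually_conj)
    then obtain c :: real where c: "(\<zeta> g0, (1 + c) *\<^sub>R \<tau>0) \<in> \<Phi> ` S" "0 < c"
      using eventually_happens' trivial_limit_at_right_real by blast
    then obtain g where "g \<in> S" "\<tau> g = (1 + c) *\<^sub>R \<tau>0" by (auto simp: \<Phi>_def)
    then have "(1 + c) * pi \<le> pi"
      using norm_le[of g] c(2) pi by (simp add: Jop_scaleR)
    then show False using mult_pos_pos[OF c(2) pi_gt_zero] by (simp add: distrib_right)
  qed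
  \<comment> \<open>Near \<open>g0\<close> all covectors now lie in \<open>\<Omega>\<close>, where
    \<open>GQ\<close> is continuous, so the critical equation extends from the dense set to a full
    neighbourhood and can be differentiated.\<close>
  define S' where "S' = S \<inter> \<tau> -` \<Omega>"
  have S': "open S'" "g0 \<in> S'"
    unfolding S'_def using continuous_open_preimage[OF cont\<tau> S(1) open_Omega] S(2) \<tau>0 by (auto simp: \<tau>0_def)
  have crit: "GQ (fst g, \<tau> g) = - 4 *\<^sub>R snd g" if "g \<in> S'" for g
  proof (rule continuous_eq_on_dense[OF dense S'(1) _ _ _ that])
    show "continuous_on S' (\<lambda>g. GQ (fst g, \<tau> g))"
      by (rule continuous_on_compose2[OF Ck_continuous_on[OF Ck_GQ]])
         (auto simp: S'_def intro!: continuous_intros continuous_on_subset[OF cont\<tau>])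
    show "continuous_on S' (\<lambda>g. - 4 *\<^sub>R snd g :: real^'m)" by (intro continuous_intros)
  qed (use onMM in \<open>auto simp: S'_def\<close>)
  obtain x0 t0 where g0: "g0 = (x0, t0)" by fastforce
  define DG where "DG = frechet_derivative GQ (at (x0, \<tau>0))"
  have "(GQ has_derivative DG) (at (x0, \<tau>0))"
    unfolding DG_def by (rule Ck_frechet_derivative(1)[OF open_W Ck_GQ]) (use \<tau>0 in auto)
  then have dH: "((\<lambda>\<sigma>. GQ (x0, \<sigma>)) has_derivative (\<lambda>h. DG (0, h))) (at \<tau>0)"
    by (rule has_derivative_compose[of "\<lambda>\<sigma>. (x0, \<sigma>)" "\<lambda>h. (0, h)", rotated]) (auto intro!: derivative_eq_intros)
  obtain \<tau>' where "(\<tau> has_derivative \<tau>') (at (x0, t0))" using diff\<tau>[OF S(2)] g0 by blast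
  then have da: "((\<lambda>t. \<tau> (x0, t)) has_derivative (\<lambda>h. \<tau>' (0, h))) (at t0)"
    by (rule has_derivative_compose[of "\<lambda>t. (x0, t)" "\<lambda>h. (0, h)", rotated]) (auto intro!: derivative_eq_intros)
  have "((\<lambda>t. GQ (x0, \<tau> (x0, t))) has_derivative (\<lambda>h. DG (0, \<tau>' (0, h)))) (at t0)"
    by (rule has_derivative_compose[OF da]) (use dH in \<open>simp add: \<tau>0_def g0\<close>)
  moreover have "((\<lambda>t. GQ (x0, \<tau> (x0, t))) has_derivative (\<lambda>h. - 4 *\<^sub>R h)) (at t0)"
  proof (rule has_derivative_transform_within_open)
    show "((\<lambda>t. - 4 *\<^sub>R t) has_derivative (\<lambda>h. - 4 *\<^sub>R h)) (at t0)"
      by (intro has_derivative_scaleR_right has_derivative_ident)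
    have "Pair x0 -` S' = {t. (x0, t) \<in> S'}" by auto
    then show "open (Pair x0 -` S')"
      by (intro open_vimage S'(1) continuous_intros)
    show "t0 \<in> Pair x0 -` S'" using S'(2) g0 by simp
    show "- 4 *\<^sub>R t = GQ (x0, \<tau> (x0, t))" if "t \<in> Pair x0 -` S'" for t
      using crit[of "(x0, t)"] that by simp
  qed
  ultimately have eq: "(\<lambda>h. DG (0, \<tau>' (0, h))) = (\<lambda>h. - 4 *\<^sub>R h)"
    by (rule has_derivative_unique)
  \<comment> \<open>The map sending \<open>k\<close> to \<open>\<tau>' (0, - k / 4)\<close> is a
    right inverse of the Hessian; in finite dimension a surjective endomorphism is
    injective.\<close>
  have "surj (\<lambda>h. DG (0, h))"
  proof (rule surjI)
    fix k :: "real^'m"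
    show "DG (0, \<tau>' (0, (- 1/4) *\<^sub>R k)) = k" using fun_cong[OF eq, of "(- 1/4) *\<^sub>R k"] by simp
  qed
  then have "inj (\<lambda>h. DG (0, h))"
    using has_derivative_linear[OF dH] linear_surjective_imp_injective by blast
  moreover have "GQ (x0, \<tau>0) = - 4 *\<^sub>R t0" using crit[OF S'(2)] by (simp add: g0 \<tau>0_def)
  ultimately show ?thesis unfolding g0 mem_MM_iff using \<tau>0 dH by blast
qed

end

theorem theorem2p12:
  fixes U :: "'m::finite \<Rightarrow> real^'q::finite^'q"
  assumes skew: "\<And>j. transpose (U j) = - U j"
    and indep: "\<And>c. (\<Sum>j\<in>UNIV. c j *\<^sub>R U j) = 0 \<Longrightarrow> (\<forall>j. c j = 0)"
    and dense: "closure (MM U) = UNIV"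
  shows "cut_locus U = UNIV - MM U"
proof -
  interpret skew_family U by (rule skew_family.intro) (rule skew)
  have "- cut_locus U \<subseteq> MM U"
    using smooth_imp_MM[OF dense] unfolding cut_locus_def by blast
  then show ?thesis using MM_not_cut by blast
qed

end
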